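(* Let $(p_1,p_2,p_3)$ be a H\"older related triplet with $p_1,p_2>1$, and let $J=[-\frac12,\frac12)$. Let $\phi\in M_{p_1,p_2}^{p_3}(\mathbb{T})$. Then the function $$\psi(\xi,\eta):=\sum_{n,m\in\mathbb{Z}}\phi(n,m)\,\chi_{J\times J}(\xi-n,\eta-m)$$ belongs to $M_{p_1,p_2}^{p_3}(\mathbb{R})$.
   Context: A triplet $(p_1,p_2,p_3)$ is H\"older related if $\frac1{p_1}+\frac1{p_2}=\frac1{p_3}$, where $p_1,p_2\ge 1$ and $p_3\ge \frac12$. $\chi_{J\times J}$ denotes the characteristic function of $J\times J$. $\hat f(\xi)=\int_{\mathbb{R}} f(x)e^{-2\pi i x\xi}\,dx$ denotes the Fourier transform on $\mathbb{R}$. $\mathbb{T}=\mathbb{R}/\mathbb{Z}$ is identified with $[-\frac12,\frac12)$ with Lebesgue measure; Fourier coefficients are $\hat F(n)=\int_{\mathbb{T}} F(x)e^{-2\pi i nx}\,dx$. Multipliers on $\mathbb{R}$: for $\psi\in L^\infty(\mathbb{R}^2)$ and Schwartz functions $f,g\in\mathcal{S}(\mathbb{R})$ put $C_\psi(f,g)(x)=\int_{\mathbb{R}}\int_{\mathbb{R}}\hat f(\xi)\hat g(\eta)\psi(\xi,\eta)e^{2\pi i x(\xi+\eta)}\,d\xi\,d\eta$. Then $\psi\in M_{p_1,p_2}^{p_3}(\mathbb{R})$ means that there is a constant $C$ with $\|C_\psi(f,g)\|_{L^{p_3}(\mathbb{R})}\le C\|f\|_{L^{p_1}(\mathbb{R})}\|g\|_{L^{p_2}(\mathbb{R})}$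 for all $f,g\in\mathcal{S}(\mathbb{R})$. Multipliers on $\mathbb{T}$: $\phi:\mathbb{Z}^2\to\mathbb{C}$ belongs to $M_{p_1,p_2}^{p_3}(\mathbb{T})$ if there is a constant $C$ such that, for all trigonometric polynomials $F,G$ on $\mathbb{T}$, the function $P_\phi(F,G)(x)=\sum_{n,m}\hat F(n)\hat G(m)\phi(n,m)e^{2\pi i x(n+m)}$ satisfies $\|P_\phi(F,G)\|_{L^{p_3}(\mathbb{T})}\le C\|F\|_{L^{p_1}(\mathbb{T})}\|G\|_{L^{p_2}(\mathbb{T})}$. *)

theory Defs
  imports "HOL-Analysis.Analysis"
begin

text \<open>All exponents are finite positive reals; the exponent \<open>\<infinity>\<close> is not part of the set-up.\<close>

definition holder_related :: "real \<Rightarrow> real \<Rightarrow> real \<Rightarrow> bool" where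
  "holder_related p1 p2 p3 \<longleftrightarrow>
     p1 \<ge> 1 \<and> p2 \<ge> 1 \<and> p3 \<ge> 1/2 \<and> 1 / p1 + 1 / p2 = 1 / p3"

text \<open>The (quasi-)norm of \<open>L\<^sup>p(M)\<close>.  It is \<open>ennreal\<close>-valued, so that a bound on it by a finite
  quantity includes the assertion that the function is in \<open>L\<^sup>p\<close>; a Bochner integral would return
  \<open>0\<close> for a function outside \<open>L\<^sup>p\<close>.\<close>

definition lp_norm :: "real \<Rightarrow> 'a measure \<Rightarrow> ('a \<Rightarrow> complex) \<Rightarrow> ennreal" where
  "lp_norm p M f =
     (let I = (\<integral>\<^sup>+ x. ennreal (norm (f x) powr p) \<partial>M)
      in if I = \<infinity> then \<infinity> else ennreal (enn2real I powr (1 / p)))"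

text \<open>Here \<open>D k\<close> is the \<open>k\<close>-th derivative of \<open>f\<close>.\<close>

definition schwartz :: "(real \<Rightarrow> complex) \<Rightarrow> bool" where
  "schwartz f \<longleftrightarrow>
     (\<exists>D :: nat \<Rightarrow> real \<Rightarrow> complex. D 0 = f \<and>
        (\<forall>k x. (D k has_vector_derivative D (Suc k) x) (at x)) \<and>
        (\<forall>j k. bounded (range (\<lambda>x. x ^ j *\<^sub>R D k x))))"

definition fourier :: "(real \<Rightarrow> complex) \<Rightarrow> real \<Rightarrow> complex" where
  "fourier f \<xi> = (LINT x|lebesgue. f x * cis (- (2 * pi * x * \<xi>)))"

definition L_infinity_plane :: "(real \<times> real \<Rightarrow> complex) set" where
  "L_infinity_plane =
     {\<psi>. \<psi> \<in> borel_measurable lebesgue \<and> (\<exists>B. AE z in lebesgue. norm (\<psi> z) \<le> B)}"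

text \<open>The integrals are taken with respect to \<open>lebesgue\<close> rather than \<open>lborel\<close>: for a symbol that
  is only Lebesgue measurable, the inner integral is in general only a Lebesgue measurable function
  of the outer variable.\<close>

definition bilinear_op_R ::
    "(real \<times> real \<Rightarrow> complex) \<Rightarrow> (real \<Rightarrow> complex) \<Rightarrow> (real \<Rightarrow> complex) \<Rightarrow> real \<Rightarrow> complex" where
  "bilinear_op_R \<psi> f g x =
     (LINT \<eta>|lebesgue. LINT \<xi>|lebesgue.
        fourier f \<xi> * fourier g \<eta> * \<psi> (\<xi>, \<eta>) * cis (2 * pi * x * (\<xi> + \<eta>)))"

definition multipliers_R :: "real \<Rightarrow> real \<Rightarrow> real \<Rightarrow> (real \<times> real \<Rightarrow> complex) set" where
  "multipliers_R p1 p2 p3 =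
     {\<psi> \<in> L_infinity_plane. \<exists>C\<ge>0. \<forall>f g. schwartz f \<longrightarrow> schwartz g \<longrightarrow>
        lp_norm p3 lebesgue (bilinear_op_R \<psi> f g)
          \<le> ennreal C * lp_norm p1 lebesgue f * lp_norm p2 lebesgue g}"

definition J :: "real set" where
  "J = {-1/2..<1/2}"

text \<open>\<open>J\<close> with Lebesgue measure serves as the torus \<open>\<real>/\<int>\<close>; functions on the torus are
  represented by 1-periodic functions on \<open>\<real>\<close>.\<close>

abbreviation torus :: "real measure" where
  "torus \<equiv> lebesgue_on J"

definition trig_polynomial :: "(real \<Rightarrow> complex) \<Rightarrow> bool" where
  "trig_polynomial F \<longleftrightarrow>
     (\<exists>(S :: int set) c. finite S \<and> F = (\<lambda>x. \<Sum>n\<in>S. c n * cis (2 * pi * real_of_int n * x)))"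

definition fourier_coeff :: "(real \<Rightarrow> complex) \<Rightarrow> int \<Rightarrow> complex" where
  "fourier_coeff F n = (LINT x|torus. F x * cis (- (2 * pi * real_of_int n * x)))"

text \<open>For trigonometric polynomials only finitely many terms of the sum are nonzero.\<close>

definition bilinear_op_T ::
    "(int \<times> int \<Rightarrow> complex) \<Rightarrow> (real \<Rightarrow> complex) \<Rightarrow> (real \<Rightarrow> complex) \<Rightarrow> real \<Rightarrow> complex" where
  "bilinear_op_T \<phi> F G x =
     (\<Sum>\<^sub>\<infinity>(n, m)\<in>UNIV. fourier_coeff F n * fourier_coeff G m * \<phi> (n, m)
                        * cis (2 * pi * x * real_of_int (n + m)))"

definition multipliers_T :: "real \<Rightarrow> real \<Rightarrow> real \<Rightarrow> (int \<times> int \<Rightarrow> complex) set" where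
  "multipliers_T p1 p2 p3 =
     {\<phi>. \<exists>C\<ge>0. \<forall>F G. trig_polynomial F \<longrightarrow> trig_polynomial G \<longrightarrow>
        lp_norm p3 torus (bilinear_op_T \<phi> F G)
          \<le> ennreal C * lp_norm p1 torus F * lp_norm p2 torus G}"

end

theory Submission
  imports Defs "HOL-Complex_Analysis.Cauchy_Integral_Theorem"
begin

text \<open>Write \<open>e(u) = exp(2 \<pi> i u)\<close>.  The symbol is the constant \<open>\<phi>(n, m)\<close> on the unit square
  centred at \<open>(n, m)\<close>, so the operator on the line is
  \<open>T(f, g)(x) = \<Sum> \<phi>(n, m) A_n(x) B_m(x)\<close>, where \<open>A_n\<close> and \<open>B_m\<close> are the parts of \<open>f\<close> and \<open>g\<close> with
  frequencies in \<open>n + J\<close> and \<open>m + J\<close>.  For \<open>x = l + \<theta>\<close> with an integer \<open>l\<close> and \<open>\<theta> \<in> J\<close>, the relation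
  \<open>e(l n) = 1\<close> gives \<open>A_n(l + \<theta>) = e(n \<theta>) \<integral>_J f^(n + t) e(t l) e(t \<theta>) dt\<close>.  Without the factor
  \<open>e(t \<theta>)\<close>, \<open>T(f, g)(l + \<theta>)\<close> would be the value at \<open>\<theta>\<close> of the periodic operator applied to two
  periodic functions that depend on \<open>l\<close> only, and the hypothesis could be integrated over \<open>\<theta>\<close> and
  summed over \<open>l\<close>.  The Taylor series of \<open>e(t \<theta>)\<close> reduces the general case to this one:
  \<open>T(f, g)(l + \<theta>) = \<Sum>_{i,k} (2 \<pi> i \<theta>)^{i+k} / (i! k!) P_\<phi>(F_{i,l}, G_{k,l})(\<theta>)\<close>, where \<open>F_{i,l}\<close> has the
  Fourier coefficients \<open>\<integral>_J f^(n + t) t^i e(t l) dt\<close>.  The factorials make the double sum converge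
  so fast that it can be estimated termwise in \<open>L^{p3}\<close> even when \<open>p3 < 1\<close>
  (\<open>weighted_double_sum_powr\<close>).

  What has to be shown is \<open>\<Sum>_l \<integral>_J |F_{i,l}|^p \<le> A \<integral> |f|^p\<close> with \<open>A\<close> independent of \<open>i\<close>
  (\<open>cell_poly_power_sum\<close>); Hoelder's inequality in \<open>l\<close> then combines the two factors.  By Poisson
  summation, \<open>F_{i,l}(\<theta>) = \<Sum>_k f(\<theta> + k) \<kappa>_i(l - k - \<theta>)\<close> with \<open>\<kappa>_i(x) = \<integral>_J t^i e(t x) dt\<close>, so for
  fixed \<open>\<theta>\<close> the sequence \<open>l \<mapsto> F_{i,l}(\<theta>)\<close> is a convolution of \<open>k \<mapsto> f(\<theta> + k)\<close> with a kernel on the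
  integers.  Two integrations by parts show that the kernel at \<open>d\<close> is \<open>c (-1)^d / d + O(1/d^2)\<close>,
  uniformly in \<open>i\<close> and \<open>\<theta>\<close> (\<open>moment_kernel_estimate\<close>).  The estimate is therefore M. Riesz's theorem
  for the discrete Hilbert transform on \<open>l^p\<close>, and this is where \<open>1 < p < \<infinity>\<close> enters.

  Riesz's theorem is proved by complex analysis.  For nonnegative finitely supported \<open>a\<close>, the
  function \<open>F(z) = \<Sum> a_k i / (z - k)\<close> has positive real part in the upper half-plane, so \<open>F^p\<close> is
  holomorphic there, and it is \<open>O(|z|^{-p})\<close>; its integral along the line \<open>Im z = 1\<close> vanishes.  With
  the pointwise inequality \<open>|Im w|^p \<le> A (Re w)^p - B Re(w^p)\<close> (\<open>abs_Im_powr_le\<close>) the conjugate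
  Poisson sum \<open>Im F\<close> is bounded by the Poisson sum \<open>Re F\<close>, and at height 1 both can be compared with
  sums over the integers.  This covers \<open>1 < p \<le> 2\<close>, and duality gives \<open>p > 2\<close>.

  Frequencies and Taylor degrees are truncated at \<open>N\<close> throughout, so that only finite sums are
  rearranged; the limit is taken once, by Fatou's lemma.\<close>

section \<open>Inequalities for finite sums\<close>

lemma weighted_am_gm:
  fixes u v r s :: real
  assumes "0 \<le> u" "0 \<le> v" "0 < r" "0 < s" "r + s = 1"
  shows "u powr r * v powr s \<le> r * u + s * v"
proof (cases "u = 0 \<or> v = 0")
  case True
  then show ?thesis using assms by auto
next
  case False
  with assms have pos: "u > 0" "v > 0" by auto
  define m where "m = r * u + s * v"
  have m: "m > 0" unfolding m_def using pos assms by (simp add: add_pos_pos)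
  have "r * ln (u / m) + s * ln (v / m) \<le> r * (u / m - 1) + s * (v / m - 1)"
    using pos m assms by (intro add_mono mult_left_mono ln_le_minus_one) auto
  also have "\<dots> = (r * u + s * v) / m - (r + s)"
    by (simp add: field_simps add_divide_distrib)
  also have "\<dots> = 0" using m assms unfolding m_def by simp
  finally have "r * ln u + s * ln v \<le> (r + s) * ln m"
    using pos m by (simp add: ln_div algebra_simps)
  then have "r * ln u + s * ln v \<le> ln m" using assms by simp
  then have "exp (r * ln u + s * ln v) \<le> exp (ln m)" by simp
  then show ?thesis using pos m by (simp add: powr_def exp_add m_def)
qed

lemma holder_sum:
  fixes a b :: "'i \<Rightarrow> real"
  assumes "0 < r" "0 < s" "r + s = 1" "finite A"
    and a: "\<And>i. i \<in> A \<Longrightarrow> 0 \<le> a i" and b: "\<And>i. i \<in> A \<Longrightarrow> 0 \<le> b i"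
  shows "(\<Sum>i\<in>A. a i powr r * b i powr s) \<le> (\<Sum>i\<in>A. a i) powr r * (\<Sum>i\<in>A. b i) powr s"
proof (cases "(\<Sum>i\<in>A. a i) = 0 \<or> (\<Sum>i\<in>A. b i) = 0")
  case True
  then have "\<And>i. i \<in> A \<Longrightarrow> a i powr r * b i powr s = 0"
    using assms by (auto simp: sum_nonneg_eq_0_iff)
  then have "(\<Sum>i\<in>A. a i powr r * b i powr s) = 0" by (rule sum.neutral[rule_format])
  then show ?thesis by simp
next
  case False
  define X where "X = (\<Sum>i\<in>A. a i)"
  define Y where "Y = (\<Sum>i\<in>A. b i)"
  have X: "X > 0" and Y: "Y > 0"
    using False a b unfolding X_def Y_def by (auto simp: less_le sum_nonneg)
  have "a i powr r * b i powr s \<le> X powr r * Y powr s * (r * (a i / X) + s * (b i / Y))"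
    if "i \<in> A" for i
  proof -
    have "(a i / X) powr r * (b i / Y) powr s \<le> r * (a i / X) + s * (b i / Y)"
      using a b that X Y assms by (intro weighted_am_gm) auto
    then have "X powr r * Y powr s * ((a i / X) powr r * (b i / Y) powr s)
        \<le> X powr r * Y powr s * (r * (a i / X) + s * (b i / Y))"
      by (intro mult_left_mono) auto
    moreover have "X powr r * Y powr s * ((a i / X) powr r * (b i / Y) powr s)
        = a i powr r * b i powr s"
      using a b that X Y by (simp add: powr_divide)
    ultimately show ?thesis by simp
  qed
  then have "(\<Sum>i\<in>A. a i powr r * b i powr s)
      \<le> (\<Sum>i\<in>A. X powr r * Y powr s * (r * (a i / X) + s * (b i / Y)))"
    by (rule sum_mono)
  also have "\<dots> = X powr r * Y powr s * (r * ((\<Sum>i\<in>A. a i) / X) + s * ((\<Sum>i\<in>A. b i) / Y))"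
    by (simp add: sum_distrib_left sum.distrib sum_divide_distrib distrib_left)
  also have "\<dots> = X powr r * Y powr s"
    using X Y assms unfolding X_def[symmetric] Y_def[symmetric] by simp
  finally show ?thesis by (simp add: X_def Y_def)
qed

lemma powr_add_le:
  fixes x y p :: real
  assumes "0 \<le> x" "0 \<le> y" "0 < p"
  shows "(x + y) powr p \<le> 2 powr p * (x powr p + y powr p)"
proof -
  have "(x + y) powr p \<le> (2 * max x y) powr p"
    using assms by (intro powr_mono2) auto
  also have "\<dots> = 2 powr p * (max x y) powr p"
    using assms by (simp add: powr_mult)
  also have "(max x y) powr p \<le> x powr p + y powr p"
    by (auto simp: max_def)
  finally show ?thesis by simp
qed

lemma frac_le_cross: "b > 0 \<Longrightarrow> d > 0 \<Longrightarrow> a * d \<le> c * b \<Longrightarrow> a / b \<le> c / (d::real)"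
  by (simp add: divide_simps mult.commute)

lemma inverse_quadratic_step:
  "2 / (1 + (real M + 1)\<^sup>2) \<le> 3 / (real M + 1) - 3 / (real M + 2)"
proof -
  have "2 / (1 + (real M + 1)\<^sup>2) \<le> 3 / ((real M + 1) * (real M + 2))"
    by (rule frac_le_cross) (auto simp: power2_eq_square algebra_simps add_pos_nonneg)
  also have "\<dots> = 3 / (real M + 1) - 3 / (real M + 2)" by (simp add: field_simps)
  finally show ?thesis .
qed

lemma symmetric_sum_Suc:
  fixes f :: "int \<Rightarrow> 'a::comm_monoid_add"
  shows "(\<Sum>n\<in>{- int (Suc M)..int (Suc M)}. f n) = f (int M + 1) + (f (- int M - 1) + (\<Sum>n\<in>{- int M..int M}. f n))"
proof -
  have "{- int (Suc M)..int (Suc M)} = insert (int M + 1) (insert (- int M - 1) {- int M..int M})" by auto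
  then show ?thesis by simp
qed

text \<open>Compared with the telescoping series of \<open>3 / (i + 1) - 3 / (i + 2)\<close>, the tail over
  \<open>|n| > M\<close> of a sequence of quadratic decay is \<open>O(1/M)\<close>.\<close>

lemma symmetric_tail_le:
  fixes f :: "int \<Rightarrow> 'a::real_normed_vector"
  assumes f: "\<And>n. norm (f n) \<le> C / (1 + (of_int n)\<^sup>2)" and "M \<le> M'"
  shows "norm ((\<Sum>n\<in>{- int M'..int M'}. f n) - (\<Sum>n\<in>{- int M..int M}. f n)) \<le> 3 * C / (real M + 1)"
proof -
  have C: "C \<ge> 0" using order_trans[OF norm_ge_zero f[of 0]] by simp
  have "norm ((\<Sum>n\<in>{- int M'..int M'}. f n) - (\<Sum>n\<in>{- int M..int M}. f n)) \<le> C * (3 / (real M + 1) - 3 / (real M' + 1))"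
    using assms(2)
  proof (induction M' rule: dec_induct)
    case (step i)
    have e: "(- real i - 1)\<^sup>2 = (real i + 1)\<^sup>2" by (simp add: power2_eq_square algebra_simps)
    have "norm ((\<Sum>n\<in>{- int (Suc i)..int (Suc i)}. f n) - (\<Sum>n\<in>{- int M..int M}. f n))
       \<le> norm (f (int i + 1)) + (norm (f (- int i - 1)) + norm ((\<Sum>n\<in>{- int i..int i}. f n) - (\<Sum>n\<in>{- int M..int M}. f n)))"
      unfolding symmetric_sum_Suc add_diff_eq[symmetric]
      by (intro order_trans[OF norm_triangle_ineq] add_mono order_refl)
    also have "\<dots> \<le> C / (1 + (real i + 1)\<^sup>2) + (C / (1 + (real i + 1)\<^sup>2) + C * (3 / (real M + 1) - 3 / (real i + 1)))"
      using f[of "int i + 1"] f[of "- int i - 1"] step.IH by (intro add_mono) (auto simp: e)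
    also have "\<dots> = C * (2 / (1 + (real i + 1)\<^sup>2)) + C * (3 / (real M + 1) - 3 / (real i + 1))"
      by simp
    also have "\<dots> \<le> C * (3 / (real i + 1) - 3 / (real i + 2)) + C * (3 / (real M + 1) - 3 / (real i + 1))"
      by (intro add_right_mono mult_left_mono inverse_quadratic_step C)
    also have "\<dots> = C * (3 / (real M + 1) - 3 / (real (Suc i) + 1))"
      by (simp add: algebra_simps)
    finally show ?case .
  qed simp
  also have "\<dots> \<le> C * (3 / (real M + 1))" using C by (intro mult_left_mono) auto
  finally show ?thesis by (simp add: mult.commute)
qed

lemma inverse_quadratic_sum_le:
  fixes N :: "int set"
  assumes "finite N"
  shows "(\<Sum>n\<in>N. 1 / (1 + (real_of_int (n - k))\<^sup>2)) \<le> 4"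
proof -
  define M where "M = nat (Max (insert 0 (abs ` (\<lambda>n. n - k) ` N)))"
  have "(\<Sum>n\<in>N. 1 / (1 + (real_of_int (n - k))\<^sup>2)) = (\<Sum>n\<in>(\<lambda>n. n - k) ` N. 1 / (1 + (real_of_int n)\<^sup>2))"
    by (subst sum.reindex) (auto simp: inj_on_def)
  also have "\<dots> \<le> (\<Sum>n\<in>{- int M..int M}. 1 / (1 + (real_of_int n)\<^sup>2))"
  proof (rule sum_mono2)
    show "(\<lambda>n. n - k) ` N \<subseteq> {- int M..int M}"
    proof
      fix m assume "m \<in> (\<lambda>n. n - k) ` N"
      then have "\<bar>m\<bar> \<le> Max (insert 0 (abs ` (\<lambda>n. n - k) ` N))"
        using assms by (intro Max_ge) auto
      then show "m \<in> {- int M..int M}" by (auto simp: M_def)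
    qed
  qed auto
  also have "\<dots> \<le> 4"
    using symmetric_tail_le[of "\<lambda>n. 1 / (1 + (real_of_int n)\<^sup>2)" 1 0 M] by simp
  finally show ?thesis .
qed

text \<open>Schur's test: the kernel \<open>1 / (1 + (n - k)^2)\<close> has mass at most 4 in each variable.\<close>

lemma schur_powr_sum:
  fixes a :: "int \<Rightarrow> real"
  assumes p: "p > 1" and "finite N" "finite K" and a: "\<And>k. 0 \<le> a k"
  shows "(\<Sum>n\<in>N. (\<Sum>k\<in>K. a k / (1 + (real_of_int (n - k))\<^sup>2)) powr p)
           \<le> 4 powr p * (\<Sum>k\<in>K. a k powr p)"
proof -
  define w where "w n k = 1 / (1 + (real_of_int (n - k))\<^sup>2)" for n k
  have w0: "w n k > 0" for n k by (simp add: w_def add_pos_nonneg)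
  have wsum: "(\<Sum>k\<in>K. w n k) \<le> 4" for n
  proof -
    have "(\<Sum>k\<in>K. w n k) = (\<Sum>k\<in>K. 1 / (1 + (real_of_int (k - n))\<^sup>2))"
      by (simp add: w_def power2_commute)
    then show ?thesis using inverse_quadratic_sum_le[OF assms(3), of n] by simp
  qed
  have 1: "(\<Sum>k\<in>K. a k * w n k) powr p \<le> 4 powr (p - 1) * (\<Sum>k\<in>K. a k powr p * w n k)" for n
  proof -
    \<comment> \<open>The weight is split as \<open>w^(1/p) w^(1 - 1/p)\<close> for Hoelder's inequality.\<close>
    have "a k * w n k = (a k powr p * w n k) powr (1/p) * (w n k) powr (1 - 1/p)" for k
    proof -
      have "(a k powr p * w n k) powr (1/p) * (w n k) powr (1 - 1/p)
          = a k * (w n k powr (1/p) * w n k powr (1 - 1/p))"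
        using a[of k] w0[of n k] p by (simp add: powr_mult powr_powr)
      also have "w n k powr (1/p) * w n k powr (1 - 1/p) = w n k"
        using w0[of n k] by (simp add: powr_add[symmetric])
      finally show ?thesis by simp
    qed
    then have "(\<Sum>k\<in>K. a k * w n k)
        = (\<Sum>k\<in>K. (a k powr p * w n k) powr (1/p) * (w n k) powr (1 - 1/p))" by simp
    also have "\<dots> \<le> (\<Sum>k\<in>K. a k powr p * w n k) powr (1/p) * (\<Sum>k\<in>K. w n k) powr (1 - 1/p)"
      using assms w0 by (intro holder_sum) (auto intro!: mult_nonneg_nonneg less_imp_le[OF w0])
    also have "\<dots> \<le> (\<Sum>k\<in>K. a k powr p * w n k) powr (1/p) * 4 powr (1 - 1/p)"
      using wsum p sum_nonneg[of K "w n"] less_imp_le[OF w0] by (intro mult_left_mono powr_mono2) auto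
    finally have "(\<Sum>k\<in>K. a k * w n k) powr p
        \<le> ((\<Sum>k\<in>K. a k powr p * w n k) powr (1/p) * 4 powr (1 - 1/p)) powr p"
      using p a less_imp_le[OF w0]
      by (intro powr_mono2) (auto intro!: sum_nonneg mult_nonneg_nonneg)
    also have "\<dots> = 4 powr (p - 1) * (\<Sum>k\<in>K. a k powr p * w n k)"
    proof -
      have "(1 - 1/p) * p = p - 1" using p by (simp add: field_simps)
      moreover have "(\<Sum>k\<in>K. a k powr p * w n k) \<ge> 0"
        using less_imp_le[OF w0] by (auto intro!: sum_nonneg mult_nonneg_nonneg)
      ultimately show ?thesis using p by (simp add: powr_mult powr_powr mult.commute)
    qed
    finally show ?thesis .
  qed
  have "(\<Sum>n\<in>N. (\<Sum>k\<in>K. a k * w n k) powr p)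
      \<le> (\<Sum>n\<in>N. 4 powr (p - 1) * (\<Sum>k\<in>K. a k powr p * w n k))"
    by (intro sum_mono 1)
  also have "\<dots> = 4 powr (p - 1) * (\<Sum>k\<in>K. a k powr p * (\<Sum>n\<in>N. w n k))"
    by (simp add: sum_distrib_left sum.swap[of _ N K] mult.assoc)
  also have "\<dots> \<le> 4 powr (p - 1) * (\<Sum>k\<in>K. a k powr p * 4)"
    using inverse_quadratic_sum_le[OF assms(2)] unfolding w_def
    by (intro mult_left_mono sum_mono) auto
  also have "\<dots> = 4 powr (p - 1) * 4 powr 1 * (\<Sum>k\<in>K. a k powr p)"
    by (simp add: sum_distrib_right[symmetric])
  also have "\<dots> = 4 powr p * (\<Sum>k\<in>K. a k powr p)"
    by (simp only: powr_add[symmetric]) simp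
  finally show ?thesis by (simp add: w_def)
qed

section \<open>The discrete Hilbert transform\<close>

lemma Re_powr_of_real:
  assumes "w \<noteq> 0"
  shows "Re (w powr of_real p) = cmod w powr p * cos (p * Arg w)"
  using assms by (simp add: powr_def Re_exp Arg_eq_Im_Ln)

text \<open>In polar coordinates the claim is \<open>|sin t|^p \<le> A cos^p t - B cos(p t)\<close> for \<open>|t| < \<pi>/2\<close>.
  Close to \<open>\<plusminus>\<pi>/2\<close> the angle \<open>p |t|\<close> lies in \<open>(\<pi>/2, \<pi>]\<close>, because \<open>1 < p \<le> 2\<close>, and so \<open>- B cos(p t)\<close> is
  positive and dominates; elsewhere \<open>cos t\<close> is bounded below.  The term with \<open>B\<close> is the real part of a
  holomorphic function and disappears after integration.\<close>

lemma abs_Im_powr_le: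
  fixes p :: real
  assumes p: "1 < p" "p \<le> 2"
  shows "\<exists>A\<ge>0. \<exists>B\<ge>0. \<forall>w. Re w > 0 \<longrightarrow>
           \<bar>Im w\<bar> powr p \<le> A * Re w powr p - B * Re (w powr of_real p)"
proof -
  \<comment> \<open>The midpoint of \<open>\<pi> / (2 p)\<close> and \<open>\<pi> / 2\<close>: beyond it \<open>cos(p t)\<close> is at most \<open>- d < 0\<close>.\<close>
  define t0 where "t0 = (pi/2 + pi/(2*p)) / 2"
  have pit: "pi / (2*p) < pi/2" using p by (simp add: field_simps)
  have t0: "0 < t0" "t0 < pi/2" "pi/2 < p * t0" "p * t0 < pi"
    using p pit pi_gt_zero unfolding t0_def
      apply (simp_all add: field_simps)
    by (smt (verit) mult_less_cancel_right2 mult_left_mono pi_gt_zero)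
  define d where "d = - cos (p * t0)"
  have d: "d > 0"
  proof -
    have "cos (p * t0) < cos (pi/2)" using t0 by (intro cos_monotone_0_pi) auto
    then show ?thesis by (simp add: d_def)
  qed
  have c0: "cos t0 > 0" using t0 by (intro cos_gt_zero) auto
  define B where "B = 1 / d"
  define A where "A = (1 + B) / cos t0 powr p"
  have "\<bar>Im w\<bar> powr p \<le> A * Re w powr p - B * Re (w powr of_real p)" if w: "Re w > 0" for w
  proof -
    have w0: "w \<noteq> 0" using w by auto
    define t where "t = Arg w"
    have t: "\<bar>t\<bar> < pi/2" unfolding t_def using Arg_Re_pos[of w] w w0 by (auto simp: abs_less_iff)
    have polar: "w = of_real (cmod w) * cis t"
      unfolding t_def using w0 by (metis Arg_eq cis_conv_exp mult.commute)
    have Re: "Re w = cmod w * cos t" and Im: "Im w = cmod w * sin t"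
      by (subst polar, simp)+
    have key: "\<bar>sin t\<bar> powr p \<le> A * cos t powr p - B * cos (p * t)"
    proof -
      have s1: "\<bar>sin t\<bar> powr p \<le> 1" using p by (intro powr_le1) auto
      have ct: "cos t > 0" using t by (intro cos_gt_zero_pi) auto
      have cabs: "cos \<bar>t\<bar> = cos t" "cos (p * \<bar>t\<bar>) = cos (p * t)"
        using p by (auto simp: abs_if)
      have B0: "B > 0" using d by (simp add: B_def)
      show ?thesis
      proof (cases "\<bar>t\<bar> \<le> t0")
        case True
        have "cos t0 \<le> cos \<bar>t\<bar>" using True t0 by (intro cos_monotone_0_pi_le) auto
        then have "cos t0 powr p \<le> cos t powr p" using c0 cabs p by (intro powr_mono2) auto
        then have "A * cos t0 powr p \<le> A * cos t powr p"
          using B0 c0 by (intro mult_left_mono) (auto simp: A_def)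
        moreover have "A * cos t0 powr p = 1 + B" using c0 by (simp add: A_def)
        moreover have "B * cos (p * t) \<le> B * 1" using B0 by (intro mult_left_mono) auto
        ultimately show ?thesis using s1 by linarith
      next
        case False
        have "p * \<bar>t\<bar> \<le> 2 * \<bar>t\<bar>" using p by (intro mult_right_mono) auto
        then have "p * \<bar>t\<bar> \<le> pi" using t by linarith
        moreover have "p * t0 \<le> p * \<bar>t\<bar>" using False p by auto
        ultimately have "cos (p * \<bar>t\<bar>) \<le> cos (p * t0)"
          using t0 p by (intro cos_monotone_0_pi_le) auto
        then have "B * cos (p * t) \<le> B * (- d)" using B0 cabs
          by (intro mult_left_mono) (auto simp: d_def)
        then have "B * cos (p * t) \<le> - 1" using d by (simp add: B_def)
        moreover have "A * cos t powr p \<ge> 0" using B0 by (simp add: A_def)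
        ultimately show ?thesis using s1 by linarith
      qed
    qed
    have "\<bar>Im w\<bar> powr p = cmod w powr p * \<bar>sin t\<bar> powr p"
      by (simp add: Im abs_mult powr_mult)
    also have "\<dots> \<le> cmod w powr p * (A * cos t powr p - B * cos (p * t))"
      using key by (intro mult_left_mono) auto
    also have "\<dots> = A * (cmod w powr p * cos t powr p) - B * (cmod w powr p * cos (p * t))"
      by (simp add: algebra_simps)
    also have "cmod w powr p * cos t powr p = Re w powr p"
      using t by (simp add: Re powr_mult cos_ge_zero)
    also have "cmod w powr p * cos (p * t) = Re (w powr of_real p)"
      using Re_powr_of_real[OF w0] by (simp add: t_def)
    finally show ?thesis .
  qed
  moreover have "A \<ge> 0" "B \<ge> 0" using d by (auto simp: A_def B_def)
  ultimately show ?thesis by blast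
qed

text \<open>A primitive of \<open>G\<close> turns the integral into a difference of two values, which is estimated
  along the other three sides of the rectangle with vertices \<open>\<plusminus>R + i\<close> and \<open>\<plusminus>R + i R\<close>.  On these sides
  \<open>|z| \<ge> R\<close>, and their total length is at most \<open>4 R\<close>.\<close>

lemma integral_horizontal_line_tendsto_0:
  fixes G :: "complex \<Rightarrow> complex"
  assumes holo: "G holomorphic_on {z. Im z > 0}" and p: "p > 1"
    and bound: "\<And>z. Im z > 0 \<Longrightarrow> norm z \<ge> R0 \<Longrightarrow> norm (G z) \<le> M * norm z powr (- p)"
  shows "((\<lambda>R. integral {-R..R} (\<lambda>x. G (Complex x 1))) \<longlongrightarrow> 0) at_top"
proof -
  have cvx: "convex {z. Im z > 0}" by (rule convex_halfspace_Im_gt)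
  have opn: "open {z. Im z > 0}" by (rule open_halfspace_Im_gt)
  obtain \<Phi> where \<Phi>: "\<And>z. z \<in> {z. Im z > 0} \<Longrightarrow> (\<Phi> has_field_derivative G z) (at z within {z. Im z > 0})"
    using holomorphic_convex_primitive'[OF cvx opn holo] by blast
  have \<Phi>': "(\<Phi> has_field_derivative G z) (at z)" if "Im z > 0" for z
    using \<Phi>[of z] that by (simp add: at_within_open[OF _ opn])
  have int: "integral {-R..R} (\<lambda>x. G (Complex x 1)) = \<Phi> (Complex R 1) - \<Phi> (Complex (-R) 1)"
    if "R \<ge> 0" for R
  proof -
    have der: "((\<lambda>x. \<Phi> (Complex x 1)) has_vector_derivative G (Complex x 1)) (at x within {-R..R})" for x
    proof -
      have "((\<lambda>x. Complex x 1) has_vector_derivative 1) (at x within {-R..R})"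
        unfolding Complex_eq by (auto intro!: derivative_eq_intros)
      from field_vector_diff_chain_within[OF this, of \<Phi> "G (Complex x 1)"] 
      show ?thesis using \<Phi>'[of "Complex x 1"]
        by (auto simp: o_def intro: has_field_derivative_at_within)
    qed
    show ?thesis
      using fundamental_theorem_of_calculus[of "-R" R "\<lambda>x. \<Phi> (Complex x 1)" "\<lambda>x. G (Complex x 1)"] der that
      by (auto intro!: integral_unique)
  qed
  have seg: "norm (\<Phi> b - \<Phi> a) \<le> M * R powr (- p) * norm (b - a)"
    if R: "R \<ge> max R0 1" and s: "\<And>z. z \<in> closed_segment a b \<Longrightarrow> Im z > 0 \<and> norm z \<ge> R" for a b R
  proof (rule field_differentiable_bound[of "closed_segment a b" \<Phi> G])
    fix z assume z: "z \<in> closed_segment a b"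
    show "(\<Phi> has_field_derivative G z) (at z within closed_segment a b)"
      using \<Phi>' s[OF z] by (auto intro: has_field_derivative_at_within)
    have M: "M \<ge> 0"
    proof -
      have "0 \<le> M * norm z powr (- p)" using bound[of z] s[OF z] R
        by (metis max.bounded_iff norm_ge_zero order_trans)
      moreover have "norm z powr (- p) > 0" using s[OF z] by (simp) (metis less_irrefl zero_complex.simps(2))
      ultimately show ?thesis by (simp add: zero_le_mult_iff)
    qed
    have "norm (G z) \<le> M * norm z powr (- p)" using bound[of z] s[OF z] R by auto
    also have "norm z powr (- p) \<le> R powr (- p)" using s[OF z] R p by (intro powr_mono2') auto
    finally show "norm (G z) \<le> M * R powr (- p)" using M by (simp add: mult_left_mono)
  qed auto
  have est: "norm (integral {-R..R} (\<lambda>x. G (Complex x 1))) \<le> 4 * M * R powr (1 - p)"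
    if R: "R \<ge> max R0 1" for R
  proof -
    have seg_re: "Re z = c \<and> Im z \<ge> 1" if zseg: "z \<in> closed_segment (Complex c y1) (Complex c y2)" and y12: "y1 \<ge> 1" "y2 \<ge> 1" for z c y1 y2
    proof -
      obtain u where u: "0 \<le> u" "u \<le> 1" "z = (1 - u) *\<^sub>R Complex c y1 + u *\<^sub>R Complex c y2"
        using zseg by (auto simp: in_segment)
      have "Re z = c" unfolding u(3) by (simp add: algebra_simps)
      moreover have "(1 - u) * 1 + u * 1 \<le> (1 - u) * y1 + u * y2"
        using u y12 by (intro add_mono mult_left_mono) auto
      ultimately show ?thesis using u by simp
    qed
    have s1: "norm (\<Phi> (Complex R R) - \<Phi> (Complex R 1)) \<le> M * R powr (- p) * norm (Complex R R - Complex R 1)"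
    proof (rule seg[OF R])
      fix z assume "z \<in> closed_segment (Complex R 1) (Complex R R)"
      from seg_re[OF this] R show "Im z > 0 \<and> norm z \<ge> R" using abs_Re_le_cmod[of z] by auto
    qed
    have s3: "norm (\<Phi> (Complex (-R) 1) - \<Phi> (Complex (-R) R)) \<le> M * R powr (- p) * norm (Complex (-R) 1 - Complex (-R) R)"
    proof (rule seg[OF R])
      fix z assume "z \<in> closed_segment (Complex (-R) R) (Complex (-R) 1)"
      from seg_re[OF this] R show "Im z > 0 \<and> norm z \<ge> R" using abs_Re_le_cmod[of z] by auto
    qed
    have s2: "norm (\<Phi> (Complex (-R) R) - \<Phi> (Complex R R)) \<le> M * R powr (- p) * norm (Complex (-R) R - Complex R R)"
    proof (rule seg[OF R])
      fix z assume "z \<in> closed_segment (Complex R R) (Complex (-R) R)"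
      then obtain u where "z = (1 - u) *\<^sub>R Complex R R + u *\<^sub>R Complex (-R) R"
        by (auto simp: in_segment)
      then have "Im z = (1 - u) * R + u * R" by simp
      then have "Im z = R" by (simp add: algebra_simps)
      then show "Im z > 0 \<and> norm z \<ge> R" using R abs_Im_le_cmod[of z] by auto
    qed
    have n: "norm (Complex R R - Complex R 1) = R - 1" "norm (Complex (-R) 1 - Complex (-R) R) = R - 1"
      "norm (Complex (-R) R - Complex R R) = 2 * R"
      using R by (simp_all add: cmod_def real_sqrt_abs2 power2_eq_square[symmetric] real_sqrt_mult)
    have M: "M * R powr (- p) \<ge> 0"
      using s2 R unfolding n by (smt (verit) norm_ge_zero zero_le_mult_iff max.bounded_iff)
    have "norm (\<Phi> (Complex R 1) - \<Phi> (Complex (-R) 1)) \<le>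
      norm (\<Phi> (Complex R R) - \<Phi> (Complex R 1)) + norm (\<Phi> (Complex (-R) R) - \<Phi> (Complex R R))
      + norm (\<Phi> (Complex (-R) 1) - \<Phi> (Complex (-R) R))"
    proof -
      have "\<Phi> (Complex R 1) - \<Phi> (Complex (-R) 1) = - ((\<Phi> (Complex R R) - \<Phi> (Complex R 1))
         + (\<Phi> (Complex (-R) R) - \<Phi> (Complex R R)) + (\<Phi> (Complex (-R) 1) - \<Phi> (Complex (-R) R)))" by simp
      then have "norm (\<Phi> (Complex R 1) - \<Phi> (Complex (-R) 1)) = norm ((\<Phi> (Complex R R) - \<Phi> (Complex R 1))
         + (\<Phi> (Complex (-R) R) - \<Phi> (Complex R R)) + (\<Phi> (Complex (-R) 1) - \<Phi> (Complex (-R) R)))"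
        by (metis norm_minus_cancel)
      then show ?thesis by (metis norm_triangle_le norm_triangle_ineq add_right_mono)
    qed
    also have "\<dots> \<le> M * R powr (- p) * (R - 1) + M * R powr (- p) * (2 * R) + M * R powr (- p) * (R - 1)"
      using s1 s2 s3 unfolding n by linarith
    also have "\<dots> \<le> M * R powr (- p) * (4 * R)"
      using M by (simp add: algebra_simps)
    also have "\<dots> = 4 * M * R powr (1 - p)"
      using R by (simp add: powr_diff powr_minus divide_inverse)
    finally show ?thesis using int[of R] R by simp
  qed
  have lim: "((\<lambda>R. 4 * M * R powr (1 - p)) \<longlongrightarrow> 0) at_top"
  proof -
    have "((\<lambda>R. R powr (1 - p)) \<longlongrightarrow> 0) at_top"
      using p by (intro tendsto_neg_powr filterlim_ident) auto
    from tendsto_mult_left[OF this, of "4 * M"] show ?thesis by simp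
  qed
  show ?thesis
    by (rule Lim_null_comparison[OF _ lim]) (rule eventually_mono[OF eventually_ge_at_top[of "max R0 1"]], rule est)
qed

lemma sum_integral_unit_intervals:
  fixes f :: "real \<Rightarrow> 'a::euclidean_space"
  assumes "continuous_on UNIV f"
  shows "(\<Sum>n\<in>{- int M..<int M}. integral {real_of_int n..real_of_int n + 1} f) = integral {- real M..real M} f"
proof (induction M)
  case 0
  then show ?case by simp
next
  case (Suc M)
  have ii: "f integrable_on {a..b}" for a b
    using assms continuous_on_subset integrable_continuous_real by blast
  have eq: "{- int (Suc M)..<int (Suc M)} = insert (int M) (insert (- int M - 1) {- int M..<int M})" by auto
  have "integral {- real M - 1..real M + 1} f = integral {- real M - 1..- real M} f
      + (integral {- real M..real M} f + integral {real M..real M + 1} f)"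
    by (subst Henstock_Kurzweil_Integration.integral_combine[OF _ _ ii], simp, simp)+ simp
  moreover have ends: "- real (Suc M) = - real M - 1" "real (Suc M) = real M + 1" by simp_all
  moreover have "integral {- real (Suc M)..real (Suc M)} f = integral {- real M - 1..real M + 1} f"
    using ends by metis
  moreover have "integral {real_of_int (- int M - 1)..real_of_int (- int M - 1) + 1} f
      = integral {- real M - 1..- real M} f" by simp
  moreover have "(\<Sum>n\<in>{- int (Suc M)..<int (Suc M)}. integral {real_of_int n..real_of_int n + 1} f)
     = integral {real M..real M + 1} f + (integral {real_of_int (- int M - 1)..real_of_int (- int M - 1) + 1} f
       + (\<Sum>n\<in>{- int M..<int M}. integral {real_of_int n..real_of_int n + 1} f))"
    unfolding eq by (subst sum.insert; simp)+
  ultimately show ?case using Suc.IH by (simp only: add_ac)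
qed

text \<open>The real part is a sum of Poisson kernels and the imaginary part the sum of the conjugate
  kernels, which at height \<open>Im z = 1\<close> is a smoothed Hilbert transform.\<close>

lemma sum_kernel_half_plane:
  fixes a :: "int \<Rightarrow> real"
  assumes "Im z > 0"
  shows "Re (\<Sum>k\<in>K. of_real (a k) * (\<i> / (z - of_int k))) = (\<Sum>k\<in>K. a k * (Im z / ((Re z - of_int k)\<^sup>2 + (Im z)\<^sup>2)))"
    and "Im (\<Sum>k\<in>K. of_real (a k) * (\<i> / (z - of_int k))) = (\<Sum>k\<in>K. a k * ((Re z - of_int k) / ((Re z - of_int k)\<^sup>2 + (Im z)\<^sup>2)))"
  by (simp_all add: Re_divide Im_divide cmod_def power2_eq_square)

lemma half_plane_powr_integral_tendsto_0:
  fixes a :: "int \<Rightarrow> real"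
  assumes p: "p > 1" and K: "finite K" and a: "\<And>k. k \<in> K \<Longrightarrow> a k > 0" and ne: "K \<noteq> {}"
  defines "F \<equiv> \<lambda>z. \<Sum>k\<in>K. of_real (a k) * (\<i> / (z - of_int k))"
  shows "Im z > 0 \<Longrightarrow> Re (F z) > 0"
    and "continuous_on UNIV (\<lambda>x. F (Complex x 1) powr of_real p)"
    and "((\<lambda>R. integral {-R..R} (\<lambda>x. F (Complex x 1) powr of_real p)) \<longlongrightarrow> 0) at_top"
proof -
  have pos: "Re (F z) > 0" if "Im z > 0" for z
    unfolding F_def using sum_kernel_half_plane(1)[OF that, of a K] that a K ne
    by (auto intro!: sum_pos mult_pos_pos divide_pos_pos add_nonneg_pos)
  then show "Im z > 0 \<Longrightarrow> Re (F z) > 0" .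
  have nz: "z - of_int k \<noteq> 0" if "Im z > 0" for z k
    using that by (metis Im_complex_of_real Reals_cases eq_iff_diff_eq_0 less_irrefl of_real_of_int_eq)
  have np: "F z \<notin> \<real>\<^sub>\<le>\<^sub>0" if "Im z > 0" for z
    using pos[OF that] by (auto simp: complex_nonpos_Reals_iff)
  have holo: "(\<lambda>z. F z powr of_real p) holomorphic_on {z. Im z > 0}"
    using np unfolding F_def by (intro holomorphic_intros) (use nz in auto)
  have "continuous_on UNIV ((\<lambda>z. F z powr of_real p) \<circ> (\<lambda>x. Complex x 1))"
    by (rule continuous_on_compose, unfold Complex_eq, intro continuous_intros,
        rule continuous_on_subset[OF holomorphic_on_imp_continuous_on[OF holo]]) auto
  then show "continuous_on UNIV (\<lambda>x. F (Complex x 1) powr of_real p)" by (simp add: o_def)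
  define T where "T = (\<Sum>k\<in>K. a k)"
  \<comment> \<open>For \<open>|z| \<ge> R0\<close>, every \<open>|z - k|\<close> is at least \<open>|z| / 2\<close>.\<close>
  define R0 where "R0 = 1 + 2 * (\<Sum>k\<in>K. \<bar>real_of_int k\<bar>)"
  have T: "T \<ge> 0" unfolding T_def using a by (intro sum_nonneg) (auto intro: less_imp_le)
  show "((\<lambda>R. integral {-R..R} (\<lambda>x. F (Complex x 1) powr of_real p)) \<longlongrightarrow> 0) at_top"
  proof (rule integral_horizontal_line_tendsto_0[OF holo p])
    fix z assume z: "Im z > 0" "norm z \<ge> R0"
    have R0: "R0 \<ge> 1" by (simp add: R0_def sum_nonneg)
    have "norm (of_real (a k) * (\<i> / (z - of_int k))) \<le> a k * (2 / norm z)" if k: "k \<in> K" for k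
    proof -
      have "\<bar>real_of_int k\<bar> \<le> (\<Sum>k\<in>K. \<bar>real_of_int k\<bar>)" using k K by (intro member_le_sum) auto
      then have "2 * \<bar>real_of_int k\<bar> \<le> norm z" using z by (simp add: R0_def)
      moreover have "norm z \<le> norm (z - of_int k) + norm (of_int k :: complex)"
        by (metis add.commute diff_add_cancel norm_triangle_ineq)
      ultimately have "norm z / 2 \<le> norm (z - of_int k)" by simp
      then have "1 / norm (z - of_int k) \<le> 1 / (norm z / 2)"
        using z R0 by (intro divide_left_mono) (auto intro!: mult_pos_pos)
      then have "a k * (1 / norm (z - of_int k)) \<le> a k * (2 / norm z)"
        using a[OF k] by (intro mult_left_mono) auto
      then show ?thesis using a[OF k] by (simp add: norm_mult norm_divide)
    qed
    then have "norm (F z) \<le> (\<Sum>k\<in>K. a k * (2 / norm z))"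
      unfolding F_def by (intro sum_norm_le)
    also have "\<dots> = 2 * T / norm z" by (simp only: T_def sum_distrib_right[symmetric]) simp
    finally have "norm (F z) powr p \<le> (2 * T / norm z) powr p" using p by (intro powr_mono2) auto
    also have "\<dots> = (2 * T) powr p * norm z powr (- p)"
      using T z R0 by (simp add: powr_divide powr_minus_divide)
    finally show "norm (F z powr of_real p) \<le> (2 * T) powr p * norm z powr (- p)"
      by (simp add: norm_powr_real_powr')
  qed
qed

text \<open>These compare the kernels at height 1, at any point of the unit interval to the right of
  \<open>d\<close>, with the discrete kernels at \<open>d\<close>.  The value \<open>1 / 0 = 0\<close> makes the second estimate true for
  \<open>d = 0\<close> as well.\<close>

lemma shifted_kernel_estimates:
  fixes s :: real and d :: int
  assumes "0 \<le> s" "s \<le> 1"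
  shows "1 / ((of_int d + s)\<^sup>2 + 1) \<le> 4 / (1 + (of_int d)\<^sup>2)"
    and "\<bar>(of_int d + s) / ((of_int d + s)\<^sup>2 + 1) - 1 / of_int d\<bar> \<le> 4 / (1 + (of_int d)\<^sup>2)"
proof -
  let ?d = "real_of_int d"
  have 1: "1 + ?d\<^sup>2 \<le> 4 * (1 + (?d + s)\<^sup>2)"
  proof -
    have "?d\<^sup>2 \<le> 2 * (?d + s)\<^sup>2 + 2 * s\<^sup>2"
      using sum_squares_ge_zero[of "?d + 2 * s" 0] by (simp add: power2_eq_square algebra_simps)
    moreover have "s\<^sup>2 \<le> 1" using assms by (simp add: power_le_one)
    moreover have "(?d + s)\<^sup>2 \<ge> 0" by simp
    ultimately show ?thesis by (simp only: distrib_left)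
  qed
  show "1 / ((of_int d + s)\<^sup>2 + 1) \<le> 4 / (1 + (of_int d)\<^sup>2)"
    by (rule frac_le_cross) (use 1 in \<open>auto simp: add_pos_nonneg add_nonneg_pos add.commute\<close>)
  show "\<bar>(of_int d + s) / ((of_int d + s)\<^sup>2 + 1) - 1 / of_int d\<bar> \<le> 4 / (1 + (of_int d)\<^sup>2)"
  proof (cases "d = 0")
    case True
    have "s \<le> s * s + 1" using assms add_increasing[of "s * s" s 1] by simp
    then have "\<bar>s / (s\<^sup>2 + 1)\<bar> \<le> 1 / 1"
      using assms by (simp only: abs_divide) (rule frac_le_cross, auto simp: add_nonneg_pos power2_eq_square)
    then show ?thesis using True by simp
  next
    case False
    define y where "y = ?d + s"
    have d1: "\<bar>?d\<bar> \<ge> 1" using False by linarith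
    have y: "\<bar>y\<bar> + 1 \<ge> \<bar>?d\<bar>" using assms by (auto simp: y_def)
    have q: "y\<^sup>2 + 1 > 0" by (simp add: add_nonneg_pos)
    have "y / (y\<^sup>2 + 1) - 1 / ?d = - ((y * s + 1) / (?d * (y\<^sup>2 + 1)))"
    proof -
      have "y / (y\<^sup>2 + 1) - 1 / ?d = (y * ?d - 1 * (y\<^sup>2 + 1)) / ((y\<^sup>2 + 1) * ?d)"
        using d1 q by (intro diff_frac_eq) auto
      also have "y * ?d - 1 * (y\<^sup>2 + 1) = - (y * s + 1)"
        by (simp add: y_def power2_eq_square algebra_simps)
      finally show ?thesis by (simp only: minus_divide_left mult.commute)
    qed
    then have "\<bar>y / (y\<^sup>2 + 1) - 1 / ?d\<bar> = \<bar>y * s + 1\<bar> / (\<bar>?d\<bar> * (y\<^sup>2 + 1))"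
      using q by (simp only: abs_minus_cancel abs_divide abs_mult)
    also have "\<dots> \<le> (\<bar>y\<bar> + 1) / (\<bar>?d\<bar> * (y\<^sup>2 + 1))"
    proof (rule divide_right_mono)
      have "\<bar>y * s\<bar> \<le> \<bar>y\<bar> * 1" unfolding abs_mult using assms by (intro mult_left_mono) auto
      then show "\<bar>y * s + 1\<bar> \<le> \<bar>y\<bar> + 1" by linarith
    qed (use q in auto)
    also have "\<dots> \<le> 4 / (1 + ?d\<^sup>2)"
    proof (rule frac_le_cross)
      have "(\<bar>y\<bar> + 1) * (\<bar>y\<bar> + 1) \<le> 2 * (y\<^sup>2 + 1)"
        using sum_squares_ge_zero[of "\<bar>y\<bar> - 1" 0] by (simp add: algebra_simps power2_eq_square)
      moreover have "(\<bar>y\<bar> + 1) * \<bar>?d\<bar> \<le> (\<bar>y\<bar> + 1) * (\<bar>y\<bar> + 1)"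
        using y by (intro mult_left_mono) auto
      ultimately have 2: "(\<bar>y\<bar> + 1) * \<bar>?d\<bar> \<le> 2 * (y\<^sup>2 + 1)" by linarith
      have "1 + ?d\<^sup>2 \<le> 2 * (\<bar>?d\<bar> * \<bar>?d\<bar>)"
        using d1 mult_mono[OF d1 d1] by (simp add: power2_eq_square)
      then have "(\<bar>y\<bar> + 1) * (1 + ?d\<^sup>2) \<le> (\<bar>y\<bar> + 1) * (2 * (\<bar>?d\<bar> * \<bar>?d\<bar>))"
        by (intro mult_left_mono) auto
      also have "\<dots> = 2 * \<bar>?d\<bar> * ((\<bar>y\<bar> + 1) * \<bar>?d\<bar>)" by simp
      also have "\<dots> \<le> 2 * \<bar>?d\<bar> * (2 * (y\<^sup>2 + 1))" using 2 by (intro mult_left_mono) auto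
      finally show "(\<bar>y\<bar> + 1) * (1 + ?d\<^sup>2) \<le> 4 * (\<bar>?d\<bar> * (y\<^sup>2 + 1))"
        by (simp add: algebra_simps)
    qed (use d1 q in \<open>auto intro!: add_pos_nonneg\<close>)
    finally show ?thesis by (simp add: y_def)
  qed
qed

text \<open>The pointwise inequality for \<open>F(x + i)\<close> with \<open>x\<close> in \<open>[n, n + 1]\<close> bounds the \<open>n\<close>-th value of the
  discrete transform.  Integrated over this interval and summed over \<open>n\<close>, the holomorphic terms add up
  to the integral of \<open>F^p\<close> along a long segment, which tends to 0; the rest is covered by Schur's test.\<close>

lemma discrete_hilbert_nonneg:
  assumes p: "1 < p" "p \<le> 2"
  shows "\<exists>C\<ge>0. \<forall>K N. \<forall>a :: int \<Rightarrow> real. finite K \<longrightarrow> finite N \<longrightarrow> (\<forall>k. 0 \<le> a k) \<longrightarrow>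
    (\<Sum>n\<in>N. \<bar>\<Sum>k\<in>K. a k / of_int (n - k)\<bar> powr p) \<le> C * (\<Sum>k\<in>K. a k powr p)"
proof -
  obtain A B where A: "A \<ge> 0" and B: "B \<ge> 0"
    and AB: "\<And>w. Re w > 0 \<Longrightarrow> \<bar>Im w\<bar> powr p \<le> A * Re w powr p - B * Re (w powr of_real p)"
    using abs_Im_powr_le[OF p] by blast
  define D where "D = 2 powr p * 4 powr p * (A + 1)"
  define E where "E = 2 powr p * B"
  have D: "D \<ge> 0" using A by (simp add: D_def)
  have main: "(\<Sum>n\<in>N. \<bar>\<Sum>k\<in>K. a k / of_int (n - k)\<bar> powr p) \<le> D * 4 powr p * (\<Sum>k\<in>K. a k powr p)"
    if K: "finite K" and N: "finite N" and a: "\<And>k. k \<in> K \<Longrightarrow> 0 < a k" and a0: "\<And>k. 0 \<le> a k" and ne: "K \<noteq> {}"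
    for K N :: "int set" and a :: "int \<Rightarrow> real"
  proof -
    define F where "F = (\<lambda>z. \<Sum>k\<in>K. complex_of_real (a k) * (\<i> / (z - of_int k)))"
    define G where "G = (\<lambda>x. F (Complex x 1) powr complex_of_real p)"
    define u0 where "u0 n = (\<Sum>k\<in>K. a k / (1 + (real_of_int (n - k))\<^sup>2))" for n
    define h where "h n = (\<Sum>k\<in>K. a k / of_int (n - k))" for n
    have contG: "continuous_on UNIV G" unfolding G_def F_def by (rule half_plane_powr_integral_tendsto_0(2)[OF p(1) K a ne])
    have limG: "((\<lambda>R. integral {-R..R} G) \<longlongrightarrow> 0) at_top" unfolding G_def F_def by (rule half_plane_powr_integral_tendsto_0(3)[OF p(1) K a ne])
    have u00: "u0 n \<ge> 0" for n unfolding u0_def using a0 by (intro sum_nonneg) auto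
    have pt: "\<bar>h n\<bar> powr p \<le> D * u0 n powr p - E * Re (G x)"
      if x: "x \<in> {of_int n..of_int n + 1}" for n x
    proof -
      define s where "s = x - of_int n"
      have s: "0 \<le> s" "s \<le> 1" using x by (auto simp: s_def)
      have xk: "x - of_int k = of_int (n - k) + s" for k by (simp add: s_def)
      let ?w = "F (Complex x 1)"
      have Rw: "Re ?w = (\<Sum>k\<in>K. a k * (1 / ((of_int (n - k) + s)\<^sup>2 + 1)))"
        unfolding F_def using sum_kernel_half_plane(1)[of "Complex x 1" a K] by (simp add: xk del: of_int_diff)
      have Iw: "Im ?w = (\<Sum>k\<in>K. a k * ((of_int (n - k) + s) / ((of_int (n - k) + s)\<^sup>2 + 1)))"
        unfolding F_def using sum_kernel_half_plane(2)[of "Complex x 1" a K] by (simp add: xk del: of_int_diff)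
      have pos: "Re ?w > 0" unfolding F_def by (rule half_plane_powr_integral_tendsto_0(1)[OF p(1) K a ne]) auto
      have "Re ?w \<le> (\<Sum>k\<in>K. a k * (4 / (1 + (real_of_int (n - k))\<^sup>2)))"
        unfolding Rw using s a0 by (intro sum_mono mult_left_mono shifted_kernel_estimates) auto
      also have "\<dots> = 4 * u0 n" by (simp add: u0_def sum_distrib_left mult.commute)
      finally have "Re ?w powr p \<le> (4 * u0 n) powr p" using p pos by (intro powr_mono2) auto
      then have R: "Re ?w powr p \<le> 4 powr p * u0 n powr p" using u00 by (simp add: powr_mult)
      have "Im ?w - h n = (\<Sum>k\<in>K. a k * ((of_int (n - k) + s) / ((of_int (n - k) + s)\<^sup>2 + 1) - 1 / of_int (n - k)))"
        unfolding Iw h_def by (simp add: sum_subtractf[symmetric] right_diff_distrib)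
      also have "\<bar>\<dots>\<bar> \<le> (\<Sum>k\<in>K. a k * (4 / (1 + (real_of_int (n - k))\<^sup>2)))"
        using s a0 by (intro order_trans[OF sum_abs] sum_mono, unfold abs_mult)
          (intro mult_mono shifted_kernel_estimates, auto)
      also have "\<dots> = 4 * u0 n" by (simp add: u0_def sum_distrib_left mult.commute)
      finally have "\<bar>h n\<bar> \<le> \<bar>Im ?w\<bar> + 4 * u0 n" by linarith
      then have "\<bar>h n\<bar> powr p \<le> (\<bar>Im ?w\<bar> + 4 * u0 n) powr p" using p by (intro powr_mono2) auto
      also have "\<dots> \<le> 2 powr p * (\<bar>Im ?w\<bar> powr p + (4 * u0 n) powr p)"
        using p u00 by (intro powr_add_le) auto
      also have "\<dots> \<le> 2 powr p * ((A * Re ?w powr p - B * Re (G x)) + 4 powr p * u0 n powr p)"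
        using AB[OF pos] u00 B by (intro mult_left_mono add_mono) (auto simp: G_def powr_mult)
      also have "\<dots> \<le> 2 powr p * ((A * (4 powr p * u0 n powr p) - B * Re (G x)) + 4 powr p * u0 n powr p)"
        using A B R by (intro mult_left_mono add_mono diff_mono) auto
      also have "\<dots> = D * u0 n powr p - E * Re (G x)" by (simp add: D_def E_def algebra_simps)
      finally show ?thesis .
    qed
    have int: "G integrable_on {c..d}" for c d
      using contG continuous_on_subset integrable_continuous_real by blast
    have ReG: "integral {c..d} (\<lambda>x. Re (G x)) = Re (integral {c..d} G)" "(\<lambda>x. Re (G x)) integrable_on {c..d}" for c d
      using integral_linear[OF int bounded_linear_Re] integrable_linear[OF int bounded_linear_Re] by (auto simp: o_def)
    have unit: "\<bar>h n\<bar> powr p \<le> D * u0 n powr p - E * Re (integral {of_int n..of_int n + 1} G)" for n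
    proof -
      have "integral {real_of_int n..of_int n + 1} (\<lambda>x. \<bar>h n\<bar> powr p) \<le> integral {real_of_int n..of_int n + 1} (\<lambda>x. D * u0 n powr p - E * Re (G x))"
        using pt ReG(2) by (intro integral_le integrable_diff integrable_on_mult_right) auto
      then show ?thesis
        by (subst (asm) Henstock_Kurzweil_Integration.integral_diff)
           (auto intro!: integrable_on_mult_right simp: ReG)
    qed
    have "(\<Sum>n\<in>N. \<bar>h n\<bar> powr p) \<le> D * 4 powr p * (\<Sum>k\<in>K. a k powr p) - E * Re (integral {- real M..real M} G)"
      if M: "N \<subseteq> {- int M..<int M}" for M
    proof -
      have "(\<Sum>n\<in>N. \<bar>h n\<bar> powr p) \<le> (\<Sum>n\<in>{- int M..<int M}. \<bar>h n\<bar> powr p)"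
        using M by (intro sum_mono2) auto
      also have "\<dots> \<le> (\<Sum>n\<in>{- int M..<int M}. D * u0 n powr p - E * Re (integral {of_int n..of_int n + 1} G))"
        by (intro sum_mono unit)
      also have "\<dots> = D * (\<Sum>n\<in>{- int M..<int M}. u0 n powr p) - E * Re (integral {- real M..real M} G)"
        by (simp add: sum_subtractf sum_distrib_left[symmetric] Re_sum[symmetric]
             sum_integral_unit_intervals[OF contG] del: Re_sum)
      also have "(\<Sum>n\<in>{- int M..<int M}. u0 n powr p) \<le> 4 powr p * (\<Sum>k\<in>K. a k powr p)"
        unfolding u0_def using p K a0 by (intro schur_powr_sum) auto
      finally show ?thesis using D by (simp add: mult_left_mono mult.assoc)
    qed
    moreover have "\<forall>\<^sub>F M in sequentially. N \<subseteq> {- int M..<int M}"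
    proof -
      have "\<forall>n\<in>N. \<forall>\<^sub>F M in sequentially. n \<in> {- int M..<int M}"
      proof
        fix n
        show "\<forall>\<^sub>F M in sequentially. n \<in> {- int M..<int M}"
          by (rule eventually_sequentiallyI[of "nat (\<bar>n\<bar> + 1)"]) auto
      qed
      then have "\<forall>\<^sub>F M in sequentially. \<forall>n\<in>N. n \<in> {- int M..<int M}"
        using N by (simp add: eventually_ball_finite_distrib)
      then show ?thesis by (auto elim: eventually_mono)
    qed
    ultimately have ev: "\<forall>\<^sub>F M in sequentially. (\<Sum>n\<in>N. \<bar>h n\<bar> powr p) \<le>
        D * 4 powr p * (\<Sum>k\<in>K. a k powr p) - E * Re (integral {- real M..real M} G)"
      by (auto elim: eventually_mono)
    have "(\<lambda>M. integral {- real M..real M} G) \<longlonglongrightarrow> 0"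
      using filterlim_compose[OF limG filterlim_real_sequentially] by simp
    then have "(\<lambda>M. D * 4 powr p * (\<Sum>k\<in>K. a k powr p) - E * Re (integral {- real M..real M} G))
        \<longlonglongrightarrow> D * 4 powr p * (\<Sum>k\<in>K. a k powr p) - E * Re 0"
      by (intro tendsto_intros)
    then show ?thesis using tendsto_lowerbound[OF _ ev] by (simp add: h_def)
  qed
  show ?thesis
  proof (intro exI[of _ "D * 4 powr p"] conjI allI impI)
    show "0 \<le> D * 4 powr p" using D by simp
    fix K N :: "int set" and a :: "int \<Rightarrow> real"
    assume K: "finite K" and N: "finite N" and a: "\<forall>k. 0 \<le> a k"
    define K' where "K' = {k\<in>K. a k \<noteq> 0}"
    have 1: "(\<Sum>k\<in>K. a k / of_int (n - k)) = (\<Sum>k\<in>K'. a k / of_int (n - k))" for n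
      using K by (intro sum.mono_neutral_right) (auto simp: K'_def)
    have 2: "(\<Sum>k\<in>K. a k powr p) = (\<Sum>k\<in>K'. a k powr p)"
      using K by (intro sum.mono_neutral_right) (auto simp: K'_def)
    show "(\<Sum>n\<in>N. \<bar>\<Sum>k\<in>K. a k / of_int (n - k)\<bar> powr p) \<le> D * 4 powr p * (\<Sum>k\<in>K. a k powr p)"
    proof (cases "K' = {}")
      case True
      then show ?thesis unfolding 1 2 using p by simp
    next
      case False
      have "finite K'" "\<And>k. k \<in> K' \<Longrightarrow> 0 < a k" using K a by (auto simp: K'_def less_le)
      then show ?thesis unfolding 1 2 using main[of K' N a] N a False by blast
    qed
  qed
qed

lemma discrete_hilbert_real_le_2:
  assumes p: "1 < p" "p \<le> 2"
  shows "\<exists>C\<ge>0. \<forall>K N. \<forall>a :: int \<Rightarrow> real. finite K \<longrightarrow> finite N \<longrightarrow>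
    (\<Sum>n\<in>N. \<bar>\<Sum>k\<in>K. a k / of_int (n - k)\<bar> powr p) \<le> C * (\<Sum>k\<in>K. \<bar>a k\<bar> powr p)"
proof -
  obtain C where C: "C \<ge> 0" and bd: "\<And>K N a. finite K \<Longrightarrow> finite N \<Longrightarrow> (\<forall>k. 0 \<le> a k) \<Longrightarrow>
    (\<Sum>n\<in>N. \<bar>\<Sum>k\<in>K. a k / of_int (n - k)\<bar> powr p) \<le> C * (\<Sum>k\<in>K. a k powr p)"
    using discrete_hilbert_nonneg[OF p] by blast
  show ?thesis
  proof (intro exI[of _ "2 powr p * (2 * C)"] conjI allI impI)
    show "0 \<le> 2 powr p * (2 * C)" using C by simp
    fix K N :: "int set" and a :: "int \<Rightarrow> real"
    assume K: "finite K" and N: "finite N"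
    define b where "b k = max (a k) 0" for k
    define c where "c k = max (- a k) 0" for k
    have eq: "(\<Sum>k\<in>K. a k / of_int (n - k)) = (\<Sum>k\<in>K. b k / of_int (n - k)) - (\<Sum>k\<in>K. c k / of_int (n - k))" for n
      unfolding sum_subtractf[symmetric] by (rule sum.cong) (auto simp: b_def c_def max_def)
    have "(\<Sum>n\<in>N. \<bar>\<Sum>k\<in>K. a k / of_int (n - k)\<bar> powr p)
      \<le> (\<Sum>n\<in>N. 2 powr p * (\<bar>\<Sum>k\<in>K. b k / of_int (n - k)\<bar> powr p + \<bar>\<Sum>k\<in>K. c k / of_int (n - k)\<bar> powr p))"
    proof (rule sum_mono)
      fix n
      have "\<bar>\<Sum>k\<in>K. a k / of_int (n - k)\<bar> powr p \<le> (\<bar>\<Sum>k\<in>K. b k / of_int (n - k)\<bar> + \<bar>\<Sum>k\<in>K. c k / of_int (n - k)\<bar>) powr p"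
        unfolding eq using p by (intro powr_mono2) auto
      also have "\<dots> \<le> 2 powr p * (\<bar>\<Sum>k\<in>K. b k / of_int (n - k)\<bar> powr p + \<bar>\<Sum>k\<in>K. c k / of_int (n - k)\<bar> powr p)"
        using p by (intro powr_add_le) auto
      finally show "\<bar>\<Sum>k\<in>K. a k / of_int (n - k)\<bar> powr p \<le> \<dots>" .
    qed
    also have "\<dots> = 2 powr p * ((\<Sum>n\<in>N. \<bar>\<Sum>k\<in>K. b k / of_int (n - k)\<bar> powr p) + (\<Sum>n\<in>N. \<bar>\<Sum>k\<in>K. c k / of_int (n - k)\<bar> powr p))"
      by (simp only: sum_distrib_left[symmetric] sum.distrib)
    also have "\<dots> \<le> 2 powr p * (C * (\<Sum>k\<in>K. b k powr p) + C * (\<Sum>k\<in>K. c k powr p))"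
      by (intro mult_left_mono add_mono bd K N) (auto simp: b_def c_def)
    also have "\<dots> \<le> 2 powr p * (C * (\<Sum>k\<in>K. \<bar>a k\<bar> powr p) + C * (\<Sum>k\<in>K. \<bar>a k\<bar> powr p))"
      using C p by (intro mult_left_mono add_mono sum_mono powr_mono2) (auto simp: b_def c_def)
    finally show "(\<Sum>n\<in>N. \<bar>\<Sum>k\<in>K. a k / of_int (n - k)\<bar> powr p) \<le> 2 powr p * (2 * C) * (\<Sum>k\<in>K. \<bar>a k\<bar> powr p)"
      by (simp add: algebra_simps)
  qed
qed

text \<open>The kernel \<open>1 / (n - k)\<close> is antisymmetric, so the bound for the dual exponent \<open>q = p / (p - 1)\<close>,
  which is at most 2 when \<open>p > 2\<close>, carries over to \<open>p\<close>.\<close>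

lemma discrete_hilbert_real:
  assumes p: "1 < p"
  shows "\<exists>C\<ge>0. \<forall>K N. \<forall>a :: int \<Rightarrow> real. finite K \<longrightarrow> finite N \<longrightarrow>
    (\<Sum>n\<in>N. \<bar>\<Sum>k\<in>K. a k / of_int (n - k)\<bar> powr p) \<le> C * (\<Sum>k\<in>K. \<bar>a k\<bar> powr p)"
proof (cases "p \<le> 2")
  case True
  then show ?thesis using discrete_hilbert_real_le_2 p by blast
next
  case False
  define q where "q = p / (p - 1)"
  have q: "1 < q" "q \<le> 2" "1/p + 1/q = 1" "(p - 1) * q = p"
    using False by (auto simp: q_def field_simps)
  obtain C where C: "C \<ge> 0" and bd: "\<And>K N. \<And>a :: int \<Rightarrow> real. finite K \<Longrightarrow> finite N \<Longrightarrow>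
    (\<Sum>n\<in>N. \<bar>\<Sum>k\<in>K. a k / of_int (n - k)\<bar> powr q) \<le> C * (\<Sum>k\<in>K. \<bar>a k\<bar> powr q)"
    using discrete_hilbert_real_le_2[OF q(1,2)] by blast
  \<comment> \<open>With this scaling in Young's inequality the dual term is at most half of the sum to be
    estimated, and is absorbed.\<close>
  define L where "L = (2 * (C + 1)) powr (1/q)"
  have L: "L > 0" "L powr q = 2 * (C + 1)" using C q by (auto simp: L_def powr_powr)
  show ?thesis
  proof (intro exI[of _ "2 * L powr p"] conjI allI impI)
    show "0 \<le> 2 * L powr p" by simp
    fix K N :: "int set" and a :: "int \<Rightarrow> real"
    assume K: "finite K" and N: "finite N"
    define h where "h n = (\<Sum>k\<in>K. a k / of_int (n - k))" for n
    \<comment> \<open>The extremal sequence for the pairing with \<open>h\<close>: \<open>h b = |b|^q = |h|^p\<close>.\<close>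
    define b where "b n = sgn (h n) * \<bar>h n\<bar> powr (p - 1)" for n
    define S where "S = (\<Sum>n\<in>N. \<bar>h n\<bar> powr p)"
    define g where "g k = (\<Sum>n\<in>N. b n / of_int (k - n))" for k
    have babs: "\<bar>b n\<bar> powr q = \<bar>h n\<bar> powr p" for n
      using q by (cases "h n = 0") (auto simp: b_def abs_mult powr_powr abs_sgn_eq)
    have hb: "h n * b n = \<bar>h n\<bar> powr p" for n
    proof (cases "h n = 0")
      case False
      then have "\<bar>h n\<bar> * \<bar>h n\<bar> powr (p - 1) = \<bar>h n\<bar> powr p" by (simp add: powr_mult_base)
      then show ?thesis by (simp add: b_def mult.assoc[symmetric] abs_sgn[symmetric])
    qed (auto simp: b_def)
    have "S = (\<Sum>n\<in>N. h n * b n)" by (simp only: S_def hb)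
    also have "\<dots> = (\<Sum>n\<in>N. \<Sum>k\<in>K. a k / of_int (n - k) * b n)"
      by (simp only: h_def sum_distrib_right)
    also have "\<dots> = (\<Sum>k\<in>K. a k * (- g k))"
    proof -
      have "a k / of_int (n - k) * b n = a k * (- (b n / of_int (k - n)))" for n k
        by (cases "n = k") (auto simp: field_simps)
      then show ?thesis by (subst sum.swap) (simp add: g_def sum_distrib_left sum_negf)
    qed
    also have "\<dots> \<le> (\<Sum>k\<in>K. L powr p * \<bar>a k\<bar> powr p + \<bar>g k\<bar> powr q / L powr q)"
    proof (rule sum_mono)
      fix k
      have "a k * (- g k) \<le> \<bar>a k\<bar> * \<bar>g k\<bar>" by (metis abs_ge_self abs_minus_cancel abs_mult)
      also have "\<dots> = ((L * \<bar>a k\<bar>) powr p) powr (1/p) * ((\<bar>g k\<bar> / L) powr q) powr (1/q)"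
        using L p q by (simp add: powr_powr)
      also have "\<dots> \<le> 1/p * (L * \<bar>a k\<bar>) powr p + 1/q * (\<bar>g k\<bar> / L) powr q"
        using p q by (intro weighted_am_gm) auto
      also have "\<dots> \<le> 1 * (L * \<bar>a k\<bar>) powr p + 1 * (\<bar>g k\<bar> / L) powr q"
        using p q by (intro add_mono mult_right_mono) auto
      finally show "a k * (- g k) \<le> L powr p * \<bar>a k\<bar> powr p + \<bar>g k\<bar> powr q / L powr q"
        using L by (simp add: powr_mult powr_divide)
    qed
    also have "\<dots> = L powr p * (\<Sum>k\<in>K. \<bar>a k\<bar> powr p) + (\<Sum>k\<in>K. \<bar>g k\<bar> powr q) / L powr q"
      by (simp add: sum.distrib sum_distrib_left sum_divide_distrib)
    also have "(\<Sum>k\<in>K. \<bar>g k\<bar> powr q) / L powr q \<le> (C * S) / L powr q"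
      using bd[OF N K, of b] unfolding g_def[symmetric] babs S_def[symmetric]
      by (intro divide_right_mono) auto
    also have "(C * S) / L powr q \<le> S / 2"
    proof -
      have "C * S * 2 \<le> S * (2 * (C + 1))" by (simp add: algebra_simps S_def sum_nonneg)
      then show ?thesis unfolding L using C by (intro frac_le_cross) auto
    qed
    finally show "(\<Sum>n\<in>N. \<bar>\<Sum>k\<in>K. a k / of_int (n - k)\<bar> powr p) \<le> 2 * L powr p * (\<Sum>k\<in>K. \<bar>a k\<bar> powr p)"
      by (simp add: S_def h_def)
  qed
qed

section \<open>Moments of characters over the unit cell\<close>

abbreviation parity_sign :: "int \<Rightarrow> complex" where
  "parity_sign n \<equiv> (if even n then 1 else -1)"

lemma J_borel [measurable, simp]: "J \<in> sets borel"
  by (simp add: J_def)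

text \<open>The torus measure on Borel sets.  The torus itself carries the completed measure; the two have
  the same integrals of Borel functions, and measurability is easier to derive here.\<close>

abbreviation unit_cell :: "real measure" where
  "unit_cell \<equiv> restrict_space lborel J"

lemma space_unit_cell [simp]: "space unit_cell = J"
  by (simp add: space_restrict_space)

lemma prob_space_unit_cell: "emeasure unit_cell (space unit_cell) = 1"
  by (subst emeasure_restrict_space) (auto simp: J_def)

interpretation unit_cell: finite_measure unit_cell
  by standard (simp add: prob_space_unit_cell[simplified])

lemma unit_cell_measure [simp]: "measure unit_cell J = 1" "emeasure unit_cell J = 1"
  using prob_space_unit_cell by (simp_all add: measure_def)

lemma unit_cell_integral:
  fixes f :: "real \<Rightarrow> 'a::{banach, second_countable_topology}"
  shows "(LINT t|unit_cell. f t) = (LINT t|lborel. indicator J t *\<^sub>R f t)"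
  by (rule integral_restrict_space) simp

lemma unit_cell_measurable [measurable (raw)]:
  "f \<in> borel_measurable borel \<Longrightarrow> f \<in> borel_measurable unit_cell"
  by (rule measurable_restrict_space1) simp

lemma unit_cell_integrable:
  fixes f :: "real \<Rightarrow> 'a::{banach, second_countable_topology}"
  assumes "f \<in> borel_measurable borel" "\<And>t. t \<in> J \<Longrightarrow> norm (f t) \<le> B"
  shows "integrable unit_cell f"
  using assms by (intro unit_cell.integrable_const_bound[of _ B]) (auto intro: unit_cell_measurable)

lemma unit_cell_integral_norm_le:
  fixes f :: "real \<Rightarrow> 'a::{banach, second_countable_topology}"
  assumes "f \<in> borel_measurable borel" "\<And>t. t \<in> J \<Longrightarrow> norm (f t) \<le> B"
  shows "norm (LINT t|unit_cell. f t) \<le> B"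
proof -
  have "norm (LINT t|unit_cell. f t) \<le> (LINT t|unit_cell. norm (f t))"
    by (rule integral_norm_bound)
  also have "\<dots> \<le> (LINT t|unit_cell. B)"
    by (rule integral_mono[OF integrable_norm[OF unit_cell_integrable[OF assms]]]) (use assms in auto)
  finally show ?thesis by simp
qed

text \<open>For \<open>j = 0\<close> this is the cardinal sine \<open>sin(\<pi> x) / (\<pi> x)\<close>.\<close>

definition moment_kernel :: "nat \<Rightarrow> real \<Rightarrow> complex" where
  "moment_kernel j x = (LINT t|unit_cell. of_real (t ^ j) * cis (2 * pi * t * x))"

lemma AE_J_closed: "AE t in lborel. indicator J t = (indicator {-1/2..1/2} t :: real)"
  using AE_lborel_singleton[of "1/2::real"] by eventually_elim (auto simp: J_def indicator_def)

text \<open>The first and second derivatives of \<open>t ^ j\<close> at \<open>|t| \<le> 1/2\<close> are bounded uniformly in \<open>j\<close>.\<close>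

lemma half_power_derivative_bounds: "real j * (1/2) ^ (j - 1) \<le> 1" "real j * real (j - 1) * (1/2) ^ (j - 1 - 1) \<le> 4"
proof -
  have 1: "2 * real j \<le> 2 ^ j" for j
  proof (induction j)
    case (Suc j)
    have "(1::real) \<le> 2 ^ j" by simp
    then show ?case using Suc by (cases j) auto
  qed simp
  have 2: "real j * (real j - 1) \<le> 2 ^ j" for j
  proof (induction j)
    case (Suc j)
    then show ?case using 1[of j] by (simp add: algebra_simps)
  qed simp
  show "real j * (1/2) ^ (j - 1) \<le> 1"
    using 1[of j] by (cases j) (auto simp: power_one_over field_simps)
  show "real j * real (j - 1) * (1/2) ^ (j - 1 - 1) \<le> 4"
  proof (cases "j \<ge> 2")
    case True
    then obtain i where "j = i + 2" by (metis add.commute le_Suc_ex)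
    then show ?thesis using 2[of j] by (simp add: power_one_over field_simps)
  next
    case False
    then have "j = 0 \<or> j = 1" by linarith
    then show ?thesis by auto
  qed
qed

text \<open>Here \<open>P\<close> collects the boundary terms of two integrations by parts; the remaining integral
  contains the second derivative of \<open>t ^ j\<close>, which is at most 4 on the cell for every \<open>j\<close>.\<close>

lemma moment_kernel_by_parts:
  fixes j :: nat and x :: real
  assumes x: "x \<noteq> 0"
  defines "\<gamma> \<equiv> 2 * of_real pi * \<i> * of_real x"
  defines "P \<equiv> \<lambda>t::real. (of_real t ^ j / \<gamma> - of_nat j * of_real t ^ (j - 1) / \<gamma>\<^sup>2) * cis (2 * pi * t * x)"
  shows "cmod (moment_kernel j x - (P (1/2) - P (-1/2))) \<le> 4 / (cmod \<gamma>)\<^sup>2"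
proof -
  have \<gamma>: "\<gamma> \<noteq> 0" using x by (simp add: \<gamma>_def)
  have e: "cis (2 * pi * t * x) = exp (\<gamma> * of_real t)" for t
    by (simp add: cis_conv_exp \<gamma>_def mult_ac)
  \<comment> \<open>The derivative of \<open>Q\<close> is \<open>q - r\<close>, where \<open>q\<close> is the integrand and \<open>r\<close> is small.\<close>
  define Q where "Q z = (z ^ j / \<gamma> - of_nat j * z ^ (j - 1) / \<gamma>\<^sup>2) * exp (\<gamma> * z)" for z :: complex
  define q where "q z = z ^ j * exp (\<gamma> * z)" for z :: complex
  define r where "r z = of_nat j * (of_nat (j - 1) * z ^ (j - 1 - 1)) * exp (\<gamma> * z) / \<gamma>\<^sup>2" for z :: complex
  have PQ: "P t = Q (of_real t)" for t by (simp add: P_def Q_def e)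
  have "(Q has_field_derivative (q z - r z)) (at z)" for z
  proof -
    have 1: "((\<lambda>z. z ^ j / \<gamma> - of_nat j * z ^ (j - 1) / \<gamma>\<^sup>2) has_field_derivative
        (of_nat j * z ^ (j - 1) / \<gamma> - of_nat j * (of_nat (j - 1) * z ^ (j - 1 - 1)) / \<gamma>\<^sup>2)) (at z)"
    proof -
      have pw: "((\<lambda>z. z ^ i) has_field_derivative of_nat i * z ^ (i - 1)) (at z)" for i
        by (auto intro!: derivative_eq_intros)
      show ?thesis
        using DERIV_diff[OF DERIV_cdivide[OF pw[of j], of \<gamma>]
            DERIV_cdivide[OF DERIV_cmult[OF pw[of "j - 1"], of "of_nat j"], of "\<gamma>\<^sup>2"]] .
    qed
    have 2: "((\<lambda>z. exp (\<gamma> * z)) has_field_derivative (\<gamma> * exp (\<gamma> * z))) (at z)"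
      by (auto intro!: derivative_eq_intros)
    have 3: "(b / \<gamma> - d / \<gamma>\<^sup>2) * E + \<gamma> * E * (a / \<gamma> - b / \<gamma>\<^sup>2) = a * E - d * E / \<gamma>\<^sup>2" for a b d E
      using \<gamma> by (simp add: field_simps power2_eq_square)
    show ?thesis using DERIV_mult[OF 1 2] unfolding 3 Q_def q_def r_def .
  qed
  then have der: "(P has_vector_derivative (q (of_real t) - r (of_real t))) (at t within S)" for t S
    unfolding PQ[abs_def] by (rule has_vector_derivative_real_field)
  have cont: "continuous_on S (\<lambda>t::real. q (of_real t))" "continuous_on S (\<lambda>t::real. r (of_real t))" for S
    unfolding q_def r_def by (intro continuous_intros; use \<gamma> in simp)+
  define I where "I = (indicator {-1/2..1/2} :: real \<Rightarrow> real)"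
  have int: "integrable lborel (\<lambda>t. I t *\<^sub>R q (of_real t))" "integrable lborel (\<lambda>t. I t *\<^sub>R r (of_real t))"
    using borel_integrable_atLeastAtMost'[OF cont(1)] borel_integrable_atLeastAtMost'[OF cont(2)]
    by (auto simp: set_integrable_def I_def)
  have "(LINT t|lborel. I t *\<^sub>R (q (of_real t) - r (of_real t))) = P (1/2) - P (-1/2)"
    unfolding I_def by (rule integral_FTC_atLeastAtMost) (auto intro!: der continuous_intros cont)
  then have 1: "(LINT t|lborel. I t *\<^sub>R q (of_real t)) - (LINT t|lborel. I t *\<^sub>R r (of_real t)) = P (1/2) - P (-1/2)"
    using int by (simp add: scaleR_diff_right)
  have 2: "moment_kernel j x = (LINT t|lborel. I t *\<^sub>R q (of_real t))"
    unfolding moment_kernel_def unit_cell_integral I_def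
    by (rule integral_cong_AE) (use AE_J_closed in \<open>auto simp: q_def e intro!: borel_measurable_continuous_onI continuous_intros\<close>)
  have "cmod (LINT t|lborel. I t *\<^sub>R r (of_real t)) \<le> (LINT t|lborel. norm (I t *\<^sub>R r (of_real t)))"
    by (rule integral_norm_bound)
  also have "\<dots> \<le> (LINT t|lborel. I t * (4 / (cmod \<gamma>)\<^sup>2))"
  proof (rule integral_mono[OF integrable_norm[OF int(2)]])
    show "integrable lborel (\<lambda>t. I t * (4 / (cmod \<gamma>)\<^sup>2))" by (simp add: I_def)
    fix t
    show "norm (I t *\<^sub>R r (of_real t)) \<le> I t * (4 / (cmod \<gamma>)\<^sup>2)"
    proof (cases "t \<in> {-1/2..1/2}")
      case True
      have "real j * real (j - 1) * \<bar>t\<bar> ^ (j - 1 - 1) \<le> real j * real (j - 1) * (1/2) ^ (j - 1 - 1)"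
        using True by (intro mult_left_mono power_mono) auto
      also have "\<dots> \<le> 4" by (rule half_power_derivative_bounds)
      finally have "cmod (r (of_real t)) \<le> 4 / (cmod \<gamma>)\<^sup>2"
        unfolding r_def e[symmetric] by (simp add: norm_mult norm_divide norm_power divide_right_mono mult.assoc)
      then show ?thesis using True by (simp add: I_def)
    qed (auto simp: I_def)
  qed
  also have "\<dots> = 4 / (cmod \<gamma>)\<^sup>2" by (simp add: I_def)
  moreover have "moment_kernel j x - (P (1/2) - P (-1/2)) = (LINT t|lborel. I t *\<^sub>R r (of_real t))"
    unfolding 2 1[symmetric] by simp
  ultimately show ?thesis by (simp only:)
qed

lemma cis_2pi_of_int: "cis (2 * pi * of_int m) = 1"
  using cos_int_2pin[of m] sin_int_2pin[of m] by (simp add: complex_eq_iff)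

lemma cis_pi_of_int: "cis (pi * of_int n) = parity_sign n" "cis (- (pi * of_int n)) = parity_sign n"
proof -
  show 1: "cis (pi * of_int n) = parity_sign n"
  proof (cases "even n")
    case True
    then obtain m where "n = 2 * m" by blast
    then show ?thesis using cis_2pi_of_int[of m] by (simp add: mult_ac)
  next
    case False
    then obtain m where n: "n = 2 * m + 1" by (blast elim: oddE)
    have "cis (pi * of_int n) = cis (2 * pi * of_int m) * cis pi"
      unfolding cis_mult n by (simp add: algebra_simps)
    then show ?thesis using False by (simp only: cis_2pi_of_int) simp
  qed
  have "cis (- (pi * of_int n)) = cnj (cis (pi * of_int n))" by (simp add: cis_cnj)
  then show "cis (- (pi * of_int n)) = parity_sign n" unfolding 1 by simp
qed

text \<open>Only the first boundary term is of order \<open>1/n\<close>.  At the end points \<open>\<plusminus>1/2\<close> the character has the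
  values \<open>(-1)^n e(\<mp>\<theta>/2)\<close>, whence the alternating sign; replacing \<open>n - \<theta>\<close> by \<open>n\<close> in the denominator
  costs \<open>O(1/n^2)\<close>.  It matters that the constant 14 depends neither on \<open>j\<close> nor on \<open>\<theta>\<close>.\<close>

lemma moment_kernel_estimate:
  assumes \<theta>: "\<theta> \<in> J"
  shows "\<exists>c. cmod c \<le> 14 \<and> (\<forall>n::int. cmod (moment_kernel j (of_int n - \<theta>) - c * parity_sign n / of_int n)
           \<le> 14 / (1 + (of_int n)\<^sup>2))"
proof -
  define c' where "c' = of_real ((1/2) ^ j) * cis (- (pi * \<theta>)) - of_real ((-1/2) ^ j) * cis (pi * \<theta>)"
  define c where "c = c' / (2 * of_real pi * \<i>)"
  have half: "(1/2::real) ^ j \<le> 1" by (simp add: power_le_one)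
  have "cmod c' \<le> (1/2) ^ j + (1/2) ^ j"
    unfolding c'_def by (rule order_trans[OF norm_triangle_ineq4]) (simp add: norm_mult norm_power power_abs)
  then have c'2: "cmod c' \<le> 2" using half by simp
  have c1: "cmod c \<le> 1"
  proof -
    have "cmod c = cmod c' / (2 * pi)" by (simp add: c_def norm_divide norm_mult)
    also have "\<dots> \<le> 2 / (2 * pi)" using c'2 by (intro divide_right_mono) auto
    also have "\<dots> \<le> 1" using pi_gt3 by (simp add: field_simps)
    finally show ?thesis .
  qed
  have th: "\<bar>\<theta>\<bar> \<le> 1/2" using \<theta> by (auto simp: J_def)
  show ?thesis
  proof (intro exI[of _ c] conjI allI)
    show "cmod c \<le> 14" using c1 by simp
    fix n :: int
    show "cmod (moment_kernel j (of_int n - \<theta>) - c * parity_sign n / of_int n) \<le> 14 / (1 + (of_int n)\<^sup>2)"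
    proof (cases "n = 0")
      case True
      have "cmod (moment_kernel j (of_int n - \<theta>)) \<le> 1"
        unfolding moment_kernel_def
      proof (rule unit_cell_integral_norm_le)
        fix t assume "t \<in> J"
        then have "\<bar>t\<bar> \<le> 1" by (auto simp: J_def)
        then show "cmod (complex_of_real (t ^ j) * cis (2 * pi * t * (of_int n - \<theta>))) \<le> 1"
          by (simp add: norm_mult norm_power power_le_one)
      qed (auto intro!: borel_measurable_continuous_onI continuous_intros)
      then show ?thesis using True by simp
    next
      case False
      define x where "x = of_int n - \<theta>"
      have n1: "\<bar>real_of_int n\<bar> \<ge> 1" using False by linarith
      have xn: "\<bar>real_of_int n\<bar> / 2 \<le> \<bar>x\<bar>" using th n1 unfolding x_def by linarith
      then have x0: "x \<noteq> 0" using n1 by auto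
      define \<gamma> where "\<gamma> = 2 * of_real pi * \<i> * complex_of_real x"
      define P where "P = (\<lambda>t::real. (of_real t ^ j / \<gamma> - of_nat j * of_real t ^ (j - 1) / \<gamma>\<^sup>2) * cis (2 * pi * t * x))"
      have bp: "cmod (moment_kernel j x - (P (1/2) - P (-1/2))) \<le> 4 / (cmod \<gamma>)\<^sup>2"
        unfolding P_def \<gamma>_def by (rule moment_kernel_by_parts[OF x0])
      have cg: "cmod \<gamma> \<ge> \<bar>of_int n\<bar>"
      proof -
        have "1 * \<bar>of_int n\<bar> \<le> pi * \<bar>of_int n\<bar>" using pi_gt3 by (intro mult_right_mono) auto
        also have "\<dots> = 2 * pi * (\<bar>of_int n\<bar> / 2)" by simp
        also have "\<dots> \<le> 2 * pi * \<bar>x\<bar>" using xn by (intro mult_left_mono) auto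
        also have "\<dots> = cmod \<gamma>" by (simp add: \<gamma>_def norm_mult)
        finally show ?thesis by simp
      qed
      have cg2: "a / (cmod \<gamma>)\<^sup>2 \<le> a / (of_int n)\<^sup>2" if "a \<ge> 0" for a
      proof (rule divide_left_mono)
        show "(of_int n)\<^sup>2 \<le> (cmod \<gamma>)\<^sup>2" using cg by (metis abs_ge_zero power2_abs power_mono)
        show "0 < (cmod \<gamma>)\<^sup>2 * (real_of_int n)\<^sup>2" using cg n1 False by (auto intro!: mult_pos_pos)
      qed (rule that)
      have ends: "cis (2 * pi * (1/2) * x) = parity_sign n * cis (- (pi * \<theta>))"
        "cis (2 * pi * (-1/2) * x) = parity_sign n * cis (pi * \<theta>)"
      proof -
        have s: "cis (pi * of_int n) = parity_sign n" "cis (- (pi * of_int n)) = parity_sign n"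
          by (rule cis_pi_of_int)+
        show "cis (2 * pi * (1/2) * x) = parity_sign n * cis (- (pi * \<theta>))"
          unfolding s(1)[symmetric] by (simp add: cis_mult x_def algebra_simps)
        show "cis (2 * pi * (-1/2) * x) = parity_sign n * cis (pi * \<theta>)"
          unfolding s(2)[symmetric] by (simp add: cis_mult x_def algebra_simps)
      qed
      define R where "R = (of_nat j * of_real (1/2) ^ (j - 1) * cis (- (pi * \<theta>)) - of_nat j * of_real (-1/2) ^ (j - 1) * cis (pi * \<theta>)) * parity_sign n"
      have PP: "P (1/2) - P (-1/2) = c' * parity_sign n / \<gamma> - R / \<gamma>\<^sup>2"
        unfolding P_def ends R_def c'_def by (simp add: algebra_simps add_divide_distrib diff_divide_distrib)
      have R2: "cmod R \<le> 2"
      proof -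
        have "cmod R = cmod (of_nat j * of_real (1/2) ^ (j - 1) * cis (- (pi * \<theta>)) - of_nat j * of_real (-1/2) ^ (j - 1) * cis (pi * \<theta>))"
          by (simp add: R_def norm_mult)
        also have "\<dots> \<le> real j * (1/2) ^ (j - 1) + real j * (1/2) ^ (j - 1)"
          by (rule order_trans[OF norm_triangle_ineq4]) (simp add: norm_mult norm_power norm_divide)
        also have "\<dots> \<le> 2" using half_power_derivative_bounds(1)[of j] by linarith
        finally show ?thesis .
      qed
      have main: "cmod (c' * parity_sign n / \<gamma> - c * parity_sign n / of_int n) \<le> 1 / (of_int n)\<^sup>2"
      proof -
        have "c' * parity_sign n / \<gamma> - c * parity_sign n / of_int n = c * parity_sign n * of_real (1 / x - 1 / of_int n)"
        proof -
          have "c' = c * (2 * of_real pi * \<i>)" by (simp add: c_def)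
          then have "c' * parity_sign n / \<gamma> = c * parity_sign n / of_real x"
            by (simp add: \<gamma>_def)
          then show ?thesis by (simp only: of_real_diff of_real_divide right_diff_distrib) simp
        qed
        also have "1 / x - 1 / of_int n = \<theta> / (x * of_int n)"
          using x0 False by (simp add: x_def field_simps)
        also have "cmod (c * parity_sign n * of_real (\<theta> / (x * of_int n))) = cmod c * (\<bar>\<theta>\<bar> / (\<bar>x\<bar> * \<bar>of_int n\<bar>))"
          by (simp add: norm_mult norm_divide abs_mult)
        also have "\<dots> \<le> 1 * (\<bar>\<theta>\<bar> / (\<bar>x\<bar> * \<bar>of_int n\<bar>))" using c1 by (intro mult_right_mono) auto
        also have "\<dots> \<le> (1/2) / ((\<bar>of_int n\<bar> / 2) * \<bar>of_int n\<bar>)"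
          unfolding mult_1 using th xn n1 x0 False by (intro frac_le mult_right_mono mult_pos_pos) auto
        also have "\<dots> = 1 / (of_int n)\<^sup>2" by (simp add: power2_eq_square)
        finally show ?thesis .
      qed
      have "moment_kernel j x - c * parity_sign n / of_int n = (moment_kernel j x - (P (1/2) - P (-1/2)))
          + (- (R / \<gamma>\<^sup>2)) + (c' * parity_sign n / \<gamma> - c * parity_sign n / of_int n)"
        unfolding PP by (simp del: of_int_eq_0_iff)
      also have "cmod \<dots> \<le> 4 / (cmod \<gamma>)\<^sup>2 + 2 / (cmod \<gamma>)\<^sup>2 + 1 / (of_int n)\<^sup>2"
        by (intro norm_triangle_mono bp main) (use R2 in \<open>auto simp: norm_divide norm_power divide_right_mono\<close>)
      also have "\<dots> \<le> 4 / (of_int n)\<^sup>2 + 2 / (of_int n)\<^sup>2 + 1 / (of_int n)\<^sup>2"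
        by (intro add_mono cg2 order_refl) auto
      also have "\<dots> = 7 / (of_int n)\<^sup>2" by (simp add: add_divide_distrib[symmetric])
      also have "\<dots> \<le> 14 / (1 + (of_int n)\<^sup>2)"
      proof (rule frac_le_cross)
        have "1 \<le> (real_of_int n)\<^sup>2" using n1 by (metis one_le_power power2_abs)
        then show "7 * (1 + (real_of_int n)\<^sup>2) \<le> 14 * (real_of_int n)\<^sup>2" by simp
      qed (use False in \<open>auto simp: add_pos_nonneg\<close>)
      finally show ?thesis by (simp add: x_def)
    qed
  qed
qed

section \<open>Convolution with kernels of Hilbert type\<close>

text \<open>The sign \<open>(-1)^(n - k)\<close> factors and can be absorbed into the input and the output, so the main
  part of the kernel is the Hilbert kernel; the error is covered by Schur's test.\<close>

lemma hilbert_type_kernel_bounded: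
  assumes p: "p > 1" and B: "B \<ge> 0"
  shows "\<exists>A\<ge>0. \<forall>\<kappa> c K N. \<forall>a :: int \<Rightarrow> complex. finite K \<longrightarrow> finite N \<longrightarrow> cmod c \<le> B \<longrightarrow>
    (\<forall>n::int. cmod (\<kappa> n - c * parity_sign n / of_int n) \<le> B / (1 + (of_int n)\<^sup>2)) \<longrightarrow>
    (\<Sum>n\<in>N. cmod (\<Sum>k\<in>K. a k * \<kappa> (n - k)) powr p) \<le> A * (\<Sum>k\<in>K. cmod (a k) powr p)"
proof -
  obtain C where C: "C \<ge> 0" and bd: "\<And>K N. \<And>a :: int \<Rightarrow> real. finite K \<Longrightarrow> finite N \<Longrightarrow>
    (\<Sum>n\<in>N. \<bar>\<Sum>k\<in>K. a k / of_int (n - k)\<bar> powr p) \<le> C * (\<Sum>k\<in>K. \<bar>a k\<bar> powr p)"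
    using discrete_hilbert_real[OF p] by blast
  define A where "A = (4 * B) powr p * (C + C + 4 powr p)"
  show ?thesis
  proof (intro exI[of _ A] conjI allI impI)
    show "0 \<le> A" using C by (simp add: A_def)
    fix \<kappa> :: "int \<Rightarrow> complex" and c :: complex and K N :: "int set" and a :: "int \<Rightarrow> complex"
    assume K: "finite K" and N: "finite N" and c: "cmod c \<le> B"
      and "\<forall>n. cmod (\<kappa> n - c * parity_sign n / of_int n) \<le> B / (1 + (of_int n)\<^sup>2)"
    define s where "s = (\<lambda>n. parity_sign n)"
    have \<kappa>: "\<And>n. cmod (\<kappa> n - c * s n / of_int n) \<le> B / (1 + (of_int n)\<^sup>2)"
      using \<open>\<forall>n. cmod (\<kappa> n - c * parity_sign n / of_int n) \<le> B / (1 + (of_int n)\<^sup>2)\<close> unfolding s_def by blast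
    have s: "s n * s k = s (n - k)" "cmod (s n) = 1" for n k by (auto simp: s_def)
    define b where "b k = a k * s k" for k
    define X where "X n = \<bar>\<Sum>k\<in>K. Re (b k) / of_int (n - k)\<bar>" for n
    define Y where "Y n = \<bar>\<Sum>k\<in>K. Im (b k) / of_int (n - k)\<bar>" for n
    define Z where "Z n = (\<Sum>k\<in>K. cmod (a k) / (1 + (real_of_int (n - k))\<^sup>2))" for n
    have nonneg: "X n \<ge> 0" "Y n \<ge> 0" "Z n \<ge> 0" for n
      unfolding X_def Y_def Z_def by (auto intro!: sum_nonneg)
    have ReIm: "Re (z / of_int m) = Re z / of_int m" "Im (z / of_int m) = Im z / of_int m" for z m
      by (metis Re_divide_of_real of_real_of_int_eq, metis Im_divide_of_real of_real_of_int_eq)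
    have cb: "cmod (b k) = cmod (a k)" for k by (simp add: b_def norm_mult s)
    have pt: "cmod (\<Sum>k\<in>K. a k * \<kappa> (n - k)) \<le> B * (X n + (Y n + Z n))" for n
    proof -
      have eq: "(\<Sum>k\<in>K. a k * \<kappa> (n - k)) = c * s n * (\<Sum>k\<in>K. b k / of_int (n - k))
          + (\<Sum>k\<in>K. a k * (\<kappa> (n - k) - c * s (n - k) / of_int (n - k)))"
        unfolding sum_distrib_left sum.distrib[symmetric]
      proof (rule sum.cong)
        fix k
        have "c * s n * (b k / of_int (n - k)) = a k * (c * s (n - k) / of_int (n - k))"
          by (simp add: b_def s(1)[symmetric] del: of_int_diff)
        then show "a k * \<kappa> (n - k) = c * s n * (b k / of_int (n - k))
            + a k * (\<kappa> (n - k) - c * s (n - k) / of_int (n - k))"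
          by (simp only: right_diff_distrib) simp
      qed simp
      have "cmod (\<Sum>k\<in>K. a k * \<kappa> (n - k)) \<le> cmod (c * s n * (\<Sum>k\<in>K. b k / of_int (n - k)))
          + cmod (\<Sum>k\<in>K. a k * (\<kappa> (n - k) - c * s (n - k) / of_int (n - k)))"
        unfolding eq by (rule norm_triangle_ineq)
      also have "cmod (c * s n * (\<Sum>k\<in>K. b k / of_int (n - k))) \<le> B * (X n + Y n)"
      proof -
        have "cmod (\<Sum>k\<in>K. b k / of_int (n - k)) \<le> X n + Y n"
        proof -
          have "Re (\<Sum>k\<in>K. b k / of_int (n - k)) = (\<Sum>k\<in>K. Re (b k) / of_int (n - k))"
            "Im (\<Sum>k\<in>K. b k / of_int (n - k)) = (\<Sum>k\<in>K. Im (b k) / of_int (n - k))"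
            by (simp_all only: Re_sum Im_sum ReIm)
          then show ?thesis using cmod_le[of "\<Sum>k\<in>K. b k / of_int (n - k)"] by (simp add: X_def Y_def)
        qed
        then show ?thesis using c B by (auto simp: norm_mult s intro!: mult_mono)
      qed
      also have "cmod (\<Sum>k\<in>K. a k * (\<kappa> (n - k) - c * s (n - k) / of_int (n - k)))
          \<le> (\<Sum>k\<in>K. cmod (a k) * (B / (1 + (real_of_int (n - k))\<^sup>2)))"
        by (rule sum_norm_le, subst norm_mult, rule mult_left_mono[OF \<kappa> norm_ge_zero])
      also have "\<dots> = B * Z n" by (simp add: Z_def sum_distrib_left mult.commute)
      finally show ?thesis by (simp add: algebra_simps)
    qed
    have "cmod (\<Sum>k\<in>K. a k * \<kappa> (n - k)) powr p \<le> (4 * B) powr p * (X n powr p + (Y n powr p + Z n powr p))" for n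
    proof -
      have "cmod (\<Sum>k\<in>K. a k * \<kappa> (n - k)) powr p \<le> (B * (X n + (Y n + Z n))) powr p"
        using pt p by (intro powr_mono2) auto
      also have "\<dots> = B powr p * (X n + (Y n + Z n)) powr p" using B nonneg by (simp add: powr_mult)
      also have "(X n + (Y n + Z n)) powr p \<le> 2 powr p * (X n powr p + (Y n + Z n) powr p)"
        using nonneg p by (intro powr_add_le) auto
      also have "\<dots> \<le> 2 powr p * (2 powr p * X n powr p + 2 powr p * (Y n powr p + Z n powr p))"
        using nonneg p by (intro mult_left_mono add_mono powr_add_le)
          (auto simp: mult_le_cancel_right1 ge_one_powr_ge_zero)
      also have "B powr p * \<dots> = (4 * B) powr p * (X n powr p + (Y n powr p + Z n powr p))"
      proof -
        have "(4::real) powr p = 2 powr p * 2 powr p" by (simp add: powr_mult[symmetric])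
        then show ?thesis using B by (simp add: powr_mult algebra_simps)
      qed
      finally show ?thesis by (simp add: mult_left_mono)
    qed
    then have "(\<Sum>n\<in>N. cmod (\<Sum>k\<in>K. a k * \<kappa> (n - k)) powr p)
        \<le> (\<Sum>n\<in>N. (4 * B) powr p * (X n powr p + (Y n powr p + Z n powr p)))" by (rule sum_mono)
    also have "\<dots> = (4 * B) powr p * ((\<Sum>n\<in>N. X n powr p) + ((\<Sum>n\<in>N. Y n powr p) + (\<Sum>n\<in>N. Z n powr p)))"
      by (simp only: sum_distrib_left[symmetric] sum.distrib)
    also have "\<dots> \<le> (4 * B) powr p * (C * (\<Sum>k\<in>K. cmod (a k) powr p) + (C * (\<Sum>k\<in>K. cmod (a k) powr p)
         + 4 powr p * (\<Sum>k\<in>K. cmod (a k) powr p)))"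
    proof (intro mult_left_mono add_mono)
      have "(\<Sum>n\<in>N. X n powr p) \<le> C * (\<Sum>k\<in>K. \<bar>Re (b k)\<bar> powr p)" unfolding X_def by (rule bd[OF K N])
      also have "\<dots> \<le> C * (\<Sum>k\<in>K. cmod (a k) powr p)"
        using C p cb abs_Re_le_cmod by (intro mult_left_mono sum_mono powr_mono2) (auto simp flip: cb)
      finally show "(\<Sum>n\<in>N. X n powr p) \<le> C * (\<Sum>k\<in>K. cmod (a k) powr p)" .
      have "(\<Sum>n\<in>N. Y n powr p) \<le> C * (\<Sum>k\<in>K. \<bar>Im (b k)\<bar> powr p)" unfolding Y_def by (rule bd[OF K N])
      also have "\<dots> \<le> C * (\<Sum>k\<in>K. cmod (a k) powr p)"
        using C p cb abs_Im_le_cmod by (intro mult_left_mono sum_mono powr_mono2) (auto simp flip: cb)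
      finally show "(\<Sum>n\<in>N. Y n powr p) \<le> C * (\<Sum>k\<in>K. cmod (a k) powr p)" .
      show "(\<Sum>n\<in>N. Z n powr p) \<le> 4 powr p * (\<Sum>k\<in>K. cmod (a k) powr p)"
        unfolding Z_def using p K N by (intro schur_powr_sum) auto
    qed auto
    also have "\<dots> = A * (\<Sum>k\<in>K. cmod (a k) powr p)" by (simp add: A_def algebra_simps)
    finally show "(\<Sum>n\<in>N. cmod (\<Sum>k\<in>K. a k * \<kappa> (n - k)) powr p) \<le> A * (\<Sum>k\<in>K. cmod (a k) powr p)" .
  qed
qed

section \<open>Schwartz functions and their Fourier transforms\<close>

lemma integrable_inverse_quadratic: "integrable lborel (\<lambda>x::real. 1 / (1 + x\<^sup>2))"
proof -
  have nz: "1 + x\<^sup>2 \<noteq> 0" for x :: real by (metis add_pos_nonneg less_irrefl zero_le_power2 zero_less_one)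
  have "set_integrable lborel (einterval (-\<infinity>) \<infinity>) (\<lambda>x::real. 1 / (1 + x\<^sup>2))"
  proof (rule interval_integral_FTC_nonneg(1)[where F = arctan and A = "- (pi/2)" and B = "pi/2"])
    show "DERIV arctan x :> 1 / (1 + x\<^sup>2)" for x
      by (auto intro!: derivative_eq_intros simp: divide_inverse)
    show "isCont (\<lambda>x. 1 / (1 + x\<^sup>2)) x" for x :: real
      using nz by (intro continuous_intros) auto
    show "((arctan \<circ> real_of_ereal) \<longlongrightarrow> - (pi / 2)) (at_right (- \<infinity>))"
      by (auto simp: ereal_tendsto_simps tendsto_arctan_at_bot)
    show "((arctan \<circ> real_of_ereal) \<longlongrightarrow> pi / 2) (at_left \<infinity>)"
      by (auto simp: ereal_tendsto_simps tendsto_arctan_at_top)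
  qed auto
  then show ?thesis by (simp add: set_integrable_def)
qed

lemma integrable_of_quadratic_decay:
  fixes f :: "real \<Rightarrow> 'a::{banach, second_countable_topology}"
  assumes "f \<in> borel_measurable borel" "\<And>x. norm (f x) \<le> C / (1 + x\<^sup>2)"
  shows "integrable lborel f"
proof (rule Bochner_Integration.integrable_bound)
  show "integrable lborel (\<lambda>x. C * (1 / (1 + x\<^sup>2)))"
    by (intro integrable_mult_right integrable_inverse_quadratic)
  show "AE x in lborel. norm (f x) \<le> norm (C * (1 / (1 + x\<^sup>2)))"
    using order_trans[OF assms(2) abs_ge_self] by simp
qed (use assms in simp)

lemma quadratic_decay_tendsto_0:
  fixes F :: "real \<Rightarrow> 'a::real_normed_vector"
  assumes "\<And>x. norm (F x) \<le> C / (1 + x\<^sup>2)"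
  shows "(F \<longlongrightarrow> 0) at_top" "(F \<longlongrightarrow> 0) at_bot"
proof -
  have bd: "y \<le> 1 + y\<^sup>2" for y :: real
  proof -
    have "0 \<le> (y - 1) * (y - 1)" by simp
    then have "2 * y \<le> 1 + y * y" by (simp add: algebra_simps)
    moreover have "0 \<le> y * y" by simp
    ultimately have "y \<le> 1 + y * y" by linarith
    then show ?thesis by (simp add: power2_eq_square)
  qed
  have "filterlim (\<lambda>x::real. 1 + x\<^sup>2) at_top at_top"
    by (rule filterlim_at_top_mono[OF filterlim_ident]) (use bd in auto)
  moreover have "filterlim (\<lambda>x::real. 1 + x\<^sup>2) at_top at_bot"
    by (rule filterlim_at_top_mono[OF filterlim_uminus_at_top_at_bot]) (use bd[of "- _"] in auto)
  ultimately have "((\<lambda>x. C * inverse (1 + x\<^sup>2)) \<longlongrightarrow> C * 0) at_top" "((\<lambda>x. C * inverse (1 + x\<^sup>2)) \<longlongrightarrow> C * 0) at_bot"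
    by - (rule tendsto_mult_left, rule tendsto_inverse_0_at_top, assumption)+
  then have lim: "((\<lambda>x. C / (1 + x\<^sup>2)) \<longlongrightarrow> 0) at_top" "((\<lambda>x. C / (1 + x\<^sup>2)) \<longlongrightarrow> 0) at_bot"
    by (simp_all add: divide_inverse)
  show "(F \<longlongrightarrow> 0) at_top" "(F \<longlongrightarrow> 0) at_bot"
    by (rule Lim_null_comparison[OF _ lim(1)], simp add: assms, rule Lim_null_comparison[OF _ lim(2)], simp add: assms)
qed

lemma integral_derivative_eq_0:
  fixes F f :: "real \<Rightarrow> complex"
  assumes "\<And>x. (F has_vector_derivative f x) (at x)" "continuous_on UNIV f" "integrable lborel f"
    and decay: "\<And>x. norm (F x) \<le> C / (1 + x\<^sup>2)"
  shows "(LINT x|lborel. f x) = 0"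
proof -
  have "(LBINT x=-\<infinity>..\<infinity>. f x) = 0 - 0"
  proof (rule interval_integral_FTC_integrable[where F = F])
    show "isCont f x" for x using assms(2) by (simp add: continuous_on_eq_continuous_at)
    show "set_integrable lborel (einterval (-\<infinity>) \<infinity>) f" using assms(3) by (simp add: set_integrable_def)
    show "((F \<circ> real_of_ereal) \<longlongrightarrow> 0) (at_right (-\<infinity>))" "((F \<circ> real_of_ereal) \<longlongrightarrow> 0) (at_left \<infinity>)"
      using quadratic_decay_tendsto_0[of F C, OF decay] by (auto simp: ereal_tendsto_simps)
  qed (use assms(1) in auto)
  then show ?thesis by (simp add: interval_lebesgue_integral_def set_lebesgue_integral_def)
qed

lemma schwartz_decay:
  assumes "schwartz f"
  obtains f1 f2 C where "C \<ge> 0"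
    "\<And>x. (f has_vector_derivative f1 x) (at x)" "\<And>x. (f1 has_vector_derivative f2 x) (at x)"
    "continuous_on UNIV f" "continuous_on UNIV f1" "continuous_on UNIV f2"
    "\<And>x. norm (f x) \<le> C / (1 + x\<^sup>2)" "\<And>x. norm (f1 x) \<le> C / (1 + x\<^sup>2)" "\<And>x. norm (f2 x) \<le> C / (1 + x\<^sup>2)"
proof -
  obtain D where D: "D 0 = f" "\<And>k x. (D k has_vector_derivative D (Suc k) x) (at x)"
    "\<And>j k. bounded (range (\<lambda>x. x ^ j *\<^sub>R D k x))"
    using assms unfolding schwartz_def by blast
  have "\<exists>C\<ge>0. \<forall>x. norm (D k x) \<le> C / (1 + x\<^sup>2)" for k
  proof -
    obtain A where A: "\<And>x. norm (x ^ 0 *\<^sub>R D k x) \<le> A" using D(3)[of 0 k] unfolding bounded_iff by blast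
    obtain B where B: "\<And>x. norm (x ^ 2 *\<^sub>R D k x) \<le> B" using D(3)[of 2 k] unfolding bounded_iff by blast
    have "norm (D k x) \<le> (A + B) / (1 + x\<^sup>2)" for x
    proof -
      have "norm (D k x) * (1 + x\<^sup>2) \<le> A + B" using A[of x] B[of x] by (simp add: algebra_simps)
      then show ?thesis by (simp add: pos_le_divide_eq add_pos_nonneg)
    qed
    moreover have "A + B \<ge> 0" using A[of 0] B[of 0] by (smt (verit) norm_ge_zero)
    ultimately show ?thesis by blast
  qed
  then obtain c where c: "\<And>k. c k \<ge> 0" "\<And>k x. norm (D k x) \<le> c k / (1 + x\<^sup>2)" by metis
  define C where "C = c 0 + c 1 + c 2"
  have le: "norm (D k x) \<le> C / (1 + x\<^sup>2)" if "c k \<le> C" for k x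
    using order_trans[OF c(2)[of k x] divide_right_mono[OF that, of "1 + x\<^sup>2"]] by simp
  have cont: "continuous_on UNIV (D k)" for k
    using D(2) by (meson continuous_at_imp_continuous_on has_vector_derivative_continuous)
  show thesis
  proof (rule that[of C "D 1" "D 2"])
    show "C \<ge> 0" using c(1) by (simp add: C_def)
    have "c 0 \<le> C" "c 1 \<le> C" "c 2 \<le> C" using c(1)[of 0] c(1)[of 1] c(1)[of 2] by (auto simp: C_def)
    then show "norm (f x) \<le> C / (1 + x\<^sup>2)" "norm (D 1 x) \<le> C / (1 + x\<^sup>2)" "norm (D 2 x) \<le> C / (1 + x\<^sup>2)" for x
      using le D(1) by metis+
    show "(f has_vector_derivative D 1 x) (at x)" "(D 1 has_vector_derivative D 2 x) (at x)" for x
      using D(2)[of 0 x] D(2)[of 1 x] D(1) by (simp_all add: numeral_2_eq_2)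
    show "continuous_on UNIV f" "continuous_on UNIV (D 1)" "continuous_on UNIV (D 2)"
      using cont D(1) by metis+
  qed
qed

lemma cis_borel_measurable [measurable]: "cis \<in> borel_measurable borel"
  by (intro borel_measurable_continuous_onI continuous_intros)

lemma fourier_lborel:
  assumes "f \<in> borel_measurable borel"
  shows "fourier f \<xi> = (LINT x|lborel. f x * cis (- (2 * pi * x * \<xi>)))"
  unfolding fourier_def
  by (rule integral_completion) (use assms in measurable)

lemma fourier_measurable:
  assumes [measurable]: "f \<in> borel_measurable borel"
  shows "fourier f \<in> borel_measurable borel"
proof -
  have "(\<lambda>\<xi>. LINT x|lborel. f x * cis (- (2 * pi * x * \<xi>))) \<in> borel_measurable borel"
    by (rule lborel.borel_measurable_lebesgue_integral) (simp add: case_prod_beta', measurable)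
  moreover have "fourier f = (\<lambda>\<xi>. LINT x|lborel. f x * cis (- (2 * pi * x * \<xi>)))"
    using fourier_lborel[OF assms] by blast
  ultimately show ?thesis by simp
qed

text \<open>Two integrations by parts on the whole line give \<open>\<xi>^2 |f^(\<xi>)| \<le> \<integral> |f''|\<close>.\<close>

lemma fourier_decay:
  assumes "schwartz f"
  shows "\<exists>C\<ge>0. \<forall>\<xi>. cmod (fourier f \<xi>) \<le> C / (1 + \<xi>\<^sup>2)"
proof -
  obtain f1 f2 C where f: "C \<ge> 0"
    "\<And>x. (f has_vector_derivative f1 x) (at x)" "\<And>x. (f1 has_vector_derivative f2 x) (at x)"
    "continuous_on UNIV f" "continuous_on UNIV f1" "continuous_on UNIV f2"
    "\<And>x. norm (f x) \<le> C / (1 + x\<^sup>2)" "\<And>x. norm (f1 x) \<le> C / (1 + x\<^sup>2)" "\<And>x. norm (f2 x) \<le> C / (1 + x\<^sup>2)"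
    by (rule schwartz_decay[OF assms], rule that, assumption+)
  define I where "I = (LINT x|lborel. C * (1 / (1 + x\<^sup>2)))"
  have meas: "f \<in> borel_measurable borel" "f2 \<in> borel_measurable borel"
    using f by (auto intro: borel_measurable_continuous_onI)
  have I: "cmod (LINT x|lborel. g x * cis (c * x)) \<le> I"
    if g: "continuous_on UNIV g" "\<And>x. norm (g x) \<le> C / (1 + x\<^sup>2)" for g c
  proof -
    have int: "integrable lborel (\<lambda>x. g x * cis (c * x))"
      by (rule integrable_of_quadratic_decay[where C = C])
        (use g in \<open>auto simp: norm_mult intro!: borel_measurable_continuous_onI continuous_intros\<close>)
    have "cmod (LINT x|lborel. g x * cis (c * x)) \<le> (LINT x|lborel. norm (g x * cis (c * x)))"
      by (rule integral_norm_bound)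
    also have "\<dots> \<le> I" unfolding I_def
      by (rule integral_mono[OF integrable_norm[OF int]])
        (use g in \<open>auto simp: norm_mult intro!: integrable_mult_right[OF integrable_inverse_quadratic, simplified]\<close>)
    finally show ?thesis .
  qed
  have "cmod (fourier f \<xi>) \<le> 2 * I / (1 + \<xi>\<^sup>2)" for \<xi>
  proof -
    have 0: "cmod (fourier f \<xi>) \<le> I"
      using I[OF f(4,7), of "- (2 * pi * \<xi>)"] by (simp add: fourier_lborel[OF meas(1)] mult_ac)
    have 2: "\<xi>\<^sup>2 * cmod (fourier f \<xi>) \<le> I"
    proof (cases "\<xi> = 0")
      case True
      then show ?thesis using order_trans[OF norm_ge_zero 0] by simp
    next
      case False
      define \<gamma> where "\<gamma> = - (2 * of_real pi * \<i> * complex_of_real \<xi>)"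
      have \<gamma>: "\<gamma> \<noteq> 0" using False by (simp add: \<gamma>_def)
      define E where "E x = cis (- (2 * pi * x * \<xi>))" for x
      have E: "E x = exp (\<gamma> * of_real x)" for x by (simp add: E_def cis_conv_exp \<gamma>_def mult_ac)
      have cE: "continuous_on UNIV E" unfolding E_def by (intro continuous_intros)
      have nE: "cmod (E x) = 1" for x by (simp add: E_def)
      have dE: "(E has_vector_derivative (\<gamma> * E x)) (at x)" for x
      proof -
        have "((\<lambda>z. exp (\<gamma> * z)) has_field_derivative (\<gamma> * exp (\<gamma> * of_real x))) (at (of_real x))"
          by (auto intro!: derivative_eq_intros)
        from has_vector_derivative_real_field[OF this] show ?thesis unfolding E[abs_def] .
      qed
      define F where "F x = (f x / \<gamma> - f1 x / \<gamma>\<^sup>2) * E x" for x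
      have dF: "(F has_vector_derivative (f x * E x - f2 x * E x / \<gamma>\<^sup>2)) (at x)" for x
      proof -
        have "((\<lambda>x. f x / \<gamma> - f1 x / \<gamma>\<^sup>2) has_vector_derivative (f1 x / \<gamma> - f2 x / \<gamma>\<^sup>2)) (at x)"
          by (intro derivative_intros f)
        from has_vector_derivative_mult[OF this dE[of x]]
        have "(F has_vector_derivative ((f x / \<gamma> - f1 x / \<gamma>\<^sup>2) * (\<gamma> * E x) + (f1 x / \<gamma> - f2 x / \<gamma>\<^sup>2) * E x)) (at x)"
          unfolding F_def .
        moreover have "(f x / \<gamma> - f1 x / \<gamma>\<^sup>2) * (\<gamma> * E x) + (f1 x / \<gamma> - f2 x / \<gamma>\<^sup>2) * E x = f x * E x - f2 x * E x / \<gamma>\<^sup>2"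
          using \<gamma> by (simp add: field_simps power2_eq_square)
        ultimately show ?thesis by simp
      qed
      have i1: "integrable lborel (\<lambda>x. f x * E x)"
        by (rule integrable_of_quadratic_decay[where C = C])
          (use f cE nE in \<open>auto simp: norm_mult intro!: borel_measurable_continuous_onI continuous_intros\<close>)
      have i2: "integrable lborel (\<lambda>x. f2 x * E x / \<gamma>\<^sup>2)"
        by (rule integrable_divide, rule integrable_of_quadratic_decay[where C = C])
          (use f cE nE in \<open>auto simp: norm_mult intro!: borel_measurable_continuous_onI continuous_intros\<close>)
      have "(LINT x|lborel. f x * E x - f2 x * E x / \<gamma>\<^sup>2) = 0"
      proof (rule integral_derivative_eq_0[OF dF])
        show "continuous_on UNIV (\<lambda>x. f x * E x - f2 x * E x / \<gamma>\<^sup>2)"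
          using \<gamma> by (intro continuous_intros f cE) auto
        show "integrable lborel (\<lambda>x. f x * E x - f2 x * E x / \<gamma>\<^sup>2)" using i1 i2 by simp
        show "cmod (F x) \<le> (C / cmod \<gamma> + C / cmod (\<gamma>\<^sup>2)) / (1 + x\<^sup>2)" for x
        proof -
          have "cmod (F x) \<le> cmod (f x / \<gamma>) + cmod (f1 x / \<gamma>\<^sup>2)"
            unfolding F_def norm_mult nE by (simp add: norm_triangle_ineq4)
          also have "\<dots> \<le> C / (1 + x\<^sup>2) / cmod \<gamma> + C / (1 + x\<^sup>2) / cmod (\<gamma>\<^sup>2)"
            unfolding norm_divide using f by (intro add_mono divide_right_mono) auto
          also have "\<dots> = (C / cmod \<gamma> + C / cmod (\<gamma>\<^sup>2)) / (1 + x\<^sup>2)"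
            by (simp add: add_divide_distrib mult.commute)
          finally show ?thesis .
        qed
      qed
      then have "(LINT x|lborel. f x * E x) = (LINT x|lborel. f2 x * E x) / \<gamma>\<^sup>2"
        using i1 i2 by simp
      then have "cmod (fourier f \<xi>) = cmod (LINT x|lborel. f2 x * E x) / (cmod \<gamma>)\<^sup>2"
        by (simp add: fourier_lborel[OF meas(1)] E_def norm_divide norm_power)
      also have "\<dots> \<le> I / (cmod \<gamma>)\<^sup>2"
        using I[OF f(6,9), of "- (2 * pi * \<xi>)"] by (intro divide_right_mono) (auto simp: E_def mult_ac)
      finally have 3: "cmod (fourier f \<xi>) * (cmod \<gamma>)\<^sup>2 \<le> I" using \<gamma> by (simp add: field_simps)
      have "\<bar>\<xi>\<bar> \<le> cmod \<gamma>"
      proof -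
        have "1 * \<bar>\<xi>\<bar> \<le> (2 * pi) * \<bar>\<xi>\<bar>" using pi_gt3 by (intro mult_right_mono) auto
        then show ?thesis by (simp add: \<gamma>_def norm_mult)
      qed
      then have "\<xi>\<^sup>2 \<le> (cmod \<gamma>)\<^sup>2" by (metis abs_ge_zero power2_abs power_mono)
      then have "\<xi>\<^sup>2 * cmod (fourier f \<xi>) \<le> (cmod \<gamma>)\<^sup>2 * cmod (fourier f \<xi>)" by (intro mult_right_mono) auto
      then show ?thesis using 3 by (simp add: mult.commute)
    qed
    have "cmod (fourier f \<xi>) * (1 + \<xi>\<^sup>2) \<le> 2 * I" using 0 2 by (simp add: algebra_simps)
    then show ?thesis by (simp add: pos_le_divide_eq add_pos_nonneg)
  qed
  moreover have "0 \<le> 2 * I" using f by (auto simp: I_def intro!: integral_nonneg)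
  ultimately show ?thesis by blast
qed

section \<open>Fourier coefficients on the unit cell\<close>

lemma sin_ge_quarter:
  assumes "0 \<le> x" "x \<le> pi / 2"
  shows "x / 4 \<le> sin x"
proof (cases "x \<le> pi / 3")
  case True
  have "sin 0 - 0 / 4 \<le> sin x - x / 4"
  proof (rule DERIV_nonneg_imp_nondecreasing[OF assms(1)])
    fix y assume y: "0 \<le> y" "y \<le> x"
    have "cos (pi / 3) \<le> cos y" using y True by (intro cos_monotone_0_pi_le) auto
    then have "0 \<le> cos y - 1 / 4" by (simp add: cos_60)
    moreover have "((\<lambda>y. sin y - y / 4) has_real_derivative cos y - 1 / 4) (at y)"
      by (auto intro!: derivative_eq_intros)
    ultimately show "\<exists>z. ((\<lambda>y. sin y - y / 4) has_real_derivative z) (at y) \<and> 0 \<le> z" by blast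
  qed
  then show ?thesis by simp
next
  case False
  have "sin (pi / 6) \<le> sin x" using False assms by (intro sin_monotone_2pi_le) auto
  moreover have "x / 4 \<le> 1 / 2" using assms pi_less_4 by simp
  ultimately show ?thesis by (simp add: sin_30)
qed

lemma norm_cis_minus_one: "cmod (cis (2 * x) - 1) = 2 * \<bar>sin x\<bar>"
proof -
  have "cis (2 * x) - 1 = cis x * (2 * \<i> * of_real (sin x))"
    unfolding complex_eq_iff by (simp add: cos_double_sin sin_double power2_eq_square)
  then show ?thesis by (simp add: norm_mult)
qed

lemma cis_minus_one_ge:
  assumes "\<bar>y\<bar> \<le> 1/2"
  shows "\<bar>y\<bar> \<le> cmod (cis (2 * pi * y) - 1)"
proof -
  have "\<bar>pi * y\<bar> / 4 \<le> sin \<bar>pi * y\<bar>"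
    using assms by (intro sin_ge_quarter) (auto simp: abs_mult)
  also have "\<dots> \<le> \<bar>sin (pi * y)\<bar>" by (simp add: abs_if)
  finally have 1: "\<bar>pi * y\<bar> / 4 \<le> \<bar>sin (pi * y)\<bar>" .
  have 2: "cmod (cis (2 * pi * y) - 1) = 2 * \<bar>sin (pi * y)\<bar>"
    using norm_cis_minus_one[of "pi * y"] by (simp add: mult.assoc)
  have "2 * \<bar>y\<bar> \<le> pi * \<bar>y\<bar>" using pi_gt3 by (intro mult_right_mono) auto
  then show ?thesis using 1 unfolding 2 by (simp add: abs_mult)
qed

lemma unit_cell_character:
  "(LINT y|unit_cell. cis (2 * pi * of_int n * y)) = (if n = 0 then 1 else 0)"
proof (cases "n = 0")
  case False
  define \<gamma> where "\<gamma> = 2 * of_real pi * \<i> * complex_of_int n"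
  have \<gamma>: "\<gamma> \<noteq> 0" using False by (simp add: \<gamma>_def)
  have e: "cis (2 * pi * of_int n * t) = exp (\<gamma> * of_real t)" for t
    by (simp add: cis_conv_exp \<gamma>_def mult_ac)
  define P where "P t = cis (2 * pi * of_int n * t) / \<gamma>" for t
  have der: "(P has_vector_derivative cis (2 * pi * of_int n * t)) (at t within S)" for t S
  proof -
    have "((\<lambda>z. exp (\<gamma> * z) / \<gamma>) has_field_derivative exp (\<gamma> * of_real t)) (at (of_real t))"
      using \<gamma> by (auto intro!: derivative_eq_intros)
    from has_vector_derivative_real_field[OF this] show ?thesis unfolding P_def e .
  qed
  have "(LINT y|unit_cell. cis (2 * pi * of_int n * y))
      = (LINT y|lborel. indicator {-1/2..1/2} y *\<^sub>R cis (2 * pi * of_int n * y))"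
    unfolding unit_cell_integral
    by (rule integral_cong_AE) (use AE_J_closed in auto)
  also have "\<dots> = P (1/2) - P (-1/2)"
    by (rule integral_FTC_atLeastAtMost) (auto intro!: der continuous_intros)
  also have "\<dots> = 0"
  proof -
    have "cis (2 * pi * of_int n * (1/2)) = cis (2 * pi * of_int n * (-1/2))"
      using cis_pi_of_int[of n] by (simp add: mult.commute)
    then show ?thesis by (simp add: P_def)
  qed
  finally show ?thesis using False by simp
qed simp

text \<open>The difference between \<open>g\<close> and its partial Fourier sum is orthogonal to the characters in the
  sum, and its square integral is nonnegative.\<close>

lemma bessel_inequality:
  fixes g :: "real \<Rightarrow> complex"
  assumes g[measurable]: "g \<in> borel_measurable borel" and B: "\<And>y. y \<in> J \<Longrightarrow> cmod (g y) \<le> B" and A: "finite A"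
  defines "c \<equiv> \<lambda>n::int. LINT y|unit_cell. g y * cis (- (2 * pi * of_int n * y))"
  shows "(\<Sum>n\<in>A. (cmod (c n))\<^sup>2) \<le> B\<^sup>2"
proof -
  define E where "E n y = cis (2 * pi * of_int n * y)" for n :: int and y
  have E: "cmod (E n y) = 1" "cis (- (2 * pi * of_int n * y)) = cnj (E n y)" "E m y * cnj (E n y) = E (m - n) y" for n m y
    by (simp_all add: E_def cis_cnj cis_mult algebra_simps)
  have [measurable]: "E n \<in> borel_measurable borel" for n unfolding E_def by measurable
  have [measurable]: "cnj \<in> borel_measurable borel" by (intro borel_measurable_continuous_onI continuous_intros)
  have c: "c n = (LINT y|unit_cell. g y * cnj (E n y))" for n by (simp add: c_def E)
  have EI: "(LINT y|unit_cell. E n y) = (if n = 0 then 1 else 0)" for n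
    unfolding E_def by (rule unit_cell_character)
  define G where "G y = (\<Sum>n\<in>A. c n * E n y)" for y
  define h where "h y = g y - G y" for y
  have [measurable]: "G \<in> borel_measurable borel" unfolding G_def by measurable
  have [measurable]: "h \<in> borel_measurable borel" unfolding h_def by measurable
  have bG: "cmod (G y) \<le> (\<Sum>n\<in>A. cmod (c n))" for y
    unfolding G_def by (intro sum_norm_le) (simp add: norm_mult E)
  have bh: "cmod (h y) \<le> B + (\<Sum>n\<in>A. cmod (c n))" if "y \<in> J" for y
    unfolding h_def using B[OF that] bG[of y] norm_triangle_ineq4[of "g y" "G y"] by linarith
  have B0: "B \<ge> 0" using order_trans[OF norm_ge_zero B[of 0]] by (simp add: J_def)
  have ig: "integrable unit_cell (\<lambda>y. g y * cnj (E n y))" for n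
    by (rule unit_cell_integrable[where B = B]) (use B in \<open>auto simp: norm_mult E\<close>)
  have ih: "integrable unit_cell (\<lambda>y. h y * cnj (E n y))" for n
    by (rule unit_cell_integrable) (use bh in \<open>auto simp: norm_mult E\<close>)
  have ic: "integrable unit_cell (\<lambda>y. c n * E m y)" for m n
    by (rule unit_cell_integrable[where B = "cmod (c n)"]) (auto simp: norm_mult E)
  note lin = Bochner_Integration.integral_diff Bochner_Integration.integrable_sum Bochner_Integration.integral_sum
  have orth: "(LINT y|unit_cell. h y * cnj (E n y)) = 0" if n: "n \<in> A" for n
  proof -
    have "h y * cnj (E n y) = g y * cnj (E n y) - (\<Sum>m\<in>A. c m * E (m - n) y)" for y
      by (simp only: h_def G_def left_diff_distrib sum_distrib_right mult.assoc E)
    then have "(LINT y|unit_cell. h y * cnj (E n y))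
       = (LINT y|unit_cell. g y * cnj (E n y)) - (\<Sum>m\<in>A. LINT y|unit_cell. c m * E (m - n) y)"
      using ig ic by (simp only: lin)
    also have "(\<Sum>m\<in>A. LINT y|unit_cell. c m * E (m - n) y) = (\<Sum>m\<in>A. if m = n then c m else 0)"
      by (rule sum.cong) (simp_all only: integral_mult_right_zero EI, simp)
    also have "\<dots> = c n" using n A by simp
    finally show ?thesis by (simp add: c)
  qed
  have "(LINT y|unit_cell. h y * cnj (h y)) = (LINT y|unit_cell. h y * cnj (g y))"
  proof -
    have "h y * cnj (h y) = h y * cnj (g y - G y)" for y by (simp only: h_def)
    then have "h y * cnj (h y) = h y * cnj (g y) - (\<Sum>n\<in>A. cnj (c n) * (h y * cnj (E n y)))" for y
      by (simp only: G_def complex_cnj_diff cnj_sum complex_cnj_mult right_diff_distrib sum_distrib_left mult.left_commute)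
    moreover have "integrable unit_cell (\<lambda>y. h y * cnj (g y))"
      by (rule unit_cell_integrable[where B = "(B + (\<Sum>n\<in>A. cmod (c n))) * B"])
        (use bh B B0 in \<open>auto simp: norm_mult intro!: mult_mono sum_nonneg add_nonneg_nonneg\<close>)
    moreover have "integrable unit_cell (\<lambda>y. cnj (c n) * (h y * cnj (E n y)))" for n
      by (intro integrable_mult_right ih)
    ultimately have "(LINT y|unit_cell. h y * cnj (h y)) = (LINT y|unit_cell. h y * cnj (g y))
        - (\<Sum>n\<in>A. LINT y|unit_cell. cnj (c n) * (h y * cnj (E n y)))"
      by (simp only: lin)
    also have "(\<Sum>n\<in>A. LINT y|unit_cell. cnj (c n) * (h y * cnj (E n y))) = 0"
      using orth by (intro sum.neutral) simp
    finally show ?thesis by simp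
  qed
  also have "\<dots> = (LINT y|unit_cell. g y * cnj (g y)) - (\<Sum>n\<in>A. c n * cnj (c n))"
  proof -
    have "c n * E n y * cnj (g y) = c n * cnj (g y * cnj (E n y))" for n y by simp
    then have "h y * cnj (g y) = g y * cnj (g y) - (\<Sum>n\<in>A. c n * cnj (g y * cnj (E n y)))" for y
      by (simp only: h_def G_def left_diff_distrib sum_distrib_right)
    moreover have "integrable unit_cell (\<lambda>y. g y * cnj (g y))"
      by (rule unit_cell_integrable[where B = "B * B"]) (use B B0 in \<open>auto simp: norm_mult intro!: mult_mono\<close>)
    moreover have "integrable unit_cell (\<lambda>y. c n * cnj (g y * cnj (E n y)))" for n
      by (intro integrable_mult_right integrable_cnj ig)
    ultimately have "(LINT y|unit_cell. h y * cnj (g y)) = (LINT y|unit_cell. g y * cnj (g y))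
        - (\<Sum>n\<in>A. LINT y|unit_cell. c n * cnj (g y * cnj (E n y)))"
      by (simp only: lin)
    also have "(\<Sum>n\<in>A. LINT y|unit_cell. c n * cnj (g y * cnj (E n y))) = (\<Sum>n\<in>A. c n * cnj (c n))"
      by (simp only: integral_mult_right_zero Bochner_Integration.integral_cnj c)
    finally show ?thesis .
  qed
  finally have eq: "(LINT y|unit_cell. h y * cnj (h y)) = (LINT y|unit_cell. g y * cnj (g y)) - (\<Sum>n\<in>A. c n * cnj (c n))" .
  have re: "z * cnj z = of_real ((cmod z)\<^sup>2)" for z using complex_norm_square[of z] by simp
  have "complex_of_real (LINT y|unit_cell. (cmod (h y))\<^sup>2) = of_real ((LINT y|unit_cell. (cmod (g y))\<^sup>2) - (\<Sum>n\<in>A. (cmod (c n))\<^sup>2))"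
    using eq unfolding re by (simp only: integral_complex_of_real of_real_diff of_real_sum)
  then have "(LINT y|unit_cell. (cmod (h y))\<^sup>2) = (LINT y|unit_cell. (cmod (g y))\<^sup>2) - (\<Sum>n\<in>A. (cmod (c n))\<^sup>2)"
    by (simp only: of_real_eq_iff)
  moreover have "(LINT y|unit_cell. (cmod (h y))\<^sup>2) \<ge> 0" by simp
  moreover have "(LINT y|unit_cell. (cmod (g y))\<^sup>2) \<le> B\<^sup>2"
  proof -
    have "norm (LINT y|unit_cell. (cmod (g y))\<^sup>2) \<le> B\<^sup>2"
      by (rule unit_cell_integral_norm_le) (use B B0 in \<open>auto intro!: power_mono\<close>)
    then show ?thesis by simp
  qed
  ultimately show ?thesis by linarith
qed

text \<open>By Bessel's inequality the squares of the coefficients are summable.\<close>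

lemma riemann_lebesgue:
  fixes g :: "real \<Rightarrow> complex"
  assumes g: "g \<in> borel_measurable borel" "\<And>y. y \<in> J \<Longrightarrow> cmod (g y) \<le> B" and u: "inj u"
  shows "(\<lambda>N::nat. LINT y|unit_cell. g y * cis (- (2 * pi * of_int (u N) * y))) \<longlonglongrightarrow> 0"
proof -
  define c where "c n = (LINT y|unit_cell. g y * cis (- (2 * pi * of_int n * y)))" for n :: int
  have "summable (\<lambda>N. (cmod (c (u N)))\<^sup>2)"
  proof (rule summableI_nonneg_bounded)
    fix M
    have "(\<Sum>N<M. (cmod (c (u N)))\<^sup>2) = (\<Sum>n\<in>u ` {..<M}. (cmod (c n))\<^sup>2)"
      using u by (subst sum.reindex) (auto intro: inj_on_subset)
    also have "\<dots> \<le> B\<^sup>2" unfolding c_def by (rule bessel_inequality[OF g]) auto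
    finally show "(\<Sum>N<M. (cmod (c (u N)))\<^sup>2) \<le> B\<^sup>2" .
  qed auto
  then have "(\<lambda>N. (cmod (c (u N)))\<^sup>2) \<longlonglongrightarrow> 0" by (rule summable_LIMSEQ_zero)
  then have "(\<lambda>N. sqrt ((cmod (c (u N)))\<^sup>2)) \<longlonglongrightarrow> sqrt 0" by (rule tendsto_real_sqrt)
  then have "(\<lambda>N. c (u N)) \<longlonglongrightarrow> 0" by (simp add: tendsto_norm_zero_iff)
  then show ?thesis by (simp add: c_def)
qed

section \<open>Poisson summation\<close>

lemma unit_cell_translate_integral:
  fixes g :: "real \<Rightarrow> 'a::{banach, second_countable_topology}"
  shows "(LINT y|unit_cell. g (of_int k + y)) = (LINT y|lborel. indicator J (y - of_int k) *\<^sub>R g y)"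
  unfolding unit_cell_integral
  using lborel_integral_real_affine[of 1 "\<lambda>y. indicator J (y - of_int k) *\<^sub>R g y" "of_int k"] by simp

lemma sum_unit_cell_translates_tendsto:
  fixes g :: "real \<Rightarrow> 'a::{banach, second_countable_topology}"
  assumes g: "integrable lborel g"
  shows "(\<lambda>K. \<Sum>k\<in>{- int K..int K}. LINT y|unit_cell. g (of_int k + y)) \<longlonglongrightarrow> (LINT y|lborel. g y)"
proof -
  have [measurable]: "g \<in> borel_measurable borel" using g by simp
  define U where "U K = {- 1/2 - real K..<real K + 1/2}" for K
  have fin: "(\<Sum>k\<in>{- int K..int K}. indicator J (y - of_int k)) = (indicator (U K) y :: real)" for K y
  proof -
    define m where "m = \<lfloor>y + 1/2\<rfloor>"
    have m: "y - of_int k \<in> J \<longleftrightarrow> k = m" for k unfolding m_def J_def by (auto; linarith)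
    have "(\<Sum>k\<in>{- int K..int K}. indicator J (y - of_int k)) = (\<Sum>k\<in>{- int K..int K}. if k = m then 1 else 0 :: real)"
      by (rule sum.cong) (auto simp: indicator_def m)
    also have "\<dots> = (if m \<in> {- int K..int K} then 1 else 0)" by simp
    also have "\<dots> = indicator (U K) y" unfolding m_def U_def by (auto simp: indicator_def; linarith)
    finally show ?thesis .
  qed
  have eq: "(\<Sum>k\<in>{- int K..int K}. LINT y|unit_cell. g (of_int k + y)) = (LINT y|lborel. indicator (U K) y *\<^sub>R g y)" for K
  proof -
    have 2: "integrable lborel (\<lambda>y. indicator J (y - of_int k) *\<^sub>R g y)" for k :: int
      by (rule Bochner_Integration.integrable_bound[OF g]) (auto simp: indicator_def)
    have "(\<Sum>k\<in>{- int K..int K}. LINT y|lborel. indicator J (y - of_int k) *\<^sub>R g y)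
        = (LINT y|lborel. (\<Sum>k\<in>{- int K..int K}. indicator J (y - of_int k) *\<^sub>R g y))"
      using 2 by (intro Bochner_Integration.integral_sum[symmetric])
    also have "\<dots> = (LINT y|lborel. indicator (U K) y *\<^sub>R g y)"
      by (simp only: scaleR_sum_left[symmetric] fin)
    finally show ?thesis unfolding unit_cell_translate_integral .
  qed
  show ?thesis unfolding eq
  proof (rule integral_dominated_convergence[where w = "\<lambda>y. norm (g y)"])
    show "AE y in lborel. (\<lambda>K. indicator (U K) y *\<^sub>R g y) \<longlonglongrightarrow> g y"
    proof (rule AE_I2)
      fix y
      obtain K0 :: nat where K0: "\<bar>y\<bar> < real K0" using reals_Archimedean2 by blast
      show "(\<lambda>K. indicator (U K) y *\<^sub>R g y) \<longlonglongrightarrow> g y"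
      proof (rule tendsto_eventually, rule eventually_sequentiallyI[of K0])
        fix K assume "K0 \<le> K"
        then have "y \<in> U K" using K0 by (auto simp: U_def)
        then show "indicator (U K) y *\<^sub>R g y = g y" by simp
      qed
    qed
  qed (use g in \<open>auto simp: indicator_def U_def\<close>)
qed

text \<open>The geometric sum for the Dirichlet kernel, kept in product form so that it holds at integers
  too.\<close>

lemma dirichlet_kernel_telescope:
  "(cis (2 * pi * y) - 1) * (\<Sum>n\<in>{- int N..int N}. cis (- (2 * pi * of_int n * y)))
     = cis (2 * pi * of_int (int N + 1) * y) - cis (- (2 * pi * of_int (int N) * y))"
proof (induction N)
  case (Suc N)
  have "(cis (2 * pi * y) - 1) * cis (- (2 * pi * of_int (int N + 1) * y))
      = cis (- (2 * pi * of_int (int N) * y)) - cis (- (2 * pi * of_int (int (Suc N)) * y))"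
    by (simp add: left_diff_distrib cis_mult algebra_simps)
  moreover have "(cis (2 * pi * y) - 1) * cis (- (2 * pi * of_int (- int N - 1) * y))
      = cis (2 * pi * of_int (int (Suc N) + 1) * y) - cis (2 * pi * of_int (int N + 1) * y)"
    by (simp add: left_diff_distrib cis_mult algebra_simps)
  ultimately show ?case unfolding symmetric_sum_Suc distrib_left Suc.IH by simp
qed (simp add: algebra_simps)

text \<open>Cut into unit cells, the left sum becomes \<open>\<Sum>_k \<integral>_J h(k + y) D_N(y) dy\<close> with the Dirichlet kernel
  \<open>D_N\<close>, whose integral is 1.  In \<open>\<integral>_J (h(k + y) - h(k)) D_N(y) dy\<close> the quotient of the increment of \<open>h\<close>
  by \<open>e(y) - 1\<close> is bounded, and the product of \<open>e(y) - 1\<close> with \<open>D_N\<close> is a difference of two characters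
  of frequency about \<open>N\<close>.  So the term of index \<open>k\<close> tends to 0 by the Riemann-Lebesgue lemma, and it is
  \<open>O(1 / (1 + k^2))\<close> uniformly in \<open>N\<close>.\<close>

lemma poisson_summation:
  fixes h :: "real \<Rightarrow> complex"
  assumes h[measurable]: "h \<in> borel_measurable borel"
    and decay: "\<And>y. cmod (h y) \<le> C / (1 + y\<^sup>2)"
    and lip: "\<And>y s. \<bar>s\<bar> \<le> 1/2 \<Longrightarrow> cmod (h (y + s) - h y) \<le> C * \<bar>s\<bar> / (1 + y\<^sup>2)"
  shows "(\<lambda>N. (\<Sum>n\<in>{- int N..int N}. LINT y|lborel. h y * cis (- (2 * pi * of_int n * y)))
           - (\<Sum>k\<in>{- int N..int N}. h (of_int k))) \<longlonglongrightarrow> 0"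
proof -
  have C: "C \<ge> 0" using order_trans[OF norm_ge_zero decay[of 0]] by simp
  define D where "D N y = (\<Sum>n\<in>{- int N..int N}. cis (- (2 * pi * of_int n * y)))" for N y
  define S where "S N = (LINT y|lborel. h y * D N y)" for N
  define H where "H N = (\<Sum>k\<in>{- int N..int N}. h (of_int k))" for N
  define r where "r k N = (LINT y|unit_cell. (h (of_int k + y) - h (of_int k)) * D N y)" for k :: int and N
  have [measurable]: "D N \<in> borel_measurable borel" for N unfolding D_def by measurable
  have bD: "cmod (D N y) \<le> 2 * real N + 1" for N y
  proof -
    have "cmod (D N y) \<le> (\<Sum>n\<in>{- int N..int N}. 1)" unfolding D_def by (rule sum_norm_le) simp
    then show ?thesis by simp
  qed
  have S: "(\<Sum>n\<in>{- int N..int N}. LINT y|lborel. h y * cis (- (2 * pi * of_int n * y))) = S N" for N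
  proof -
    have "integrable lborel (\<lambda>y. h y * cis (- (2 * pi * of_int n * y)))" for n :: int
      by (rule integrable_of_quadratic_decay[where C = C]) (use decay in \<open>auto simp: norm_mult\<close>)
    then show ?thesis unfolding S_def D_def sum_distrib_left by (simp add: Bochner_Integration.integral_sum)
  qed
  have iS: "integrable lborel (\<lambda>y. h y * D N y)" for N
  proof (rule integrable_of_quadratic_decay)
    fix y
    show "cmod (h y * D N y) \<le> (C * (2 * real N + 1)) / (1 + y\<^sup>2)"
      using mult_mono[OF decay[of y] bD[of N y]] C by (simp add: norm_mult)
  qed simp
  have per: "D N (of_int k + y) = D N y" for k :: int and N y
  proof -
    have "cis (- (2 * pi * of_int n * (of_int k + y))) = cis (- (2 * pi * of_int n * y))" for n :: int
    proof -
      have "cis (- (2 * pi * of_int n * (of_int k + y))) = cis (2 * pi * of_int (- n * k)) * cis (- (2 * pi * of_int n * y))"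
        unfolding cis_mult by (simp add: algebra_simps)
      then show ?thesis by (simp only: cis_2pi_of_int) simp
    qed
    then show ?thesis by (simp add: D_def)
  qed
  have iD: "(LINT y|unit_cell. D N y) = 1" for N
  proof -
    have "(LINT y|unit_cell. D N y) = (\<Sum>n\<in>{- int N..int N}. LINT y|unit_cell. cis (2 * pi * of_int (- n) * y))"
      unfolding D_def by (subst Bochner_Integration.integral_sum) (auto intro!: unit_cell_integrable[where B = 1])
    also have "\<dots> = (\<Sum>n\<in>{- int N..int N}. if n = 0 then 1 else 0)"
      unfolding unit_cell_character by (rule sum.cong) auto
    finally show ?thesis by simp
  qed
  have cell: "(LINT y|unit_cell. h (of_int k + y) * D N y) = h (of_int k) + r k N" for k :: int and N
  proof -
    have bh: "cmod (h y) \<le> C" for y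
    proof -
      have "C / (1 + y\<^sup>2) \<le> C / 1" using C by (intro divide_left_mono) (auto simp: add_pos_nonneg)
      then show ?thesis using decay[of y] by simp
    qed
    have 1: "integrable unit_cell (\<lambda>y. h (of_int k + y) * D N y)"
      by (rule unit_cell_integrable[where B = "C * (2 * real N + 1)"])
        (use bh bD C in \<open>auto simp: norm_mult intro!: mult_mono\<close>)
    have 2: "integrable unit_cell (\<lambda>y. h (of_int k) * D N y)"
      by (rule unit_cell_integrable[where B = "C * (2 * real N + 1)"])
        (use bh bD C in \<open>auto simp: norm_mult intro!: mult_mono\<close>)
    have "r k N = (LINT y|unit_cell. h (of_int k + y) * D N y) - (LINT y|unit_cell. h (of_int k) * D N y)"
      unfolding r_def left_diff_distrib by (rule Bochner_Integration.integral_diff[OF 1 2])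
    then show ?thesis by (simp add: iD)
  qed
  have lim: "(\<lambda>K. \<Sum>k\<in>{- int K..int K}. h (of_int k) + r k N) \<longlonglongrightarrow> S N" for N
    using sum_unit_cell_translates_tendsto[OF iS[of N]] unfolding per cell S_def .
  \<comment> \<open>At \<open>y = 0\<close> the quotient is 0 by convention, in agreement with the vanishing increment of \<open>h\<close>.\<close>
  define g where "g k y = (h (of_int k + y) - h (of_int k)) / (cis (2 * pi * y) - 1)" for k :: int and y
  have [measurable]: "g k \<in> borel_measurable borel" for k unfolding g_def by measurable
  have half: "\<bar>y\<bar> \<le> 1/2" if "y \<in> J" for y using that by (auto simp: J_def)
  have bg: "cmod (g k y) \<le> C / (1 + (of_int k)\<^sup>2)" if y: "y \<in> J" for k y
  proof (cases "y = 0")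
    case False
    have "cmod (g k y) \<le> (C * \<bar>y\<bar> / (1 + (of_int k)\<^sup>2)) / \<bar>y\<bar>"
      unfolding g_def norm_divide using False C
      by (intro frac_le lip half y cis_minus_one_ge) auto
    then show ?thesis using False by simp
  qed (use C in \<open>simp add: g_def\<close>)
  have gh: "g k y * (cis (2 * pi * y) - 1) = h (of_int k + y) - h (of_int k)" if y: "y \<in> J" for k y
    using cis_minus_one_ge[OF half[OF y]] by (cases "y = 0") (auto simp: g_def)
  have ig: "integrable unit_cell (\<lambda>y. g k y * cis (- (2 * pi * of_int n * y)))" for k n
    by (rule unit_cell_integrable[where B = "C / (1 + (of_int k)\<^sup>2)"]) (use bg in \<open>auto simp: norm_mult\<close>)
  have r: "r k N = (LINT y|unit_cell. g k y * cis (- (2 * pi * of_int (- int N - 1) * y)))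
      - (LINT y|unit_cell. g k y * cis (- (2 * pi * of_int (int N) * y)))" for k N
  proof -
    have "r k N = (LINT y|unit_cell. g k y * cis (- (2 * pi * of_int (- int N - 1) * y)) - g k y * cis (- (2 * pi * of_int (int N) * y)))"
      unfolding r_def
    proof (rule Bochner_Integration.integral_cong)
      fix y assume "y \<in> space unit_cell"
      then have y: "y \<in> J" by simp
      have e: "- (2 * pi * of_int (- int N - 1) * y) = 2 * pi * of_int (int N + 1) * y" by (simp add: algebra_simps)
      show "(h (of_int k + y) - h (of_int k)) * D N y
         = g k y * cis (- (2 * pi * of_int (- int N - 1) * y)) - g k y * cis (- (2 * pi * of_int (int N) * y))"
      proof -
        have "(h (of_int k + y) - h (of_int k)) * D N y = g k y * ((cis (2 * pi * y) - 1) * D N y)"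
          by (simp only: gh[OF y, symmetric] mult.assoc)
        also have "\<dots> = g k y * (cis (2 * pi * of_int (int N + 1) * y) - cis (- (2 * pi * of_int (int N) * y)))"
          by (simp only: D_def dirichlet_kernel_telescope)
        finally show ?thesis by (simp only: right_diff_distrib e)
      qed
    qed simp
    also have "\<dots> = (LINT y|unit_cell. g k y * cis (- (2 * pi * of_int (- int N - 1) * y)))
      - (LINT y|unit_cell. g k y * cis (- (2 * pi * of_int (int N) * y)))"
      by (rule Bochner_Integration.integral_diff[OF ig ig])
    finally show ?thesis .
  qed
  have r0: "(\<lambda>N. r k N) \<longlonglongrightarrow> 0" for k
  proof -
    have "(\<lambda>N. (LINT y|unit_cell. g k y * cis (- (2 * pi * of_int (- int N - 1) * y)))
      - (LINT y|unit_cell. g k y * cis (- (2 * pi * of_int (int N) * y)))) \<longlonglongrightarrow> 0 - 0"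
      by (intro tendsto_diff riemann_lebesgue[where B = "C / (1 + (of_int k)\<^sup>2)"] bg) (auto simp: inj_def)
    then show ?thesis unfolding r[symmetric] by simp
  qed
  have br: "cmod (r k N) \<le> 2 * C / (1 + (of_int k)\<^sup>2)" for k N
  proof -
    have "cmod (LINT y|unit_cell. g k y * cis (- (2 * pi * of_int n * y))) \<le> C / (1 + (of_int k)\<^sup>2)" for n
      by (rule unit_cell_integral_norm_le) (use bg in \<open>auto simp: norm_mult\<close>)
    then have "cmod (r k N) \<le> C / (1 + (of_int k)\<^sup>2) + C / (1 + (of_int k)\<^sup>2)"
      unfolding r by (intro order_trans[OF norm_triangle_ineq4] add_mono)
    then show ?thesis by simp
  qed
  \<comment> \<open>The terms with \<open>|k| \<le> K0\<close> are kept for the limit in \<open>N\<close>; the others are estimated uniformly in \<open>N\<close>.\<close>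
  have est: "cmod (S N - H N) \<le> (\<Sum>k\<in>{- int K0..int K0}. cmod (r k N)) + 3 * (2 * C) / (real K0 + 1) + 3 * C / (real N + 1)" for N K0
  proof -
    define R where "R K = (\<Sum>k\<in>{- int K..int K}. r k N)" for K
    have "(\<lambda>K. cmod ((\<Sum>k\<in>{- int K..int K}. h (of_int k) + r k N) - H N)) \<longlonglongrightarrow> cmod (S N - H N)"
      by (intro tendsto_intros lim)
    then show ?thesis
    proof (rule LIMSEQ_le_const2, intro exI allI impI)
      fix K assume K: "max N K0 \<le> K"
      have "(\<Sum>k\<in>{- int K..int K}. h (of_int k) + r k N) - H N = R K0 + (R K - R K0) + (H K - H N)"
        by (simp add: R_def H_def sum.distrib)
      also have "cmod \<dots> \<le> (\<Sum>k\<in>{- int K0..int K0}. cmod (r k N)) + 3 * (2 * C) / (real K0 + 1) + 3 * C / (real N + 1)"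
      proof (intro norm_triangle_mono)
        show "cmod (R K0) \<le> (\<Sum>k\<in>{- int K0..int K0}. cmod (r k N))" unfolding R_def by (rule norm_sum)
        show "cmod (R K - R K0) \<le> 3 * (2 * C) / (real K0 + 1)"
          unfolding R_def using K by (intro symmetric_tail_le br) auto
        show "cmod (H K - H N) \<le> 3 * C / (real N + 1)"
          unfolding H_def using K decay by (intro symmetric_tail_le) auto
      qed
      finally show "cmod ((\<Sum>k\<in>{- int K..int K}. h (of_int k) + r k N) - H N) \<le> \<dots>" .
    qed
  qed
  have "(\<lambda>N. S N - H N) \<longlonglongrightarrow> 0"
  proof (rule LIMSEQ_I)
    fix e :: real assume e: "e > 0"
    obtain K0 :: nat where K0: "real K0 > 3 * (2 * C) / (e / 2)" using reals_Archimedean2 by blast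
    then have K0': "3 * (2 * C) / (real K0 + 1) < e / 2" using e by (simp add: field_simps)
    have "(\<lambda>N. (\<Sum>k\<in>{- int K0..int K0}. cmod (r k N)) + 3 * C / (real N + 1)) \<longlonglongrightarrow> (\<Sum>k\<in>{- int K0..int K0}. cmod 0) + 0"
    proof (intro tendsto_add tendsto_sum tendsto_norm r0)
      show "(\<lambda>N. 3 * C / (real N + 1)) \<longlonglongrightarrow> 0"
        using tendsto_mult_right_zero[OF LIMSEQ_inverse_real_of_nat, of "3 * C"] by (simp add: divide_inverse add.commute)
    qed
    then have "\<forall>\<^sub>F N in sequentially. (\<Sum>k\<in>{- int K0..int K0}. cmod (r k N)) + 3 * C / (real N + 1) < e / 2"
      using e by (intro order_tendstoD(2)) auto
    then have "\<forall>\<^sub>F N in sequentially. norm (S N - H N - 0) < e"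
    proof eventually_elim
      case (elim N)
      then show ?case using est[of N K0] K0' by simp
    qed
    then show "\<exists>no. \<forall>N\<ge>no. norm (S N - H N - 0) < e" by (simp add: eventually_sequentially)
  qed
  then show ?thesis unfolding S H_def .
qed

section \<open>Trigonometric sums attached to a Schwartz function\<close>

lemma inverse_quadratic_shift:
  fixes x u C :: real
  assumes "\<bar>u\<bar> \<le> 1/2" "C \<ge> 0"
  shows "C / (1 + (x + u)\<^sup>2) \<le> 2 * C / (1 + x\<^sup>2)"
proof (rule frac_le_cross)
  define v where "v = x + u"
  have "0 \<le> (x + 2 * u) * (x + 2 * u)" by simp
  then have "x * x \<le> 2 * (v * v) + 2 * (u * u)" by (simp add: v_def algebra_simps)
  moreover have "u * u \<le> 1/4"
    using mult_mono[OF assms(1) assms(1)] by (simp add: abs_mult_self_eq)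
  ultimately have "1 + x * x \<le> 2 * (1 + v * v)" by (simp add: distrib_left)
  then have "C * (1 + x * x) \<le> C * (2 * (1 + (x + u) * (x + u)))"
    unfolding v_def using assms by (intro mult_left_mono) auto
  then show "C * (1 + x\<^sup>2) \<le> 2 * C * (1 + (x + u)\<^sup>2)" by (simp add: power2_eq_square algebra_simps)
qed (auto simp: add_pos_nonneg)

lemma cis_lipschitz: "cmod (cis a - cis b) \<le> \<bar>a - b\<bar>"
proof -
  have "cis a - cis b = cis b * (cis (a - b) - 1)" by (simp add: right_diff_distrib cis_mult)
  then have "cmod (cis a - cis b) = cmod (cis (a - b) - 1)" by (simp add: norm_mult)
  also have "\<dots> \<le> \<bar>a - b\<bar>"
  proof -
    define x where "x = (a - b) / 2"
    have "2 * x = a - b" by (simp add: x_def)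
    then have "cmod (cis (a - b) - 1) = 2 * \<bar>sin x\<bar>" using norm_cis_minus_one[of x] by simp
    then show ?thesis using abs_sin_x_le_abs_x[of x] by (simp add: x_def)
  qed
  finally show ?thesis .
qed

lemma quadratic_decay_lipschitz:
  fixes f f1 :: "real \<Rightarrow> complex"
  assumes d: "\<And>x. (f has_vector_derivative f1 x) (at x)" and C: "C \<ge> 0"
    and f1: "\<And>x. cmod (f1 x) \<le> C / (1 + x\<^sup>2)" and s: "\<bar>s\<bar> \<le> 1/2"
  shows "cmod (f (z + s) - f z) \<le> 2 * C / (1 + z\<^sup>2) * \<bar>s\<bar>"
proof -
  have "norm (f (z + s) - f z) \<le> 2 * C / (1 + z\<^sup>2) * norm ((z + s) - z)"
  proof (rule differentiable_bound[of "closed_segment z (z + s)" f "\<lambda>x h. h *\<^sub>R f1 x"])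
    fix x assume x: "x \<in> closed_segment z (z + s)"
    show "(f has_derivative (\<lambda>h. h *\<^sub>R f1 x)) (at x within closed_segment z (z + s))"
      using d[of x] unfolding has_vector_derivative_def by (rule has_derivative_at_withinI)
    have "\<bar>x - z\<bar> \<le> \<bar>s\<bar>" using x by (auto simp: closed_segment_eq_real_ivl split: if_splits)
    then have "C / (1 + (z + (x - z))\<^sup>2) \<le> 2 * C / (1 + z\<^sup>2)" using s C by (intro inverse_quadratic_shift) auto
    then have le: "cmod (f1 x) \<le> 2 * C / (1 + z\<^sup>2)" using f1[of x] by simp
    show "onorm (\<lambda>h. h *\<^sub>R f1 x) \<le> 2 * C / (1 + z\<^sup>2)"
    proof (rule onorm_bound)
      show "0 \<le> 2 * C / (1 + z\<^sup>2)" using C by simp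
      show "norm (h *\<^sub>R f1 x) \<le> 2 * C / (1 + z\<^sup>2) * norm h" for h :: real
        unfolding norm_scaleR real_norm_def mult.commute[of "\<bar>h\<bar>"] by (intro mult_right_mono le) simp
    qed
  qed auto
  then show ?thesis by simp
qed

definition trig_sum :: "(int \<Rightarrow> complex) \<Rightarrow> nat \<Rightarrow> real \<Rightarrow> complex" where
  "trig_sum a N \<theta> = (\<Sum>n\<in>{- int N..int N}. a n * cis (2 * pi * of_int n * \<theta>))"

lemma trig_sum_measurable [measurable]: "trig_sum a N \<in> borel_measurable borel"
  unfolding trig_sum_def by measurable

lemma trig_sum_norm_le: "cmod (trig_sum a N \<theta>) \<le> (\<Sum>n\<in>{- int N..int N}. cmod (a n))"
  unfolding trig_sum_def by (rule sum_norm_le) (simp add: norm_mult)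

lemma trig_sum_power_integrable:
  assumes "p > 0"
  shows "integrable unit_cell (\<lambda>\<theta>. cmod (trig_sum a N \<theta>) powr p)"
  by (rule unit_cell_integrable[where B = "(\<Sum>n\<in>{- int N..int N}. cmod (a n)) powr p"])
    (use assms trig_sum_norm_le in \<open>auto intro!: powr_mono2\<close>)

text \<open>The \<open>n\<close>-th Fourier coefficient of the periodic function that belongs to the integer \<open>l\<close> and to
  the Taylor term of degree \<open>j\<close>.\<close>

definition cell_moment :: "(real \<Rightarrow> complex) \<Rightarrow> nat \<Rightarrow> int \<Rightarrow> int \<Rightarrow> complex" where
  "cell_moment f j l n =
     (LINT t|unit_cell. fourier f (of_int n + t) * (of_real (t ^ j) * cis (2 * pi * t * of_int l)))"

abbreviation cell_poly :: "(real \<Rightarrow> complex) \<Rightarrow> nat \<Rightarrow> int \<Rightarrow> nat \<Rightarrow> real \<Rightarrow> complex" where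
  "cell_poly f j l N \<equiv> trig_sum (cell_moment f j l) N"

lemma J_bound: "t \<in> J \<Longrightarrow> \<bar>t\<bar> \<le> 1/2"
  by (auto simp: J_def)

lemma cell_weight_bound:
  "t \<in> J \<Longrightarrow> cmod (of_real (t ^ j) * cis a) \<le> 1"
  using J_bound[of t] by (simp add: norm_mult norm_power power_le_one)

lemma cell_moment_bound:
  assumes "f \<in> borel_measurable borel" "C \<ge> 0" "\<And>\<xi>. cmod (fourier f \<xi>) \<le> C / (1 + \<xi>\<^sup>2)"
  shows "cmod (cell_moment f j l n) \<le> 2 * C / (1 + (of_int n)\<^sup>2)"
  unfolding cell_moment_def
proof (rule unit_cell_integral_norm_le)
  note [measurable] = fourier_measurable[OF assms(1)]
  show "(\<lambda>t. fourier f (of_int n + t) * (of_real (t ^ j) * cis (2 * pi * t * of_int l))) \<in> borel_measurable borel"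
    by measurable
  fix t assume t: "t \<in> J"
  have "cmod (fourier f (of_int n + t) * (of_real (t ^ j) * cis (2 * pi * t * of_int l))) \<le> C / (1 + (of_int n + t)\<^sup>2) * 1"
    unfolding norm_mult[of "fourier f _"] using assms(2)
    by (intro mult_mono assms(3) cell_weight_bound t) (auto simp: add_nonneg_nonneg)
  also have "\<dots> \<le> 2 * C / (1 + (of_int n)\<^sup>2)"
    using inverse_quadratic_shift[OF J_bound[OF t] assms(2)] by simp
  finally show "cmod (fourier f (of_int n + t) * (of_real (t ^ j) * cis (2 * pi * t * of_int l))) \<le> 2 * C / (1 + (of_int n)\<^sup>2)" .
qed

text \<open>This identifies the integrals in the Poisson summation formula for
  \<open>y \<mapsto> f(\<theta> + y) e(- t (\<theta> + y))\<close>.\<close>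

lemma fourier_translate_modulate:
  assumes "f \<in> borel_measurable borel"
  shows "(LINT y|lborel. f (\<theta> + y) * cis (- (2 * pi * t * (\<theta> + y))) * cis (- (2 * pi * of_int n * y)))
     = fourier f (of_int n + t) * cis (2 * pi * of_int n * \<theta>)"
proof -
  have "(LINT y|lborel. f (\<theta> + y) * cis (- (2 * pi * t * (\<theta> + y))) * cis (- (2 * pi * of_int n * y)))
     = (LINT y|lborel. f y * cis (- (2 * pi * t * y)) * cis (- (2 * pi * of_int n * (y - \<theta>))))"
    using lborel_integral_real_affine[of 1 "\<lambda>y. f y * cis (- (2 * pi * t * y)) * cis (- (2 * pi * of_int n * (y - \<theta>)))" \<theta>] by simp
  also have "\<dots> = (LINT y|lborel. (f y * cis (- (2 * pi * y * (of_int n + t)))) * cis (2 * pi * of_int n * \<theta>))"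
    by (rule Bochner_Integration.integral_cong) (simp_all add: mult.assoc cis_mult algebra_simps)
  also have "\<dots> = fourier f (of_int n + t) * cis (2 * pi * of_int n * \<theta>)"
    unfolding fourier_lborel[OF assms] by (rule integral_mult_left_zero)
  finally show ?thesis .
qed

lemma poisson_modulated:
  assumes f: "schwartz f" and \<theta>: "\<bar>\<theta>\<bar> \<le> 1/2" and t: "\<bar>t\<bar> \<le> 1/2"
  shows "(\<lambda>N. (\<Sum>n\<in>{- int N..int N}. fourier f (of_int n + t) * cis (2 * pi * of_int n * \<theta>))
     - (\<Sum>k\<in>{- int N..int N}. f (\<theta> + of_int k) * cis (- (2 * pi * t * (\<theta> + of_int k))))) \<longlonglongrightarrow> 0"
proof -
  obtain f1 f2 C where C: "C \<ge> 0"
    and d: "\<And>x. (f has_vector_derivative f1 x) (at x)" "\<And>x. (f1 has_vector_derivative f2 x) (at x)"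
    and cont: "continuous_on UNIV f" "continuous_on UNIV f1" "continuous_on UNIV f2"
    and b: "\<And>x. norm (f x) \<le> C / (1 + x\<^sup>2)" "\<And>x. norm (f1 x) \<le> C / (1 + x\<^sup>2)" "\<And>x. norm (f2 x) \<le> C / (1 + x\<^sup>2)"
    by (rule schwartz_decay[OF f], rule that, assumption+)
  have [measurable]: "f \<in> borel_measurable borel" using cont(1) by (rule borel_measurable_continuous_onI)
  define h where "h y = f (\<theta> + y) * cis (- (2 * pi * t * (\<theta> + y)))" for y
  have shift: "c / (1 + (\<theta> + y)\<^sup>2) \<le> 2 * c / (1 + y\<^sup>2)" if "c \<ge> 0" for c y
    using inverse_quadratic_shift[OF \<theta> that, of y] by (simp add: add.commute)
  have "(\<lambda>N. (\<Sum>n\<in>{- int N..int N}. LINT y|lborel. h y * cis (- (2 * pi * of_int n * y)))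
           - (\<Sum>k\<in>{- int N..int N}. h (of_int k))) \<longlonglongrightarrow> 0"
  proof (rule poisson_summation)
    show "h \<in> borel_measurable borel" unfolding h_def by measurable
    show "cmod (h y) \<le> (12 * C) / (1 + y\<^sup>2)" for y
    proof -
      have "cmod (h y) \<le> C / (1 + (\<theta> + y)\<^sup>2)" using b(1)[of "\<theta> + y"] by (simp add: h_def norm_mult)
      also have "\<dots> \<le> 2 * C / (1 + y\<^sup>2)" by (rule shift[OF C])
      also have "\<dots> \<le> (12 * C) / (1 + y\<^sup>2)" using C by (intro divide_right_mono) auto
      finally show ?thesis .
    qed
    show "cmod (h (y + s) - h y) \<le> (12 * C) * \<bar>s\<bar> / (1 + y\<^sup>2)" if s: "\<bar>s\<bar> \<le> 1/2" for y s
    proof -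
      define z where "z = \<theta> + y"
      define e where "e x = cis (- (2 * pi * t * x))" for x
      have "h (y + s) - h y = (f (z + s) - f z) * e (z + s) + f z * (e (z + s) - e z)"
        by (simp add: h_def z_def e_def algebra_simps)
      then have "cmod (h (y + s) - h y) \<le> cmod (f (z + s) - f z) + cmod (f z) * cmod (e (z + s) - e z)"
        using norm_triangle_ineq[of "(f (z + s) - f z) * e (z + s)" "f z * (e (z + s) - e z)"]
        by (simp add: norm_mult e_def)
      also have "\<dots> \<le> 2 * C / (1 + z\<^sup>2) * \<bar>s\<bar> + C / (1 + z\<^sup>2) * (4 * \<bar>s\<bar>)"
      proof (intro add_mono mult_mono b quadratic_decay_lipschitz[OF d(1) C b(2) s])
        have "cmod (e (z + s) - e z) \<le> 2 * pi * \<bar>t\<bar> * \<bar>s\<bar>"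
          using cis_lipschitz[of "- (2 * pi * t * (z + s))" "- (2 * pi * t * z)"]
          by (simp add: e_def algebra_simps abs_mult)
        also have "\<dots> \<le> 2 * 4 * (1/2) * \<bar>s\<bar>" using t pi_less_4 by (intro mult_mono) auto
        finally show "cmod (e (z + s) - e z) \<le> 4 * \<bar>s\<bar>" by simp
      qed (use C in auto)
      also have "\<dots> = (6 * C * \<bar>s\<bar>) / (1 + z\<^sup>2)" by (simp add: add_divide_distrib[symmetric])
      also have "\<dots> \<le> 2 * (6 * C * \<bar>s\<bar>) / (1 + y\<^sup>2)" unfolding z_def using C by (intro shift) auto
      finally show ?thesis by simp
    qed
  qed
  then show ?thesis unfolding h_def fourier_translate_modulate[OF \<open>f \<in> borel_measurable borel\<close>] .
qed

text \<open>Both sums are integrals over \<open>t \<in> J\<close>, with the weight \<open>t ^ j e(t l)\<close>, of the two sides of the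
  Poisson summation formula; dominated convergence applies since both sides are bounded
  uniformly in \<open>N\<close> and \<open>t\<close>.\<close>

lemma cell_poly_minus_kernel_sum_tendsto_0:
  assumes f: "schwartz f" and \<theta>: "\<bar>\<theta>\<bar> \<le> 1/2"
  shows "(\<lambda>N. cell_poly f j l N \<theta>
     - (\<Sum>k\<in>{- int N..int N}. f (\<theta> + of_int k) * moment_kernel j (of_int (l - k) - \<theta>))) \<longlonglongrightarrow> 0"
proof -
  obtain f1 f2 C where C: "C \<ge> 0"
    and "\<And>x. (f has_vector_derivative f1 x) (at x)" "\<And>x. (f1 has_vector_derivative f2 x) (at x)"
    and cont: "continuous_on UNIV f" "continuous_on UNIV f1" "continuous_on UNIV f2"
    and b: "\<And>x. norm (f x) \<le> C / (1 + x\<^sup>2)" "\<And>x. norm (f1 x) \<le> C / (1 + x\<^sup>2)" "\<And>x. norm (f2 x) \<le> C / (1 + x\<^sup>2)"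
    by (rule schwartz_decay[OF f], rule that, assumption+)
  have fm[measurable]: "f \<in> borel_measurable borel" using cont(1) by (rule borel_measurable_continuous_onI)
  note [measurable] = fourier_measurable[OF fm]
  obtain Cf where Cf: "Cf \<ge> 0" "\<And>\<xi>. cmod (fourier f \<xi>) \<le> Cf / (1 + \<xi>\<^sup>2)" using fourier_decay[OF f] by blast
  define w where "w t = of_real (t ^ j) * cis (2 * pi * t * of_int l)" for t
  have [measurable]: "w \<in> borel_measurable borel" unfolding w_def by measurable
  have bw: "cmod (w t) \<le> 1" if "t \<in> J" for t unfolding w_def by (rule cell_weight_bound[OF that])
  define P where "P N t = (\<Sum>n\<in>{- int N..int N}. fourier f (of_int n + t) * cis (2 * pi * of_int n * \<theta>))
     - (\<Sum>k\<in>{- int N..int N}. f (\<theta> + of_int k) * cis (- (2 * pi * t * (\<theta> + of_int k))))" for N t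
  have [measurable]: "P N \<in> borel_measurable borel" for N unfolding P_def by measurable
  have eq: "cell_poly f j l N \<theta> - (\<Sum>k\<in>{- int N..int N}. f (\<theta> + of_int k) * moment_kernel j (of_int (l - k) - \<theta>))
      = (LINT t|unit_cell. P N t * w t)" for N
  proof -
    have i1: "integrable unit_cell (\<lambda>t. fourier f (of_int n + t) * w t * cis (2 * pi * of_int n * \<theta>))" for n
    proof (rule unit_cell_integrable[where B = Cf])
      fix t assume t: "t \<in> J"
      have "cmod (fourier f (of_int n + t)) \<le> Cf"
      proof (rule order_trans[OF Cf(2)])
        have "Cf / (1 + (of_int n + t)\<^sup>2) \<le> Cf / 1" using Cf(1) by (intro divide_left_mono) (auto simp: add_pos_nonneg)
        then show "Cf / (1 + (of_int n + t)\<^sup>2) \<le> Cf" by simp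
      qed
      then show "cmod (fourier f (of_int n + t) * w t * cis (2 * pi * of_int n * \<theta>)) \<le> Cf"
        using mult_mono[OF _ bw[OF t], of "cmod (fourier f (of_int n + t))" Cf] Cf(1) by (simp add: norm_mult)
    qed measurable
    have i2: "integrable unit_cell (\<lambda>t. f (\<theta> + of_int k) * (cis (- (2 * pi * t * (\<theta> + of_int k))) * w t))" for k
      by (rule unit_cell_integrable[where B = "cmod (f (\<theta> + of_int k))"])
        (use bw in \<open>auto simp: norm_mult mult_left_le\<close>)
    have k: "moment_kernel j (of_int (l - k) - \<theta>) = (LINT t|unit_cell. cis (- (2 * pi * t * (\<theta> + of_int k))) * w t)" for k
      unfolding moment_kernel_def w_def
      by (rule Bochner_Integration.integral_cong) (simp_all add: cis_mult algebra_simps)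
    have "P N t * w t = (\<Sum>n\<in>{- int N..int N}. fourier f (of_int n + t) * w t * cis (2 * pi * of_int n * \<theta>))
      - (\<Sum>k\<in>{- int N..int N}. f (\<theta> + of_int k) * (cis (- (2 * pi * t * (\<theta> + of_int k))) * w t))" for t
      unfolding P_def left_diff_distrib sum_distrib_right by (simp only: mult_ac)
    then have "(LINT t|unit_cell. P N t * w t) = (\<Sum>n\<in>{- int N..int N}. LINT t|unit_cell. fourier f (of_int n + t) * w t * cis (2 * pi * of_int n * \<theta>))
      - (\<Sum>k\<in>{- int N..int N}. LINT t|unit_cell. f (\<theta> + of_int k) * (cis (- (2 * pi * t * (\<theta> + of_int k))) * w t))"
      using i1 i2 by (simp only: Bochner_Integration.integral_diff Bochner_Integration.integrable_sum Bochner_Integration.integral_sum)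
    then show ?thesis
      by (simp only: integral_mult_left_zero integral_mult_right_zero trig_sum_def cell_moment_def w_def[symmetric] k)
  qed
  have bP: "cmod (P N t) \<le> 8 * Cf + 8 * C" if t: "t \<in> J" for N t
  proof -
    have "cmod (\<Sum>n\<in>{- int N..int N}. fourier f (of_int n + t) * cis (2 * pi * of_int n * \<theta>))
        \<le> (\<Sum>n\<in>{- int N..int N}. 2 * Cf * (1 / (1 + (real_of_int (n - 0))\<^sup>2)))"
    proof (rule sum_norm_le)
      fix n
      show "cmod (fourier f (of_int n + t) * cis (2 * pi * of_int n * \<theta>)) \<le> 2 * Cf * (1 / (1 + (real_of_int (n - 0))\<^sup>2))"
        using order_trans[OF Cf(2) inverse_quadratic_shift[OF J_bound[OF t] Cf(1)], of "of_int n"] by (simp add: norm_mult)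
    qed
    also have "\<dots> \<le> 2 * Cf * 4" unfolding sum_distrib_left[symmetric]
      using Cf(1) by (intro mult_left_mono inverse_quadratic_sum_le) auto
    finally have 1: "cmod (\<Sum>n\<in>{- int N..int N}. fourier f (of_int n + t) * cis (2 * pi * of_int n * \<theta>)) \<le> 8 * Cf" by simp
    have "cmod (\<Sum>k\<in>{- int N..int N}. f (\<theta> + of_int k) * cis (- (2 * pi * t * (\<theta> + of_int k))))
        \<le> (\<Sum>n\<in>{- int N..int N}. 2 * C * (1 / (1 + (real_of_int (n - 0))\<^sup>2)))"
    proof (rule sum_norm_le)
      fix k
      show "cmod (f (\<theta> + of_int k) * cis (- (2 * pi * t * (\<theta> + of_int k)))) \<le> 2 * C * (1 / (1 + (real_of_int (k - 0))\<^sup>2))"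
        using order_trans[OF b(1)[of "of_int k + \<theta>"] inverse_quadratic_shift[OF \<theta> C]] by (simp add: norm_mult add.commute)
    qed
    also have "\<dots> \<le> 2 * C * 4" unfolding sum_distrib_left[symmetric]
      using C by (intro mult_left_mono inverse_quadratic_sum_le) auto
    finally have "cmod (\<Sum>k\<in>{- int N..int N}. f (\<theta> + of_int k) * cis (- (2 * pi * t * (\<theta> + of_int k)))) \<le> 8 * C" by simp
    with 1 show ?thesis unfolding P_def by (intro order_trans[OF norm_triangle_ineq4] add_mono)
  qed
  have "(\<lambda>N. LINT t|unit_cell. P N t * w t) \<longlonglongrightarrow> (LINT t|unit_cell. 0)"
  proof (rule integral_dominated_convergence[where w = "\<lambda>_. 8 * Cf + 8 * C"])
    show "AE t in unit_cell. (\<lambda>N. P N t * w t) \<longlonglongrightarrow> 0"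
    proof (rule AE_I2)
      fix t assume "t \<in> space unit_cell"
      then have t: "\<bar>t\<bar> \<le> 1/2" using J_bound by simp
      show "(\<lambda>N. P N t * w t) \<longlonglongrightarrow> 0"
        unfolding P_def by (rule tendsto_mult_left_zero) (rule poisson_modulated[OF f \<theta> t])
    qed
    show "AE t in unit_cell. cmod (P N t * w t) \<le> 8 * Cf + 8 * C" for N
    proof (rule AE_I2)
      fix t assume "t \<in> space unit_cell"
      then have t: "t \<in> J" by simp
      show "cmod (P N t * w t) \<le> 8 * Cf + 8 * C"
        using mult_mono[OF bP[OF t, of N] bw[OF t]] C Cf(1) by (simp add: norm_mult)
    qed
  qed auto
  then show ?thesis unfolding eq by simp
qed

lemma cell_poly_tail:
  assumes "f \<in> borel_measurable borel" "C \<ge> 0" "\<And>\<xi>. cmod (fourier f \<xi>) \<le> C / (1 + \<xi>\<^sup>2)" "N \<le> M"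
  shows "cmod (cell_poly f j l M \<theta> - cell_poly f j l N \<theta>) \<le> 3 * (2 * C) / (real N + 1)"
  unfolding trig_sum_def
proof (rule symmetric_tail_le)
  show "cmod (cell_moment f j l n * cis (2 * pi * of_int n * \<theta>)) \<le> 2 * C / (1 + (of_int n)\<^sup>2)" for n
    using cell_moment_bound[OF assms(1-3), of j l n] by (simp add: norm_mult)
qed (rule assms)

lemma mem_cell_iff: "\<xi> - of_int n \<in> J \<longleftrightarrow> \<lfloor>\<xi> + 1/2\<rfloor> = n"
  unfolding J_def by (auto; linarith)

lemma sum_unit_cell_translates_nn_integral:
  fixes g :: "real \<Rightarrow> ennreal"
  assumes [measurable]: "g \<in> borel_measurable borel"
  shows "(\<Sum>k\<in>{- int M..int M}. \<integral>\<^sup>+\<theta>. g (of_int k + \<theta>) \<partial>unit_cell) = (\<integral>\<^sup>+x. g x * indicator {x. \<lfloor>x + 1/2\<rfloor> \<in> {- int M..int M}} x \<partial>lborel)"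
proof -
  have 1: "(\<integral>\<^sup>+\<theta>. g (of_int k + \<theta>) \<partial>unit_cell) = (\<integral>\<^sup>+x. g x * indicator J (x - of_int k) \<partial>lborel)" for k :: int
    by (subst nn_integral_real_affine[of "\<lambda>x. g x * indicator J (x - of_int k)" 1 "of_int k"])
      (auto simp: nn_integral_restrict_space)
  have 2: "(\<Sum>k\<in>{- int M..int M}. g x * indicator J (x - of_int k)) = g x * indicator {x. \<lfloor>x + 1/2\<rfloor> \<in> {- int M..int M}} x" for x
  proof -
    have "(\<Sum>k\<in>{- int M..int M}. g x * indicator J (x - of_int k)) = (\<Sum>k\<in>{- int M..int M}. if k = \<lfloor>x + 1/2\<rfloor> then g x else 0)"
      by (rule sum.cong) (auto simp: indicator_def mem_cell_iff)
    then show ?thesis by (simp add: indicator_def)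
  qed
  show ?thesis unfolding 1 2[symmetric] by (rule nn_integral_sum[symmetric]) measurable
qed

lemma SUP_sum_unit_cell_translates:
  fixes g :: "real \<Rightarrow> ennreal"
  assumes [measurable]: "g \<in> borel_measurable borel"
  shows "(SUP M. \<Sum>k\<in>{- int M..int M}. \<integral>\<^sup>+\<theta>. g (of_int k + \<theta>) \<partial>unit_cell) = (\<integral>\<^sup>+x. g x \<partial>lborel)"
proof -
  define U where "U M = {x::real. \<lfloor>x + 1/2\<rfloor> \<in> {- int M..int M}}" for M
  have "U M = {- 1/2 - real M..<real M + 1/2}" for M
    unfolding U_def by (auto; linarith)
  then have [measurable]: "U M \<in> sets borel" for M by simp
  have inc: "incseq (\<lambda>M x. g x * indicator (U M) x)"
    by (auto simp: incseq_def le_fun_def U_def indicator_def)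
  have "(\<integral>\<^sup>+x. (SUP M. g x * indicator (U M) x) \<partial>lborel) = (SUP M. \<integral>\<^sup>+x. g x * indicator (U M) x \<partial>lborel)"
    by (rule nn_integral_monotone_convergence_SUP[OF inc]) measurable
  moreover have "(SUP M. g x * indicator (U M) x) = g x" for x
  proof (rule antisym)
    have "x \<in> U (nat \<bar>\<lfloor>x + 1/2\<rfloor>\<bar>)" by (auto simp: U_def)
    then show "g x \<le> (SUP M. g x * indicator (U M) x)"
      by (intro SUP_upper2[of "nat \<bar>\<lfloor>x + 1/2\<rfloor>\<bar>"]) auto
  qed (auto intro!: SUP_least simp: indicator_def)
  ultimately show ?thesis
    unfolding sum_unit_cell_translates_nn_integral[OF assms] U_def by simp
qed

text \<open>For fixed \<open>\<theta>\<close> the sequence of values indexed by \<open>l\<close> is, up to a truncation error, a convolution of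
  \<open>k \<mapsto> f(\<theta> + k)\<close> with a kernel of Hilbert type.  The constant \<open>A\<close> is the same for all \<open>f\<close>, \<open>\<theta>\<close>, \<open>j\<close>, \<open>N\<close>
  and \<open>L\<close>; only the error term depends on the size of \<open>L\<close>, and it vanishes as \<open>N\<close> grows.\<close>

lemma cell_poly_power_sum_pointwise:
  assumes p: "p > 1"
  shows "\<exists>A\<ge>0. \<forall>f C. \<forall>\<theta>\<in>J. \<forall>j N. \<forall>L :: int set. schwartz f \<longrightarrow> C \<ge> 0 \<longrightarrow> (\<forall>\<xi>. cmod (fourier f \<xi>) \<le> C / (1 + \<xi>\<^sup>2)) \<longrightarrow> finite L \<longrightarrow>
    ennreal (\<Sum>l\<in>L. cmod (cell_poly f j l N \<theta>) powr p)
      \<le> ennreal A * (SUP M. \<Sum>k\<in>{- int M..int M}. ennreal (cmod (f (of_int k + \<theta>)) powr p))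
        + ennreal (real (card L) * (4 powr p * (6 * C / (real N + 1)) powr p))"
proof -
  obtain A where A: "A \<ge> 0" and bd: "\<And>\<kappa> c K N (a :: int \<Rightarrow> complex). finite K \<Longrightarrow> finite N \<Longrightarrow> cmod c \<le> 14 \<Longrightarrow>
    (\<And>n::int. cmod (\<kappa> n - c * parity_sign n / of_int n) \<le> 14 / (1 + (of_int n)\<^sup>2)) \<Longrightarrow>
    (\<Sum>n\<in>N. cmod (\<Sum>k\<in>K. a k * \<kappa> (n - k)) powr p) \<le> A * (\<Sum>k\<in>K. cmod (a k) powr p)"
    using hilbert_type_kernel_bounded[OF p, of 14] by auto
  show ?thesis
  proof (intro exI[of _ "4 powr p * A"] conjI allI impI ballI)
    show "0 \<le> 4 powr p * A" using A by simp
    fix f C \<theta> j N and L :: "int set"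
    assume \<theta>: "\<theta> \<in> J" and f: "schwartz f" and C: "0 \<le> C" and Cf: "\<forall>\<xi>. cmod (fourier f \<xi>) \<le> C / (1 + \<xi>\<^sup>2)" and L: "finite L"
    have fm: "f \<in> borel_measurable borel"
      by (rule schwartz_decay[OF f]) (rule borel_measurable_continuous_onI)
    define K where "K M l = (\<Sum>k\<in>{- int M..int M}. f (\<theta> + of_int k) * moment_kernel j (of_int (l - k) - \<theta>))" for M l
    define \<epsilon> where "\<epsilon> = 6 * C / (real N + 1)"
    define \<delta> where "\<delta> M l = cmod (cell_poly f j l M \<theta> - K M l)" for M l
    define B where "B = (SUP M. \<Sum>k\<in>{- int M..int M}. ennreal (cmod (f (of_int k + \<theta>)) powr p))"
    have \<epsilon>: "\<epsilon> \<ge> 0" using C by (simp add: \<epsilon>_def)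
    have \<delta>0: "\<delta> M l \<ge> 0" for M l by (simp add: \<delta>_def)
    have \<delta>lim: "(\<lambda>M. \<delta> M l) \<longlonglongrightarrow> 0" for l
      unfolding \<delta>_def K_def using cell_poly_minus_kernel_sum_tendsto_0[OF f J_bound[OF \<theta>], of j l]
      by (rule tendsto_norm_zero)
    obtain c where c: "cmod c \<le> 14" "\<And>n::int. cmod (moment_kernel j (of_int n - \<theta>) - c * parity_sign n / of_int n) \<le> 14 / (1 + (of_int n)\<^sup>2)"
      using moment_kernel_estimate[OF \<theta>, of j] by blast
    have Kb: "(\<Sum>l\<in>L. cmod (K M l) powr p) \<le> A * (\<Sum>k\<in>{- int M..int M}. cmod (f (of_int k + \<theta>)) powr p)" for M
      unfolding K_def using bd[OF _ L c, of "{- int M..int M}" "\<lambda>k. f (\<theta> + of_int k)"] by (simp add: add.commute)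
    \<comment> \<open>The trigonometric sums of order \<open>N\<close> and \<open>M\<close> differ by at most \<open>\<epsilon>\<close>, which depends on \<open>N\<close>; the sum of
      order \<open>M\<close> and the kernel sum differ by \<open>\<delta>\<close>, which tends to 0 as \<open>M\<close> grows.\<close>
    have split: "(\<Sum>l\<in>L. cmod (cell_poly f j l N \<theta>) powr p)
        \<le> 4 powr p * A * (\<Sum>k\<in>{- int M..int M}. cmod (f (of_int k + \<theta>)) powr p)
          + (4 powr p * (\<Sum>l\<in>L. \<delta> M l powr p) + real (card L) * (4 powr p * \<epsilon> powr p))" if M: "N \<le> M" for M
    proof -
      have pt: "cmod (cell_poly f j l N \<theta>) powr p \<le> 4 powr p * (cmod (K M l) powr p + (\<delta> M l powr p + \<epsilon> powr p))" for l
      proof -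
        have "cmod (cell_poly f j l N \<theta>) \<le> cmod (K M l) + (\<delta> M l + \<epsilon>)"
        proof -
          have "cell_poly f j l N \<theta> = K M l + (cell_poly f j l M \<theta> - K M l) - (cell_poly f j l M \<theta> - cell_poly f j l N \<theta>)" by simp
          then have "cmod (cell_poly f j l N \<theta>) \<le> cmod (K M l) + cmod (cell_poly f j l M \<theta> - K M l) + cmod (cell_poly f j l M \<theta> - cell_poly f j l N \<theta>)"
            by (metis norm_triangle_ineq norm_triangle_ineq4 add_right_mono order_trans)
          moreover have "cmod (cell_poly f j l M \<theta> - cell_poly f j l N \<theta>) \<le> \<epsilon>"
            using cell_poly_tail[OF fm C, of N M j l \<theta>] Cf M by (simp add: \<epsilon>_def)
          ultimately show ?thesis by (simp add: \<delta>_def)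
        qed
        then have "cmod (cell_poly f j l N \<theta>) powr p \<le> (cmod (K M l) + (\<delta> M l + \<epsilon>)) powr p"
          using p by (intro powr_mono2) auto
        also have "\<dots> \<le> 2 powr p * (cmod (K M l) powr p + (\<delta> M l + \<epsilon>) powr p)"
          using p \<delta>0 \<epsilon> by (intro powr_add_le) auto
        also have "\<dots> \<le> 2 powr p * (2 powr p * cmod (K M l) powr p + 2 powr p * (\<delta> M l powr p + \<epsilon> powr p))"
          using p \<delta>0 \<epsilon> by (intro mult_left_mono add_mono powr_add_le) (auto simp: mult_le_cancel_right1 ge_one_powr_ge_zero)
        also have "\<dots> = 4 powr p * (cmod (K M l) powr p + (\<delta> M l powr p + \<epsilon> powr p))"
        proof -
          have "(4::real) powr p = 2 powr p * 2 powr p" by (simp add: powr_mult[symmetric])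
          then show ?thesis by (simp add: algebra_simps)
        qed
        finally show ?thesis .
      qed
      have "(\<Sum>l\<in>L. cmod (cell_poly f j l N \<theta>) powr p) \<le> (\<Sum>l\<in>L. 4 powr p * (cmod (K M l) powr p + (\<delta> M l powr p + \<epsilon> powr p)))"
        by (intro sum_mono pt)
      also have "\<dots> = 4 powr p * (\<Sum>l\<in>L. cmod (K M l) powr p) + (4 powr p * (\<Sum>l\<in>L. \<delta> M l powr p) + real (card L) * (4 powr p * \<epsilon> powr p))"
        by (simp add: sum.distrib sum_distrib_left[symmetric] distrib_left)
      also have "4 powr p * (\<Sum>l\<in>L. cmod (K M l) powr p) \<le> 4 powr p * (A * (\<Sum>k\<in>{- int M..int M}. cmod (f (of_int k + \<theta>)) powr p))"
        using Kb by (intro mult_left_mono) auto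
      finally show ?thesis by (simp add: mult.assoc)
    qed
    have "ennreal (\<Sum>l\<in>L. cmod (cell_poly f j l N \<theta>) powr p) \<le> ennreal (4 powr p * A) * B + ennreal (real (card L) * (4 powr p * \<epsilon> powr p))"
    proof (rule ennreal_le_epsilon)
      fix e :: real assume e: "e > 0"
      have "(\<lambda>M. 4 powr p * (\<Sum>l\<in>L. \<delta> M l powr p)) \<longlonglongrightarrow> 4 powr p * (\<Sum>l\<in>L. 0)"
      proof (intro tendsto_intros)
        fix l
        have "(\<lambda>M. \<delta> M l powr p) \<longlonglongrightarrow> 0 powr p"
          using \<delta>lim[of l] \<delta>0 p by (intro tendsto_powr2) (auto simp: eventually_sequentially)
        then show "(\<lambda>M. \<delta> M l powr p) \<longlonglongrightarrow> 0" by simp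
      qed
      then have "\<forall>\<^sub>F M in sequentially. 4 powr p * (\<Sum>l\<in>L. \<delta> M l powr p) < e"
        using e by (intro order_tendstoD(2)) auto
      then have "\<forall>\<^sub>F M in sequentially. 4 powr p * (\<Sum>l\<in>L. \<delta> M l powr p) < e \<and> N \<le> M"
        using eventually_ge_at_top[of N] by eventually_elim simp
      then obtain M where M: "4 powr p * (\<Sum>l\<in>L. \<delta> M l powr p) < e" "N \<le> M"
        using eventually_happens[of _ sequentially] by auto
      define b where "b = (\<Sum>k\<in>{- int M..int M}. cmod (f (of_int k + \<theta>)) powr p)"
      have b: "0 \<le> b" unfolding b_def by (intro sum_nonneg) auto
      have "ennreal (\<Sum>l\<in>L. cmod (cell_poly f j l N \<theta>) powr p) \<le> ennreal (4 powr p * A * b + (e + real (card L) * (4 powr p * \<epsilon> powr p)))"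
        using split[OF M(2)] M(1) unfolding b_def[symmetric] by (intro ennreal_leI) linarith
      also have "\<dots> = ennreal (4 powr p * A) * ennreal b + (ennreal e + ennreal (real (card L) * (4 powr p * \<epsilon> powr p)))"
        using A b e by (simp add: ennreal_plus ennreal_mult)
      also have "ennreal b \<le> B"
        unfolding b_def B_def by (intro SUP_upper2[of M]) (auto simp: sum_ennreal)
      finally show "ennreal (\<Sum>l\<in>L. cmod (cell_poly f j l N \<theta>) powr p) \<le> ennreal (4 powr p * A) * B + ennreal (real (card L) * (4 powr p * \<epsilon> powr p)) + ennreal e"
        by (simp add: add_ac mult_left_mono add_left_mono)
    qed
    then show "ennreal (\<Sum>l\<in>L. cmod (cell_poly f j l N \<theta>) powr p)
      \<le> ennreal (4 powr p * A) * (SUP M. \<Sum>k\<in>{- int M..int M}. ennreal (cmod (f (of_int k + \<theta>)) powr p))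
        + ennreal (real (card L) * (4 powr p * (6 * C / (real N + 1)) powr p))"
      unfolding B_def \<epsilon>_def .
  qed
qed

lemma schwartz_power_integrable:
  assumes f: "schwartz f" and p: "p \<ge> 1"
  shows "integrable lborel (\<lambda>x. cmod (f x) powr p)"
proof -
  obtain f1 f2 C where C: "C \<ge> 0" and "continuous_on UNIV f"
    and b: "\<And>x. norm (f x) \<le> C / (1 + x\<^sup>2)"
    by (rule schwartz_decay[OF f], rule that)
  then have [measurable]: "f \<in> borel_measurable borel" by (intro borel_measurable_continuous_onI)
  show ?thesis
  proof (rule integrable_of_quadratic_decay[where C = "C powr p"])
    fix x :: real
    have 1: "1 + x\<^sup>2 \<ge> 1" by simp
    have "cmod (f x) powr p \<le> (C / (1 + x\<^sup>2)) powr p" using b p by (intro powr_mono2) auto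
    also have "\<dots> = C powr p / (1 + x\<^sup>2) powr p" using C by (simp add: powr_divide)
    also have "\<dots> \<le> C powr p / (1 + x\<^sup>2) powr 1"
      using 1 p by (intro divide_left_mono powr_mono) (auto intro!: mult_pos_pos simp: add_pos_nonneg add_nonneg_eq_0_iff)
    finally show "norm (cmod (f x) powr p) \<le> C powr p / (1 + x\<^sup>2)" using 1 by simp
  qed measurable
qed

text \<open>The pointwise bound integrated over the cell: the translates of the cell tile the line, so the
  periodization of \<open>|f|^p\<close> has the integral of \<open>|f|^p\<close>.\<close>

lemma cell_poly_power_sum:
  assumes p: "p > 1"
  shows "\<exists>A\<ge>0. \<forall>f. schwartz f \<longrightarrow> (\<exists>E. (\<forall>N. 0 \<le> E N) \<and> E \<longlonglongrightarrow> 0 \<and> (\<forall>j N. \<forall>L :: int set. finite L \<longrightarrow>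
     (\<Sum>l\<in>L. LINT \<theta>|unit_cell. cmod (cell_poly f j l N \<theta>) powr p)
       \<le> A * (LINT x|lborel. cmod (f x) powr p) + real (card L) * E N))"
proof -
  obtain A where A: "A \<ge> 0" and bd: "\<And>f C \<theta> j N (L :: int set). schwartz f \<Longrightarrow> C \<ge> 0 \<Longrightarrow> (\<forall>\<xi>. cmod (fourier f \<xi>) \<le> C / (1 + \<xi>\<^sup>2)) \<Longrightarrow> finite L \<Longrightarrow> \<theta> \<in> J \<Longrightarrow>
    ennreal (\<Sum>l\<in>L. cmod (cell_poly f j l N \<theta>) powr p)
      \<le> ennreal A * (SUP M. \<Sum>k\<in>{- int M..int M}. ennreal (cmod (f (of_int k + \<theta>)) powr p))
        + ennreal (real (card L) * (4 powr p * (6 * C / (real N + 1)) powr p))"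
    using cell_poly_power_sum_pointwise[OF p] by blast
  show ?thesis
  proof (intro exI[of _ A] conjI allI impI A)
    fix f assume f: "schwartz f"
    obtain C where C: "C \<ge> 0" "\<forall>\<xi>. cmod (fourier f \<xi>) \<le> C / (1 + \<xi>\<^sup>2)" using fourier_decay[OF f] by blast
    have [measurable]: "f \<in> borel_measurable borel"
      by (rule schwartz_decay[OF f]) (rule borel_measurable_continuous_onI)
    define E where "E N = 4 powr p * (6 * C / (real N + 1)) powr p" for N
    have lim: "E \<longlonglongrightarrow> 0"
    proof -
      have "(\<lambda>N. 6 * C / (real N + 1)) \<longlonglongrightarrow> 0"
        using tendsto_mult_right_zero[OF LIMSEQ_inverse_real_of_nat, of "6 * C"] by (simp add: divide_inverse add.commute)
      then have "(\<lambda>N. (6 * C / (real N + 1)) powr p) \<longlonglongrightarrow> 0 powr p"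
        using C p by (intro tendsto_powr2) (auto simp: eventually_sequentially)
      then show ?thesis unfolding E_def using tendsto_mult_right_zero by fastforce
    qed
    have int: "(\<Sum>l\<in>L. LINT \<theta>|unit_cell. cmod (cell_poly f j l N \<theta>) powr p)
       \<le> A * (LINT x|lborel. cmod (f x) powr p) + real (card L) * E N" if L: "finite L" for j N and L :: "int set"
    proof -
      let ?s = "\<lambda>M \<theta>. \<Sum>k\<in>{- int M..int M}. ennreal (cmod (f (of_int k + \<theta>)) powr p)"
      have [measurable]: "?s M \<in> borel_measurable borel" for M by measurable
      have ic: "integrable unit_cell (\<lambda>\<theta>. cmod (cell_poly f j l N \<theta>) powr p)" for l
        using p by (intro trig_sum_power_integrable) auto
      have inc: "incseq ?s" by (auto simp: incseq_def le_fun_def intro!: ennreal_leI sum_mono2)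
      have "ennreal (\<Sum>l\<in>L. LINT \<theta>|unit_cell. cmod (cell_poly f j l N \<theta>) powr p)
         = (\<integral>\<^sup>+\<theta>. ennreal (\<Sum>l\<in>L. cmod (cell_poly f j l N \<theta>) powr p) \<partial>unit_cell)"
        using ic by (subst nn_integral_eq_integral) (auto intro!: AE_I2 sum_nonneg simp: Bochner_Integration.integral_sum)
      also have "\<dots> \<le> (\<integral>\<^sup>+\<theta>. ennreal A * (SUP M. ?s M \<theta>) + ennreal (real (card L) * E N) \<partial>unit_cell)"
        unfolding E_def by (rule nn_integral_mono) (rule bd[OF f C L], simp)
      also have "\<dots> = ennreal A * (\<integral>\<^sup>+\<theta>. (SUP M. ?s M \<theta>) \<partial>unit_cell) + ennreal (real (card L) * E N)"
        by (subst nn_integral_add) (auto simp: nn_integral_cmult intro!: unit_cell_measurable)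
      also have "(\<integral>\<^sup>+\<theta>. (SUP M. ?s M \<theta>) \<partial>unit_cell) = (SUP M. \<integral>\<^sup>+\<theta>. ?s M \<theta> \<partial>unit_cell)"
        by (rule nn_integral_monotone_convergence_SUP[OF inc]) (auto intro!: unit_cell_measurable)
      also have "\<dots> = (SUP M. \<Sum>k\<in>{- int M..int M}. \<integral>\<^sup>+\<theta>. ennreal (cmod (f (of_int k + \<theta>)) powr p) \<partial>unit_cell)"
        by (subst nn_integral_sum) (auto intro!: unit_cell_measurable)
      also have "\<dots> = (\<integral>\<^sup>+x. ennreal (cmod (f x) powr p) \<partial>lborel)"
        by (rule SUP_sum_unit_cell_translates) measurable
      also have "\<dots> = ennreal (LINT x|lborel. cmod (f x) powr p)"
        using p by (intro nn_integral_eq_integral schwartz_power_integrable f) auto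
      finally have "ennreal (\<Sum>l\<in>L. LINT \<theta>|unit_cell. cmod (cell_poly f j l N \<theta>) powr p)
        \<le> ennreal (A * (LINT x|lborel. cmod (f x) powr p) + real (card L) * E N)"
        using A by (simp add: ennreal_plus ennreal_mult E_def)
      then show ?thesis
        by (subst (asm) ennreal_le_iff) (use A in \<open>auto simp: E_def\<close>)
    qed
    show "\<exists>E. (\<forall>N. 0 \<le> E N) \<and> E \<longlonglongrightarrow> 0 \<and> (\<forall>j N. \<forall>L :: int set. finite L \<longrightarrow>
     (\<Sum>l\<in>L. LINT \<theta>|unit_cell. cmod (cell_poly f j l N \<theta>) powr p)
       \<le> A * (LINT x|lborel. cmod (f x) powr p) + real (card L) * E N)"
      using int lim by (intro exI[of _ E]) (auto simp: E_def)
  qed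
qed

section \<open>Multipliers on the torus\<close>

lemma torus_nn_integral: "(\<integral>\<^sup>+\<theta>. g \<theta> \<partial>torus) = (\<integral>\<^sup>+\<theta>. g \<theta> \<partial>unit_cell)"
  by (simp add: nn_integral_restrict_space nn_integral_completion)

lemma torus_integral:
  fixes f :: "real \<Rightarrow> 'a::{banach, second_countable_topology}"
  assumes [measurable]: "f \<in> borel_measurable borel"
  shows "(LINT \<theta>|torus. f \<theta>) = (LINT \<theta>|unit_cell. f \<theta>)"
proof -
  have "(LINT \<theta>|torus. f \<theta>) = (LINT \<theta>|lebesgue. indicator J \<theta> *\<^sub>R f \<theta>)"
    by (rule integral_restrict_space) simp
  also have "\<dots> = (LINT \<theta>|lborel. indicator J \<theta> *\<^sub>R f \<theta>)"
    by (rule integral_completion) measurable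
  finally show ?thesis unfolding unit_cell_integral .
qed

lemma lp_norm_eq:
  assumes "(\<integral>\<^sup>+x. ennreal (norm (f x) powr p) \<partial>M) = ennreal I" "0 \<le> I"
  shows "lp_norm p M f = ennreal (I powr (1 / p))"
  using assms by (simp add: lp_norm_def)

lemma nn_integral_le_of_lp_norm_le:
  assumes "lp_norm p M f \<le> ennreal c" "0 \<le> c" "p > 0"
  shows "(\<integral>\<^sup>+x. ennreal (norm (f x) powr p) \<partial>M) \<le> ennreal (c powr p)"
proof -
  let ?I = "\<integral>\<^sup>+x. ennreal (norm (f x) powr p) \<partial>M"
  have fin: "?I \<noteq> \<infinity>" using assms(1) by (auto simp: lp_norm_def Let_def top_unique split: if_splits)
  then have "lp_norm p M f = ennreal (enn2real ?I powr (1 / p))" by (simp add: lp_norm_def)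
  then have "enn2real ?I powr (1 / p) \<le> c" using assms by (simp add: ennreal_le_iff)
  then have "(enn2real ?I powr (1 / p)) powr p \<le> c powr p" using assms by (intro powr_mono2) auto
  then have "enn2real ?I \<le> c powr p" using assms by (simp add: powr_powr)
  then have "ennreal (enn2real ?I) \<le> ennreal (c powr p)" by (rule ennreal_leI)
  moreover have "ennreal (enn2real ?I) = ?I" using fin by (intro ennreal_enn2real) (simp add: less_top)
  ultimately show ?thesis by (simp only:)
qed

lemma lp_norm_le_of_nn_integral_le:
  assumes "(\<integral>\<^sup>+x. ennreal (norm (f x) powr p) \<partial>M) \<le> ennreal c" "0 \<le> c" "p > 0"
  shows "lp_norm p M f \<le> ennreal (c powr (1 / p))"
proof -
  let ?I = "\<integral>\<^sup>+x. ennreal (norm (f x) powr p) \<partial>M"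
  have fin: "?I \<noteq> \<infinity>" using assms(1) by (auto simp: top_unique)
  then have "lp_norm p M f = ennreal (enn2real ?I powr (1 / p))" by (simp add: lp_norm_def)
  moreover have "enn2real ?I \<le> c" using assms(1,2) by (simp add: enn2real_leI)
  ultimately show ?thesis using assms by (auto intro!: ennreal_leI powr_mono2)
qed

definition bilinear_trig_sum ::
    "(int \<times> int \<Rightarrow> complex) \<Rightarrow> (int \<Rightarrow> complex) \<Rightarrow> (int \<Rightarrow> complex) \<Rightarrow> nat \<Rightarrow> real \<Rightarrow> complex" where
  "bilinear_trig_sum \<phi> a b N \<theta> = (\<Sum>n\<in>{- int N..int N}. \<Sum>m\<in>{- int N..int N}.
     a n * b m * \<phi> (n, m) * cis (2 * pi * \<theta> * of_int (n + m)))"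

lemma trig_polynomial_trig_sum: "trig_polynomial (trig_sum a N)"
  unfolding trig_polynomial_def trig_sum_def
  by (intro exI[of _ "{- int N..int N}"] exI[of _ a]) auto

lemma fourier_coeff_trig_sum:
  "fourier_coeff (trig_sum a N) n = (if n \<in> {- int N..int N} then a n else 0)"
proof -
  have "fourier_coeff (trig_sum a N) n = (LINT \<theta>|unit_cell. trig_sum a N \<theta> * cis (- (2 * pi * of_int n * \<theta>)))"
    unfolding fourier_coeff_def by (rule torus_integral) measurable
  also have "\<dots> = (LINT \<theta>|unit_cell. (\<Sum>m\<in>{- int N..int N}. a m * cis (2 * pi * of_int (m - n) * \<theta>)))"
  proof (rule Bochner_Integration.integral_cong)
    fix \<theta>
    show "trig_sum a N \<theta> * cis (- (2 * pi * of_int n * \<theta>)) = (\<Sum>m\<in>{- int N..int N}. a m * cis (2 * pi * of_int (m - n) * \<theta>))"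
      unfolding trig_sum_def sum_distrib_right
      by (rule sum.cong) (simp_all add: mult.assoc cis_mult algebra_simps)
  qed simp
  also have "\<dots> = (\<Sum>m\<in>{- int N..int N}. LINT \<theta>|unit_cell. a m * cis (2 * pi * of_int (m - n) * \<theta>))"
    by (rule Bochner_Integration.integral_sum)
      (rule unit_cell_integrable[where B = "cmod (a _)"], auto simp: norm_mult)
  also have "\<dots> = (\<Sum>m\<in>{- int N..int N}. if m = n then a m else 0)"
    by (rule sum.cong) (simp_all only: integral_mult_right_zero unit_cell_character, simp)
  finally show ?thesis by simp
qed

lemma bilinear_op_T_trig_sum:
  "bilinear_op_T \<phi> (trig_sum a N) (trig_sum b N) = bilinear_trig_sum \<phi> a b N"
proof
  fix \<theta>
  define I where "I = {- int N..int N}"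
  have "bilinear_op_T \<phi> (trig_sum a N) (trig_sum b N) \<theta>
     = (\<Sum>\<^sub>\<infinity>(n, m)\<in>I \<times> I. a n * b m * \<phi> (n, m) * cis (2 * pi * \<theta> * of_int (n + m)))"
    unfolding bilinear_op_T_def fourier_coeff_trig_sum I_def
    by (rule infsum_cong_neutral) (auto split: if_splits)
  also have "\<dots> = (\<Sum>(n, m)\<in>I \<times> I. a n * b m * \<phi> (n, m) * cis (2 * pi * \<theta> * of_int (n + m)))"
    by (rule infsum_finite) (simp add: I_def)
  also have "\<dots> = bilinear_trig_sum \<phi> a b N \<theta>"
    by (simp add: bilinear_trig_sum_def I_def sum.cartesian_product)
  finally show "bilinear_op_T \<phi> (trig_sum a N) (trig_sum b N) \<theta> = bilinear_trig_sum \<phi> a b N \<theta>" .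
qed

lemma lp_norm_torus_trig_sum:
  assumes "p > 0"
  shows "lp_norm p torus (trig_sum a N) = ennreal ((LINT \<theta>|unit_cell. cmod (trig_sum a N \<theta>) powr p) powr (1 / p))"
  using assms by (intro lp_norm_eq) (auto simp: torus_nn_integral nn_integral_eq_integral trig_sum_power_integrable)

text \<open>The multiplier hypothesis for trigonometric sums given by their coefficients, raised to the
  power \<open>p3\<close> so that it can be summed.\<close>

lemma multipliers_T_bound:
  assumes \<phi>: "\<phi> \<in> multipliers_T p1 p2 p3" and p: "p1 > 0" "p2 > 0" "p3 > 0"
  shows "\<exists>C\<ge>0. \<forall>N a b. (\<integral>\<^sup>+\<theta>. ennreal (cmod (bilinear_trig_sum \<phi> a b N \<theta>) powr p3) \<partial>unit_cell)
     \<le> ennreal (C * (LINT \<theta>|unit_cell. cmod (trig_sum a N \<theta>) powr p1) powr (p3 / p1)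
                  * (LINT \<theta>|unit_cell. cmod (trig_sum b N \<theta>) powr p2) powr (p3 / p2))"
proof -
  obtain C where C: "C \<ge> 0" and bd: "\<And>F G. trig_polynomial F \<Longrightarrow> trig_polynomial G \<Longrightarrow>
        lp_norm p3 torus (bilinear_op_T \<phi> F G) \<le> ennreal C * lp_norm p1 torus F * lp_norm p2 torus G"
    using \<phi> unfolding multipliers_T_def by blast
  show ?thesis
  proof (intro exI[of _ "C powr p3"] conjI allI)
    show "0 \<le> C powr p3" by simp
    fix N a b
    define x where "x = (LINT \<theta>|unit_cell. cmod (trig_sum a N \<theta>) powr p1)"
    define y where "y = (LINT \<theta>|unit_cell. cmod (trig_sum b N \<theta>) powr p2)"
    have xy: "x \<ge> 0" "y \<ge> 0" unfolding x_def y_def by (auto intro!: integral_nonneg)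
    have "lp_norm p3 torus (bilinear_trig_sum \<phi> a b N) \<le> ennreal (C * x powr (1 / p1) * y powr (1 / p2))"
      using bd[OF trig_polynomial_trig_sum trig_polynomial_trig_sum, of a N b N] C p
      by (simp add: bilinear_op_T_trig_sum lp_norm_torus_trig_sum x_def y_def ennreal_mult)
    then have "(\<integral>\<^sup>+\<theta>. ennreal (cmod (bilinear_trig_sum \<phi> a b N \<theta>) powr p3) \<partial>torus)
        \<le> ennreal ((C * x powr (1 / p1) * y powr (1 / p2)) powr p3)"
      using C p by (intro nn_integral_le_of_lp_norm_le) auto
    also have "(C * x powr (1 / p1) * y powr (1 / p2)) powr p3 = C powr p3 * x powr (p3 / p1) * y powr (p3 / p2)"
      using C xy by (simp add: powr_mult powr_powr)
    finally show "(\<integral>\<^sup>+\<theta>. ennreal (cmod (bilinear_trig_sum \<phi> a b N \<theta>) powr p3) \<partial>unit_cell)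
        \<le> ennreal (C powr p3 * x powr (p3 / p1) * y powr (p3 / p2))"
      unfolding torus_nn_integral .
  qed
qed

text \<open>The hypothesis applied to a pair of characters bounds one value of \<open>\<phi>\<close>.\<close>

lemma multipliers_T_bounded:
  assumes \<phi>: "\<phi> \<in> multipliers_T p1 p2 p3" and p: "p1 > 0" "p2 > 0" "p3 > 0"
  shows "\<exists>C\<ge>0. \<forall>z. cmod (\<phi> z) \<le> C"
proof -
  obtain C where C: "C \<ge> 0" and bd: "\<And>N a b. (\<integral>\<^sup>+\<theta>. ennreal (cmod (bilinear_trig_sum \<phi> a b N \<theta>) powr p3) \<partial>unit_cell)
     \<le> ennreal (C * (LINT \<theta>|unit_cell. cmod (trig_sum a N \<theta>) powr p1) powr (p3 / p1)
                  * (LINT \<theta>|unit_cell. cmod (trig_sum b N \<theta>) powr p2) powr (p3 / p2))"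
    using multipliers_T_bound[OF assms] by blast
  have "cmod (\<phi> (n, m)) \<le> C powr (1 / p3)" for n m
  proof -
    define N where "N = nat (max \<bar>n\<bar> \<bar>m\<bar>)"
    have N: "n \<in> {- int N..int N}" "m \<in> {- int N..int N}" by (auto simp: N_def)
    define \<delta> :: "int \<Rightarrow> int \<Rightarrow> complex" where "\<delta> n k = (if k = n then 1 else 0)" for n k
    have t: "trig_sum (\<delta> k) N \<theta> = cis (2 * pi * of_int k * \<theta>)" if "k \<in> {- int N..int N}" for k \<theta>
    proof -
      have "trig_sum (\<delta> k) N \<theta> = (\<Sum>n\<in>{- int N..int N}. if n = k then cis (2 * pi * of_int n * \<theta>) else 0)"
        unfolding trig_sum_def by (rule sum.cong) (auto simp: \<delta>_def)
      then show ?thesis using that by simp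
    qed
    have b: "bilinear_trig_sum \<phi> (\<delta> n) (\<delta> m) N \<theta> = \<phi> (n, m) * cis (2 * pi * \<theta> * of_int (n + m))" for \<theta>
    proof -
      have "bilinear_trig_sum \<phi> (\<delta> n) (\<delta> m) N \<theta> = (\<Sum>i\<in>{- int N..int N}. \<Sum>k\<in>{- int N..int N}.
          if k = m then (if i = n then \<phi> (i, k) * cis (2 * pi * \<theta> * of_int (i + k)) else 0) else 0)"
        unfolding bilinear_trig_sum_def by (intro sum.cong) (auto simp: \<delta>_def)
      also have "\<dots> = (\<Sum>i\<in>{- int N..int N}. if i = n then \<phi> (i, m) * cis (2 * pi * \<theta> * of_int (i + m)) else 0)"
        using N by (simp del: of_int_add)
      also have "\<dots> = \<phi> (n, m) * cis (2 * pi * \<theta> * of_int (n + m))" using N by (simp del: of_int_add)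
      finally show ?thesis .
    qed
    have "ennreal (cmod (\<phi> (n, m)) powr p3) \<le> ennreal C"
      using bd[of "\<delta> n" "\<delta> m" N] unfolding b t[OF N(1)] t[OF N(2)] by (simp add: norm_mult)
    then have "cmod (\<phi> (n, m)) powr p3 \<le> C" using C by simp
    then have "(cmod (\<phi> (n, m)) powr p3) powr (1 / p3) \<le> C powr (1 / p3)" using p by (intro powr_mono2) auto
    then show ?thesis using p by (simp add: powr_powr)
  qed
  then show ?thesis by (intro exI[of _ "C powr (1 / p3)"]) auto
qed

section \<open>Auxiliary bounds for the Taylor expansion and the limit\<close>

lemma power_over_fact_le_exp:
  fixes x :: real
  assumes "0 \<le> x"
  shows "x ^ i / fact i \<le> exp x" "(\<Sum>i<N. x ^ i / fact i) \<le> exp x"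
proof -
  have s: "(\<lambda>i. x ^ i / fact i) sums exp x"
    using exp_converges[of x] by (simp add: divide_inverse mult.commute)
  have nn: "0 \<le> x ^ i / fact i" for i using assms by simp
  show "(\<Sum>i<N. x ^ i / fact i) \<le> exp x" for N
    using sum_le_suminf[OF sums_summable[OF s], of "{..<N}"] nn sums_unique[OF s] by auto
  from this[of "Suc i"] have "(\<Sum>i<i. x ^ i / fact i) + x ^ i / fact i \<le> exp x" by simp
  then show "x ^ i / fact i \<le> exp x" using sum_nonneg[of "{..<i}" "\<lambda>i. x ^ i / fact i"] nn by simp
qed

text \<open>Replaces the triangle inequality in \<open>L^p\<close>, which fails for \<open>p < 1\<close>.  The geometric decay of the
  coefficients makes the modulus of the sum at most a constant times the largest
  \<open>(1/4)^(i + k) |X i k|\<close>, whose \<open>p\<close>-th power is bounded by the weighted sum of all \<open>p\<close>-th powers.\<close>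

lemma weighted_double_sum_powr:
  fixes c :: "nat \<Rightarrow> complex" and X :: "nat \<Rightarrow> nat \<Rightarrow> complex"
  assumes p: "p \<ge> 1/2" and M: "M \<ge> 0" and c: "\<And>i. cmod (c i) \<le> M * (1/8) ^ i"
  shows "cmod (\<Sum>i<N. \<Sum>k<N. c i * c k * X i k) powr p
     \<le> (4 * M\<^sup>2) powr p * (\<Sum>i<N. \<Sum>k<N. (1/2) ^ i * (1/2) ^ k * cmod (X i k) powr p)"
proof -
  define T where "T = (\<Sum>i<N. \<Sum>k<N. (1/2) ^ i * (1/2) ^ k * cmod (X i k) powr p)"
  have T0: "T \<ge> 0" unfolding T_def by (intro sum_nonneg) auto
  \<comment> \<open>Of the factor \<open>(1/8)^i\<close>, the part \<open>(1/2)^i\<close> is kept for the summation; the part \<open>(1/4)^i\<close>, raised to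
    the power \<open>p \<ge> 1/2\<close>, is at most \<open>(1/2)^i\<close>.\<close>
  have X: "(1/4) ^ i * (1/4) ^ k * cmod (X i k) \<le> T powr (1 / p)" if ik: "i < N" "k < N" for i k
  proof -
    have "((1/4) ^ i * (1/4) ^ k * cmod (X i k)) powr p = ((1/4) ^ (i + k)) powr p * cmod (X i k) powr p"
      by (simp add: powr_mult power_add)
    also have "((1/4::real) ^ (i + k)) powr p \<le> ((1/4) ^ (i + k)) powr (1/2)"
      using p by (intro powr_mono') (auto simp: power_le_one)
    also have "((1/4::real) ^ (i + k)) powr (1/2) = (1/2) ^ i * (1/2) ^ k"
    proof -
      have "(1/4::real) ^ (i + k) = ((1/2) ^ (i + k))\<^sup>2"
        by (simp add: power2_eq_square power_mult_distrib[symmetric])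
      then have "((1/4::real) ^ (i + k)) powr (1/2) = (1/2) ^ (i + k)" by (simp add: powr_half_sqrt)
      then show ?thesis by (simp add: power_add)
    qed
    finally have "((1/4) ^ i * (1/4) ^ k * cmod (X i k)) powr p \<le> (1/2) ^ i * (1/2) ^ k * cmod (X i k) powr p"
      by (simp add: mult_right_mono)
    also have "\<dots> \<le> (\<Sum>k<N. (1/2) ^ i * (1/2) ^ k * cmod (X i k) powr p)"
      using ik by (intro member_le_sum) auto
    also have "\<dots> \<le> T" unfolding T_def using ik
      by (intro member_le_sum[of i _ "\<lambda>i. \<Sum>k<N. (1/2) ^ i * (1/2) ^ k * cmod (X i k) powr p"]) (auto intro!: sum_nonneg)
    finally have "(((1/4) ^ i * (1/4) ^ k * cmod (X i k)) powr p) powr (1 / p) \<le> T powr (1 / p)"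
      using p by (intro powr_mono2) auto
    then show ?thesis using p by (simp add: powr_powr)
  qed
  have geo: "(\<Sum>i<N. (1/2::real) ^ i) \<le> 2"
    by (simp add: sum_gp_strict)
  have "cmod (\<Sum>i<N. \<Sum>k<N. c i * c k * X i k) \<le> (\<Sum>i<N. \<Sum>k<N. M\<^sup>2 * T powr (1 / p) * ((1/2) ^ i * (1/2) ^ k))"
  proof (intro sum_norm_le)
    fix i k assume "i \<in> {..<N}" "k \<in> {..<N}"
    then have ik: "i < N" "k < N" by auto
    have "cmod (c i * c k * X i k) \<le> (M * (1/8) ^ i) * (M * (1/8) ^ k) * cmod (X i k)"
      unfolding norm_mult using c M by (intro mult_right_mono mult_mono) auto
    also have "\<dots> = M\<^sup>2 * ((1/4) ^ i * (1/4) ^ k * cmod (X i k)) * ((1/2) ^ i * (1/2) ^ k)"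
    proof -
      have "(1/8::real) ^ n = (1/4) ^ n * (1/2) ^ n" for n
        unfolding power_mult_distrib[symmetric] by simp
      then show ?thesis by (simp only: power2_eq_square mult_ac)
    qed
    also have "\<dots> \<le> M\<^sup>2 * T powr (1 / p) * ((1/2) ^ i * (1/2) ^ k)"
      by (intro mult_right_mono mult_left_mono X ik) auto
    finally show "cmod (c i * c k * X i k) \<le> M\<^sup>2 * T powr (1 / p) * ((1/2) ^ i * (1/2) ^ k)" .
  qed
  also have "\<dots> = M\<^sup>2 * T powr (1 / p) * ((\<Sum>i<N. (1/2) ^ i) * (\<Sum>k<N. (1/2) ^ k))"
    by (simp only: sum_product) (simp only: sum_distrib_left)
  also have "\<dots> \<le> M\<^sup>2 * T powr (1 / p) * (2 * 2)"
    using geo by (intro mult_left_mono mult_mono) (auto intro!: sum_nonneg)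
  finally have "cmod (\<Sum>i<N. \<Sum>k<N. c i * c k * X i k) powr p \<le> (4 * M\<^sup>2 * T powr (1 / p)) powr p"
    using p by (intro powr_mono2) (auto simp: mult_ac)
  also have "\<dots> = (4 * M\<^sup>2) powr p * T" using p T0 by (simp add: powr_mult powr_powr)
  finally show ?thesis by (simp add: T_def)
qed

lemma nn_integral_le_of_pointwise_limit:
  fixes u :: "nat \<Rightarrow> 'a \<Rightarrow> ennreal"
  assumes m: "\<And>N. u N \<in> borel_measurable M" and lim: "\<And>x. x \<in> space M \<Longrightarrow> (\<lambda>N. u N x) \<longlonglongrightarrow> v x"
    and bd: "\<And>N. (\<integral>\<^sup>+x. u N x \<partial>M) \<le> ennreal (c N)" and c: "c \<longlonglongrightarrow> d"
  shows "(\<integral>\<^sup>+x. v x \<partial>M) \<le> ennreal d"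
proof -
  have "(\<integral>\<^sup>+x. v x \<partial>M) = (\<integral>\<^sup>+x. liminf (\<lambda>N. u N x) \<partial>M)"
    by (rule nn_integral_cong) (use lim in \<open>auto intro!: lim_imp_Liminf[symmetric]\<close>)
  also have "\<dots> \<le> liminf (\<lambda>N. \<integral>\<^sup>+x. u N x \<partial>M)" by (rule nn_integral_liminf[OF m])
  also have "\<dots> \<le> liminf (\<lambda>N. ennreal (c N))" by (intro Liminf_mono always_eventually allI bd)
  also have "\<dots> = ennreal d" by (intro lim_imp_Liminf tendsto_ennrealI c) simp
  finally show ?thesis .
qed

section \<open>Approximation of the operator on the line\<close>

text \<open>The index of the cell that contains \<open>\<xi>\<close>: the residue \<open>\<xi> - nearest \<xi>\<close> lies in \<open>J\<close>.\<close>

abbreviation nearest :: "real \<Rightarrow> int" where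
  "nearest \<xi> \<equiv> \<lfloor>\<xi> + 1/2\<rfloor>"

lemma nearest_measurable [measurable]: "nearest \<in> borel \<rightarrow>\<^sub>M count_space UNIV"
  by measurable

lemma nearest_real_measurable [measurable]: "(\<lambda>\<xi>. real_of_int (nearest \<xi>)) \<in> borel_measurable borel"
  by (rule measurable_compose[OF nearest_measurable]) simp

lemma nearest_pred_measurable [measurable]: "Measurable.pred borel (\<lambda>\<xi>. nearest \<xi> \<in> A)"
  by (rule measurable_compose[OF nearest_measurable]) simp

lemma nearest_add: "t \<in> J \<Longrightarrow> nearest (of_int n + t) = n"
  using mem_cell_iff[of "of_int n + t" n] by simp

lemma nearest_residue: "\<xi> - of_int (nearest \<xi>) \<in> J"
  by (simp add: mem_cell_iff)

lemma step_integral: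
  fixes q :: "real \<Rightarrow> complex" and s :: "int \<Rightarrow> complex"
  assumes q: "integrable lborel q" and vanish: "\<And>\<xi>. nearest \<xi> \<notin> {- int N..int N} \<Longrightarrow> q \<xi> = 0"
  shows "(LINT \<xi>|lborel. q \<xi> * s (nearest \<xi>)) = (\<Sum>n\<in>{- int N..int N}. s n * (LINT t|unit_cell. q (of_int n + t)))"
proof -
  have [measurable]: "q \<in> borel_measurable borel" using q by simp
  have "q \<xi> * s (nearest \<xi>) = (\<Sum>n\<in>{- int N..int N}. s n * (indicator J (\<xi> - of_int n) *\<^sub>R q \<xi>))" for \<xi>
  proof -
    have "(\<Sum>n\<in>{- int N..int N}. s n * (indicator J (\<xi> - of_int n) *\<^sub>R q \<xi>))
        = (\<Sum>n\<in>{- int N..int N}. if n = nearest \<xi> then s n * q \<xi> else 0)"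
      by (rule sum.cong) (auto simp: indicator_def mem_cell_iff)
    then show ?thesis using vanish[of \<xi>] by (auto simp: mult.commute)
  qed
  moreover have "integrable lborel (\<lambda>\<xi>. s n * (indicator J (\<xi> - of_int n) *\<^sub>R q \<xi>))" for n
    by (rule integrable_mult_right, rule Bochner_Integration.integrable_bound[OF q]) (auto simp: indicator_def)
  ultimately have "(LINT \<xi>|lborel. q \<xi> * s (nearest \<xi>))
      = (\<Sum>n\<in>{- int N..int N}. LINT \<xi>|lborel. s n * (indicator J (\<xi> - of_int n) *\<^sub>R q \<xi>))"
    by (simp only: Bochner_Integration.integral_sum)
  then show ?thesis by (simp only: integral_mult_right_zero unit_cell_translate_integral)
qed

definition taylor_cis :: "nat \<Rightarrow> real \<Rightarrow> complex" where
  "taylor_cis N u = (\<Sum>i<N. (2 * of_real pi * \<i> * of_real u) ^ i / fact i)"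

lemma taylor_cis_tendsto: "(\<lambda>N. taylor_cis N u) \<longlonglongrightarrow> cis (2 * pi * u)"
proof -
  have "(\<lambda>i. (2 * of_real pi * \<i> * of_real u) ^ i /\<^sub>R fact i) sums exp (2 * of_real pi * \<i> * complex_of_real u)"
    by (rule exp_converges)
  then have "(\<lambda>i. (2 * of_real pi * \<i> * of_real u) ^ i / fact i) sums cis (2 * pi * u)"
    by (simp add: cis_conv_exp scaleR_conv_of_real divide_inverse mult_ac)
  then show ?thesis unfolding sums_def taylor_cis_def .
qed

lemma taylor_cis_norm_le: "cmod (taylor_cis N u) \<le> exp (2 * pi * \<bar>u\<bar>)"
proof -
  have "cmod (taylor_cis N u) \<le> (\<Sum>i<N. (2 * pi * \<bar>u\<bar>) ^ i / fact i)"
    unfolding taylor_cis_def by (rule sum_norm_le) (simp add: norm_divide norm_power norm_mult)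
  also have "\<dots> \<le> exp (2 * pi * \<bar>u\<bar>)" by (rule power_over_fact_le_exp) simp
  finally show ?thesis .
qed

lemma taylor_cis_measurable [measurable]: "taylor_cis N \<in> borel_measurable borel"
  unfolding taylor_cis_def by measurable

text \<open>Since \<open>(l + \<theta>) \<xi>\<close> differs from \<open>\<theta> n + l \<tau> + \<theta> \<tau>\<close> by the integer \<open>l n\<close>, where \<open>n\<close> is the nearest
  integer to \<open>\<xi>\<close> and \<open>\<tau>\<close> the residue, this is \<open>f^(\<xi>) e((l + \<theta>) \<xi>)\<close> with frequencies cut off at \<open>N\<close> and
  \<open>e(\<theta> \<tau>)\<close> replaced by its Taylor polynomial.\<close>

definition truncated_wave :: "(real \<Rightarrow> complex) \<Rightarrow> real \<Rightarrow> int \<Rightarrow> nat \<Rightarrow> real \<Rightarrow> complex" where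
  "truncated_wave f \<theta> l N \<xi> = (if nearest \<xi> \<in> {- int N..int N}
     then fourier f \<xi> * (cis (2 * pi * \<theta> * of_int (nearest \<xi>)) * cis (2 * pi * (\<xi> - of_int (nearest \<xi>)) * of_int l)
        * taylor_cis N (\<theta> * (\<xi> - of_int (nearest \<xi>)))) else 0)"

lemma truncated_wave_measurable:
  assumes [measurable]: "f \<in> borel_measurable borel"
  shows "truncated_wave f \<theta> l N \<in> borel_measurable borel"
proof -
  note [measurable] = fourier_measurable[OF assms]
  show ?thesis unfolding truncated_wave_def[abs_def]
    by (rule measurable_If[OF _ _ nearest_pred_measurable[unfolded pred_def]]; measurable)
qed

lemma truncated_wave_norm_le:
  assumes "\<theta> \<in> J"
  shows "cmod (truncated_wave f \<theta> l N \<xi>) \<le> exp (2 * pi) * cmod (fourier f \<xi>)"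
proof -
  define u where "u = \<theta> * (\<xi> - of_int (nearest \<xi>))"
  have "\<bar>u\<bar> \<le> 1/2 * (1/2)" unfolding u_def abs_mult
    using J_bound[OF assms] J_bound[OF nearest_residue[of \<xi>]] by (intro mult_mono) auto
  then have "2 * pi * \<bar>u\<bar> \<le> 2 * pi * 1" by (intro mult_left_mono) auto
  then have t: "cmod (taylor_cis N u) \<le> exp (2 * pi)"
    by (intro order_trans[OF taylor_cis_norm_le]) simp
  have "cmod (truncated_wave f \<theta> l N \<xi>) \<le> cmod (fourier f \<xi>) * cmod (taylor_cis N u)"
    unfolding truncated_wave_def u_def by (simp add: norm_mult)
  also have "\<dots> \<le> cmod (fourier f \<xi>) * exp (2 * pi)" using t by (intro mult_left_mono) auto
  finally show ?thesis by (simp add: mult.commute)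
qed

lemma truncated_wave_tendsto:
  "(\<lambda>N. truncated_wave f \<theta> l N \<xi>) \<longlonglongrightarrow> fourier f \<xi> * cis (2 * pi * (of_int l + \<theta>) * \<xi>)"
proof -
  define n where "n = nearest \<xi>"
  define \<tau> where "\<tau> = \<xi> - of_int n"
  have "(\<lambda>N. fourier f \<xi> * (cis (2 * pi * \<theta> * of_int n) * cis (2 * pi * \<tau> * of_int l) * taylor_cis N (\<theta> * \<tau>)))
     \<longlonglongrightarrow> fourier f \<xi> * (cis (2 * pi * \<theta> * of_int n) * cis (2 * pi * \<tau> * of_int l) * cis (2 * pi * (\<theta> * \<tau>)))"
    by (intro tendsto_intros taylor_cis_tendsto)
  moreover have "cis (2 * pi * \<theta> * of_int n) * cis (2 * pi * \<tau> * of_int l) * cis (2 * pi * (\<theta> * \<tau>)) = cis (2 * pi * (of_int l + \<theta>) * \<xi>)"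
  proof -
    have "cis (2 * pi * (of_int l + \<theta>) * \<xi>) = cis (2 * pi * \<theta> * of_int n) * cis (2 * pi * \<tau> * of_int l) * cis (2 * pi * (\<theta> * \<tau>)) * cis (2 * pi * of_int (l * n))"
      unfolding cis_mult by (simp add: \<tau>_def algebra_simps)
    then show ?thesis by (simp only: cis_2pi_of_int) simp
  qed
  moreover have "\<forall>\<^sub>F N in sequentially. truncated_wave f \<theta> l N \<xi>
      = fourier f \<xi> * (cis (2 * pi * \<theta> * of_int n) * cis (2 * pi * \<tau> * of_int l) * taylor_cis N (\<theta> * \<tau>))"
    by (rule eventually_sequentiallyI[of "nat \<bar>n\<bar>"]) (auto simp: truncated_wave_def n_def \<tau>_def)
  ultimately show ?thesis by (simp add: tendsto_cong)
qed

lemma truncated_wave_cell_integral: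
  assumes f: "f \<in> borel_measurable borel" and C: "C \<ge> 0" "\<And>\<xi>. cmod (fourier f \<xi>) \<le> C / (1 + \<xi>\<^sup>2)"
    and n: "n \<in> {- int N..int N}"
  shows "(LINT t|unit_cell. truncated_wave f \<theta> l N (of_int n + t))
     = cis (2 * pi * \<theta> * of_int n) * (\<Sum>i<N. (2 * of_real pi * \<i> * of_real \<theta>) ^ i / fact i * cell_moment f i l n)"
proof -
  note [measurable] = fourier_measurable[OF f]
  define c where "c i = (2 * of_real pi * \<i> * complex_of_real \<theta>) ^ i / fact i" for i :: nat
  have "(LINT t|unit_cell. truncated_wave f \<theta> l N (of_int n + t))
     = (LINT t|unit_cell. cis (2 * pi * \<theta> * of_int n) * (\<Sum>i<N. c i * (fourier f (of_int n + t) * (of_real (t ^ i) * cis (2 * pi * t * of_int l)))))"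
  proof (rule Bochner_Integration.integral_cong)
    fix t assume "t \<in> space unit_cell"
    then have near: "nearest (of_int n + t) = n" by (simp add: nearest_add)
    have "taylor_cis N (\<theta> * t) = (\<Sum>i<N. c i * of_real (t ^ i))"
      by (simp add: taylor_cis_def c_def power_mult_distrib mult_ac)
    then show "truncated_wave f \<theta> l N (of_int n + t)
       = cis (2 * pi * \<theta> * of_int n) * (\<Sum>i<N. c i * (fourier f (of_int n + t) * (of_real (t ^ i) * cis (2 * pi * t * of_int l))))"
      using n unfolding truncated_wave_def near by (simp add: sum_distrib_left sum_distrib_right mult_ac)
  qed simp
  also have "\<dots> = cis (2 * pi * \<theta> * of_int n) * (\<Sum>i<N. LINT t|unit_cell. c i * (fourier f (of_int n + t) * (of_real (t ^ i) * cis (2 * pi * t * of_int l))))"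
  proof -
    have "integrable unit_cell (\<lambda>t. c i * (fourier f (of_int n + t) * (of_real (t ^ i) * cis (2 * pi * t * of_int l))))" for i
    proof (rule integrable_mult_right, rule unit_cell_integrable[where B = "C * 1"])
      fix t assume t: "t \<in> J"
      have "cmod (fourier f (of_int n + t)) \<le> C / 1"
        using C(1) by (intro order_trans[OF C(2)] divide_left_mono) (auto simp: add_pos_nonneg)
      then show "cmod (fourier f (of_int n + t) * (of_real (t ^ i) * cis (2 * pi * t * of_int l))) \<le> C * 1"
        unfolding norm_mult[of "fourier f _"] using C(1) by (intro mult_mono cell_weight_bound t) auto
    qed measurable
    then show ?thesis by (simp only: integral_mult_right_zero Bochner_Integration.integral_sum)
  qed
  finally show ?thesis by (simp only: integral_mult_right_zero c_def cell_moment_def)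
qed

text \<open>The truncated form of the expansion of the operator on the line, at the point \<open>l + \<theta>\<close>, into
  values of the periodic operator.\<close>

definition approximant :: "(int \<times> int \<Rightarrow> complex) \<Rightarrow> (real \<Rightarrow> complex) \<Rightarrow> (real \<Rightarrow> complex) \<Rightarrow> nat \<Rightarrow> int \<Rightarrow> real \<Rightarrow> complex" where
  "approximant \<phi> f g N l \<theta> = (\<Sum>i<N. \<Sum>k<N.
     (2 * of_real pi * \<i> * of_real \<theta>) ^ i / fact i * ((2 * of_real pi * \<i> * of_real \<theta>) ^ k / fact k)
       * bilinear_trig_sum \<phi> (cell_moment f i l) (cell_moment g k l) N \<theta>)"

text \<open>The integrand is, in each variable, a truncated wave times a function of the nearest integer;
  the integrals split into cells, and on each cell the Taylor polynomial produces the moments.\<close>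

lemma approximant_eq_iterated_integral:
  assumes f: "f \<in> borel_measurable borel" "Cf \<ge> 0" "\<And>\<xi>. cmod (fourier f \<xi>) \<le> Cf / (1 + \<xi>\<^sup>2)"
    and g: "g \<in> borel_measurable borel" "Cg \<ge> 0" "\<And>\<xi>. cmod (fourier g \<xi>) \<le> Cg / (1 + \<xi>\<^sup>2)"
    and \<theta>: "\<theta> \<in> J"
  shows "approximant \<phi> f g N l \<theta> = (LINT \<eta>|lborel. truncated_wave g \<theta> l N \<eta> *
     (LINT \<xi>|lborel. truncated_wave f \<theta> l N \<xi> * \<phi> (nearest \<xi>, nearest \<eta>)))"
proof -
  define c where "c i = (2 * of_real pi * \<i> * complex_of_real \<theta>) ^ i / fact i" for i :: nat
  define I where "I = {- int N..int N}"
  have int: "integrable lborel (truncated_wave h \<theta> l N)"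
    if "h \<in> borel_measurable borel" "\<And>\<xi>. cmod (fourier h \<xi>) \<le> C / (1 + \<xi>\<^sup>2)" for h C
  proof (rule integrable_of_quadratic_decay[where C = "exp (2 * pi) * C"])
    show "cmod (truncated_wave h \<theta> l N \<xi>) \<le> exp (2 * pi) * C / (1 + \<xi>\<^sup>2)" for \<xi>
      using mult_left_mono[OF that(2)[of \<xi>], of "exp (2 * pi)"]
      by (intro order_trans[OF truncated_wave_norm_le[OF \<theta>]]) simp
  qed (rule truncated_wave_measurable[OF that(1)])
  have van: "truncated_wave h \<theta> l N \<xi> = 0" if "nearest \<xi> \<notin> {- int N..int N}" for h \<xi>
    by (simp only: truncated_wave_def that if_False)
  have cellf: "(LINT t|unit_cell. truncated_wave f \<theta> l N (of_int n + t)) = cis (2 * pi * \<theta> * of_int n) * (\<Sum>i<N. c i * cell_moment f i l n)" if "n \<in> I" for n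
    using truncated_wave_cell_integral[OF f] that unfolding c_def I_def by blast
  have cellg: "(LINT t|unit_cell. truncated_wave g \<theta> l N (of_int n + t)) = cis (2 * pi * \<theta> * of_int n) * (\<Sum>i<N. c i * cell_moment g i l n)" if "n \<in> I" for n
    using truncated_wave_cell_integral[OF g] that unfolding c_def I_def by blast
  define s where "s m = (\<Sum>n\<in>I. \<phi> (n, m) * (cis (2 * pi * \<theta> * of_int n) * (\<Sum>i<N. c i * cell_moment f i l n)))" for m
  have inner: "(LINT \<xi>|lborel. truncated_wave f \<theta> l N \<xi> * \<phi> (nearest \<xi>, m)) = s m" for m
  proof -
    have "(LINT \<xi>|lborel. truncated_wave f \<theta> l N \<xi> * \<phi> (nearest \<xi>, m))
       = (\<Sum>n\<in>I. \<phi> (n, m) * (LINT t|unit_cell. truncated_wave f \<theta> l N (of_int n + t)))"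
      unfolding I_def
      by (rule step_integral[where q = "truncated_wave f \<theta> l N" and s = "\<lambda>n. \<phi> (n, m)"])
        (rule int[OF f(1,3)], rule van)
    then show ?thesis unfolding s_def by (simp add: cellf)
  qed
  have "(LINT \<eta>|lborel. truncated_wave g \<theta> l N \<eta> * s (nearest \<eta>))
      = (\<Sum>m\<in>I. s m * (cis (2 * pi * \<theta> * of_int m) * (\<Sum>k<N. c k * cell_moment g k l m)))"
  proof -
    have "(LINT \<eta>|lborel. truncated_wave g \<theta> l N \<eta> * s (nearest \<eta>))
       = (\<Sum>m\<in>I. s m * (LINT t|unit_cell. truncated_wave g \<theta> l N (of_int m + t)))"
      unfolding I_def
      by (rule step_integral[where q = "truncated_wave g \<theta> l N"]) (rule int[OF g(1,3)], rule van)
    then show ?thesis by (simp add: cellg)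
  qed
  also have "\<dots> = (\<Sum>m\<in>I. \<Sum>n\<in>I. \<Sum>i<N. \<Sum>k<N. c i * c k * (cell_moment f i l n * cell_moment g k l m * \<phi> (n, m) * cis (2 * pi * \<theta> * of_int (n + m))))"
  proof (rule sum.cong)
    fix m
    have "cis (2 * pi * \<theta> * of_int (n + m)) = cis (2 * pi * \<theta> * of_int n) * cis (2 * pi * \<theta> * of_int m)" for n
      by (simp add: cis_mult algebra_simps)
    then have e: "\<phi> (n, m) * (cis (2 * pi * \<theta> * of_int n) * a) * (cis (2 * pi * \<theta> * of_int m) * b)
        = \<phi> (n, m) * cis (2 * pi * \<theta> * of_int (n + m)) * (a * b)" for n a b
      by (simp only: mult_ac)
    have r: "\<phi> (n, m) * E * ((c i * a) * (c k * b)) = c i * c k * (a * b * \<phi> (n, m) * E)" for n E i k a b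
      by (simp only: mult_ac)
    have t: "\<phi> (n, m) * (cis (2 * pi * \<theta> * of_int n) * (\<Sum>i<N. c i * cell_moment f i l n))
          * (cis (2 * pi * \<theta> * of_int m) * (\<Sum>k<N. c k * cell_moment g k l m))
       = (\<Sum>i<N. \<Sum>k<N. c i * c k * (cell_moment f i l n * cell_moment g k l m * \<phi> (n, m) * cis (2 * pi * \<theta> * of_int (n + m))))" for n
      unfolding e sum_product by (simp only: sum_distrib_left r)
    show "s m * (cis (2 * pi * \<theta> * of_int m) * (\<Sum>k<N. c k * cell_moment g k l m))
      = (\<Sum>n\<in>I. \<Sum>i<N. \<Sum>k<N. c i * c k * (cell_moment f i l n * cell_moment g k l m * \<phi> (n, m) * cis (2 * pi * \<theta> * of_int (n + m))))"
      unfolding t[symmetric] s_def by (rule sum_distrib_right)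
  qed simp
  also have "\<dots> = (\<Sum>i<N. \<Sum>k<N. \<Sum>n\<in>I. \<Sum>m\<in>I. c i * c k * (cell_moment f i l n * cell_moment g k l m * \<phi> (n, m) * cis (2 * pi * \<theta> * of_int (n + m))))"
    by (subst sum.swap, subst (2) sum.swap, subst sum.swap) (simp only: sum.swap[of _ "{..<N}" I])
  also have "\<dots> = approximant \<phi> f g N l \<theta>"
    unfolding approximant_def bilinear_trig_sum_def c_def I_def sum_distrib_left ..
  finally show ?thesis unfolding inner by simp
qed

lemma step_symbol_eq:
  "(\<lambda>(\<xi>, \<eta>). \<Sum>\<^sub>\<infinity>(n, m)\<in>UNIV. \<phi> (n, m) * indicator (J \<times> J) (\<xi> - real_of_int n, \<eta> - real_of_int m))
     = (\<lambda>(\<xi>, \<eta>). \<phi> (nearest \<xi>, nearest \<eta>) :: complex)"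
proof (rule ext, clarify)
  fix \<xi> \<eta> :: real
  have "(\<Sum>\<^sub>\<infinity>(n, m)\<in>UNIV. \<phi> (n, m) * indicator (J \<times> J) (\<xi> - real_of_int n, \<eta> - real_of_int m))
      = (\<Sum>\<^sub>\<infinity>(n, m)\<in>{(nearest \<xi>, nearest \<eta>)}. \<phi> (n, m) * indicator (J \<times> J) (\<xi> - real_of_int n, \<eta> - real_of_int m))"
    by (rule infsum_cong_neutral) (auto simp: indicator_def mem_cell_iff split: if_splits)
  then show "(\<Sum>\<^sub>\<infinity>(n, m)\<in>UNIV. \<phi> (n, m) * indicator (J \<times> J) (\<xi> - real_of_int n, \<eta> - real_of_int m))
      = \<phi> (nearest \<xi>, nearest \<eta>)"
    by (simp add: mem_cell_iff)
qed

lemma step_symbol_measurable: "(\<lambda>(\<xi>, \<eta>). \<phi> (nearest \<xi>, nearest \<eta>) :: complex) \<in> borel_measurable lebesgue"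
proof -
  have "(\<lambda>z::real \<times> real. nearest (fst z)) \<in> borel \<rightarrow>\<^sub>M count_space UNIV" "(\<lambda>z::real \<times> real. nearest (snd z)) \<in> borel \<rightarrow>\<^sub>M count_space UNIV"
    by (rule measurable_compose[OF _ nearest_measurable], intro borel_measurable_continuous_onI continuous_intros)+
  then have "(\<lambda>z. \<phi> (nearest (fst z), nearest (snd z))) \<in> borel_measurable (borel :: (real \<times> real) measure)"
    using measurable_compose_countable[of "\<lambda>n z. \<phi> (n, nearest (snd z))" borel borel "\<lambda>z. nearest (fst z)"]
      measurable_compose[of "\<lambda>z::real \<times> real. nearest (snd z)" borel "count_space UNIV" "\<lambda>m. \<phi> (_, m)" borel]
    by simp
  then show ?thesis by (auto simp: case_prod_beta' intro: measurable_completion)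
qed

lemma bilinear_op_R_step_symbol:
  assumes f: "f \<in> borel_measurable borel" and g: "g \<in> borel_measurable borel"
  shows "bilinear_op_R (\<lambda>(\<xi>, \<eta>). \<phi> (nearest \<xi>, nearest \<eta>)) f g x
    = (LINT \<eta>|lborel. (fourier g \<eta> * cis (2 * pi * x * \<eta>)) *
        (LINT \<xi>|lborel. (fourier f \<xi> * cis (2 * pi * x * \<xi>)) * \<phi> (nearest \<xi>, nearest \<eta>)))"
proof -
  note [measurable] = fourier_measurable[OF f] fourier_measurable[OF g]
  have [measurable]: "(\<lambda>\<xi>. s (nearest \<xi>)) \<in> borel_measurable borel" for s :: "int \<Rightarrow> complex"
    by (rule measurable_compose[OF nearest_measurable]) simp
  have inner: "(LINT \<xi>|lebesgue. fourier f \<xi> * fourier g \<eta> * \<phi> (nearest \<xi>, nearest \<eta>) * cis (2 * pi * x * (\<xi> + \<eta>)))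
     = (fourier g \<eta> * cis (2 * pi * x * \<eta>)) * (LINT \<xi>|lborel. (fourier f \<xi> * cis (2 * pi * x * \<xi>)) * \<phi> (nearest \<xi>, nearest \<eta>))" for \<eta>
  proof -
    have [measurable]: "(\<lambda>\<xi>. \<phi> (nearest \<xi>, nearest \<eta>)) \<in> borel_measurable borel"
      by (rule measurable_compose[OF nearest_measurable]) simp
    have "(LINT \<xi>|lebesgue. fourier f \<xi> * fourier g \<eta> * \<phi> (nearest \<xi>, nearest \<eta>) * cis (2 * pi * x * (\<xi> + \<eta>)))
      = (LINT \<xi>|lborel. fourier f \<xi> * fourier g \<eta> * \<phi> (nearest \<xi>, nearest \<eta>) * cis (2 * pi * x * (\<xi> + \<eta>)))"
      by (rule integral_completion) measurable
    also have "\<dots> = (LINT \<xi>|lborel. (fourier g \<eta> * cis (2 * pi * x * \<eta>)) * ((fourier f \<xi> * cis (2 * pi * x * \<xi>)) * \<phi> (nearest \<xi>, nearest \<eta>)))"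
    proof (rule Bochner_Integration.integral_cong)
      fix \<xi>
      have "cis (2 * pi * x * (\<xi> + \<eta>)) = cis (2 * pi * x * \<xi>) * cis (2 * pi * x * \<eta>)"
        by (simp add: cis_mult distrib_left)
      then show "fourier f \<xi> * fourier g \<eta> * \<phi> (nearest \<xi>, nearest \<eta>) * cis (2 * pi * x * (\<xi> + \<eta>))
        = (fourier g \<eta> * cis (2 * pi * x * \<eta>)) * ((fourier f \<xi> * cis (2 * pi * x * \<xi>)) * \<phi> (nearest \<xi>, nearest \<eta>))"
        by (simp only: mult_ac)
    qed simp
    finally show ?thesis by (simp only: integral_mult_right_zero)
  qed
  have [measurable]: "(\<lambda>\<eta>. LINT \<xi>|lborel. (fourier f \<xi> * cis (2 * pi * x * \<xi>)) * \<phi> (nearest \<xi>, nearest \<eta>)) \<in> borel_measurable borel"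
    by (rule measurable_compose[OF nearest_measurable, of "\<lambda>m. LINT \<xi>|lborel. (fourier f \<xi> * cis (2 * pi * x * \<xi>)) * \<phi> (nearest \<xi>, m)"]) simp
  show ?thesis unfolding bilinear_op_R_def prod.case inner
    by (rule integral_completion) measurable
qed

lemma approximant_tendsto:
  assumes f: "f \<in> borel_measurable borel" "Cf \<ge> 0" "\<And>\<xi>. cmod (fourier f \<xi>) \<le> Cf / (1 + \<xi>\<^sup>2)"
    and g: "g \<in> borel_measurable borel" "Cg \<ge> 0" "\<And>\<xi>. cmod (fourier g \<xi>) \<le> Cg / (1 + \<xi>\<^sup>2)"
    and B: "\<And>z. cmod (\<phi> z) \<le> B" and \<theta>: "\<theta> \<in> J"
  shows "(\<lambda>N. approximant \<phi> f g N l \<theta>) \<longlonglongrightarrow> bilinear_op_R (\<lambda>(\<xi>, \<eta>). \<phi> (nearest \<xi>, nearest \<eta>)) f g (of_int l + \<theta>)"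
proof -
  note [measurable] = fourier_measurable[OF f(1)] fourier_measurable[OF g(1)]
    truncated_wave_measurable[OF f(1)] truncated_wave_measurable[OF g(1)]
  have [measurable]: "(\<lambda>\<xi>. s (nearest \<xi>)) \<in> borel_measurable borel" for s :: "int \<Rightarrow> complex"
    by (rule measurable_compose[OF nearest_measurable]) simp
  have B0: "B \<ge> 0" using order_trans[OF norm_ge_zero B] .
  define x where "x = of_int l + \<theta>"
  define u where "u N m = (LINT \<xi>|lborel. truncated_wave f \<theta> l N \<xi> * \<phi> (nearest \<xi>, m))" for N m
  define v where "v m = (LINT \<xi>|lborel. (fourier f \<xi> * cis (2 * pi * x * \<xi>)) * \<phi> (nearest \<xi>, m))" for m
  define W where "W = (LINT \<xi>|lborel. exp (2 * pi) * (Cf * (1 / (1 + \<xi>\<^sup>2))) * B)"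
  have iW: "integrable lborel (\<lambda>\<xi>. exp (2 * pi) * (C * (1 / (1 + \<xi>\<^sup>2))) * D)" for C D :: real
    by (intro integrable_mult_left integrable_mult_right integrable_inverse_quadratic)
  have tw: "cmod (truncated_wave h \<theta> l N \<xi>) \<le> exp (2 * pi) * (C * (1 / (1 + \<xi>\<^sup>2)))"
    if "\<And>\<xi>. cmod (fourier h \<xi>) \<le> C / (1 + \<xi>\<^sup>2)" for h C N \<xi>
    using mult_left_mono[OF that[of \<xi>], of "exp (2 * pi)"]
    by (intro order_trans[OF truncated_wave_norm_le[OF \<theta>]]) simp
  have \<phi>m: "(\<lambda>\<xi>. \<phi> (nearest \<xi>, m)) \<in> borel_measurable borel" for m
    by (rule measurable_compose[OF nearest_measurable]) simp
  have bd1: "cmod (truncated_wave f \<theta> l N \<xi> * \<phi> (nearest \<xi>, m)) \<le> exp (2 * pi) * (Cf * (1 / (1 + \<xi>\<^sup>2))) * B" for N \<xi> m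
    unfolding norm_mult using f(2) B0 by (intro mult_mono tw f(3) B) auto
  have ulim: "(\<lambda>N. u N m) \<longlonglongrightarrow> v m" for m
    unfolding u_def v_def
  proof (rule integral_dominated_convergence[where w = "\<lambda>\<xi>. exp (2 * pi) * (Cf * (1 / (1 + \<xi>\<^sup>2))) * B"])
    show "AE \<xi> in lborel. (\<lambda>N. truncated_wave f \<theta> l N \<xi> * \<phi> (nearest \<xi>, m)) \<longlonglongrightarrow> fourier f \<xi> * cis (2 * pi * x * \<xi>) * \<phi> (nearest \<xi>, m)"
      unfolding x_def by (intro AE_I2 tendsto_mult_right truncated_wave_tendsto)
  qed (use \<phi>m bd1 iW in \<open>auto intro!: borel_measurable_times\<close>)
  have ub: "cmod (u N m) \<le> W" for N m
  proof -
    have "integrable lborel (\<lambda>\<xi>. truncated_wave f \<theta> l N \<xi> * \<phi> (nearest \<xi>, m))"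
      by (rule Bochner_Integration.integrable_bound[OF iW[of Cf B]])
        (use \<phi>m order_trans[OF bd1 abs_ge_self] in \<open>auto intro!: borel_measurable_times\<close>)
    note i = integrable_norm[OF this]
    have "cmod (u N m) \<le> (LINT \<xi>|lborel. norm (truncated_wave f \<theta> l N \<xi> * \<phi> (nearest \<xi>, m)))"
      unfolding u_def by (rule integral_norm_bound)
    also have "\<dots> \<le> W" unfolding W_def by (rule integral_mono[OF i iW]) (rule bd1)
    finally show ?thesis .
  qed
  have "(\<lambda>N. LINT \<eta>|lborel. truncated_wave g \<theta> l N \<eta> * u N (nearest \<eta>))
      \<longlonglongrightarrow> (LINT \<eta>|lborel. (fourier g \<eta> * cis (2 * pi * x * \<eta>)) * v (nearest \<eta>))"
  proof (rule integral_dominated_convergence[where w = "\<lambda>\<eta>. exp (2 * pi) * (Cg * (1 / (1 + \<eta>\<^sup>2))) * W"])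
    show "AE \<eta> in lborel. (\<lambda>N. truncated_wave g \<theta> l N \<eta> * u N (nearest \<eta>)) \<longlonglongrightarrow> fourier g \<eta> * cis (2 * pi * x * \<eta>) * v (nearest \<eta>)"
      unfolding x_def by (intro AE_I2 tendsto_mult truncated_wave_tendsto ulim)
    show "AE \<eta> in lborel. cmod (truncated_wave g \<theta> l N \<eta> * u N (nearest \<eta>)) \<le> exp (2 * pi) * (Cg * (1 / (1 + \<eta>\<^sup>2))) * W" for N
      unfolding norm_mult using g(2) order_trans[OF norm_ge_zero ub] by (intro AE_I2 mult_mono tw g(3) ub) auto
  qed (use iW in auto)
  then show ?thesis
    unfolding approximant_eq_iterated_integral[OF f g \<theta>] bilinear_op_R_step_symbol[OF f(1) g(1)] u_def v_def x_def .
qed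

section \<open>Transference\<close>

lemma bilinear_trig_sum_measurable [measurable]: "bilinear_trig_sum \<phi> a b N \<in> borel_measurable borel"
  unfolding bilinear_trig_sum_def by measurable

lemma approximant_measurable [measurable]: "approximant \<phi> f g N l \<in> borel_measurable borel"
  unfolding approximant_def by measurable

lemma taylor_coefficient_bound:
  assumes "\<theta> \<in> J"
  shows "cmod ((2 * of_real pi * \<i> * of_real \<theta>) ^ i / fact i) \<le> exp (8 * pi) * (1/8) ^ i"
proof -
  have "cmod ((2 * of_real pi * \<i> * of_real \<theta>) ^ i / fact i) = (2 * pi * \<bar>\<theta>\<bar>) ^ i / fact i"
    by (simp add: norm_divide norm_power norm_mult)
  also have "\<dots> \<le> pi ^ i / fact i"
    using J_bound[OF assms] by (intro divide_right_mono power_mono) (auto simp: mult.commute)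
  also have "\<dots> = ((8 * pi) ^ i / fact i) * (1/8) ^ i"
    by (simp add: power_mult_distrib power_one_over)
  also have "\<dots> \<le> exp (8 * pi) * (1/8) ^ i"
    by (intro mult_right_mono power_over_fact_le_exp) auto
  finally show ?thesis .
qed

text \<open>The periodic bound, applied to each pair of Taylor degrees and to each \<open>l\<close>, is summed over \<open>l\<close> by
  Hoelder's inequality with the exponents \<open>p3 / p1\<close> and \<open>p3 / p2\<close>; the weights of the Taylor degrees
  have total mass at most 4.\<close>

lemma approximant_power_sum:
  assumes C: "C \<ge> 0" and bd: "\<And>N a b. (\<integral>\<^sup>+\<theta>. ennreal (cmod (bilinear_trig_sum \<phi> a b N \<theta>) powr p3) \<partial>unit_cell)
     \<le> ennreal (C * (LINT \<theta>|unit_cell. cmod (trig_sum a N \<theta>) powr p1) powr (p3 / p1)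
                  * (LINT \<theta>|unit_cell. cmod (trig_sum b N \<theta>) powr p2) powr (p3 / p2))"
    and p: "p1 > 0" "p2 > 0" "p3 \<ge> 1/2" "p3 / p1 + p3 / p2 = 1" and L: "finite L"
    and X: "\<And>i. (\<Sum>l\<in>L. LINT \<theta>|unit_cell. cmod (cell_poly f i l N \<theta>) powr p1) \<le> X"
    and Y: "\<And>i. (\<Sum>l\<in>L. LINT \<theta>|unit_cell. cmod (cell_poly g i l N \<theta>) powr p2) \<le> Y"
  shows "(\<integral>\<^sup>+\<theta>. (\<Sum>l\<in>L. ennreal (cmod (approximant \<phi> f g N l \<theta>) powr p3)) \<partial>unit_cell)
      \<le> ennreal ((4 * (exp (8 * pi))\<^sup>2) powr p3 * (4 * C) * X powr (p3 / p1) * Y powr (p3 / p2))"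
proof -
  define D where "D = (4 * (exp (8 * pi))\<^sup>2) powr p3"
  define x where "x i l = (LINT \<theta>|unit_cell. cmod (cell_poly f i l N \<theta>) powr p1)" for i l
  define y where "y i l = (LINT \<theta>|unit_cell. cmod (cell_poly g i l N \<theta>) powr p2)" for i l
  define P where "P i k l = bilinear_trig_sum \<phi> (cell_moment f i l) (cell_moment g k l) N" for i k l
  have [measurable]: "P i k l \<in> borel_measurable borel" for i k l unfolding P_def by measurable
  have xy: "x i l \<ge> 0" "y i l \<ge> 0" for i l unfolding x_def y_def by (auto intro!: integral_nonneg)
  have D0: "D \<ge> 0" by (simp add: D_def)
  have XY: "X powr (p3 / p1) * Y powr (p3 / p2) \<ge> 0" by simp
  have pt: "(\<Sum>l\<in>L. ennreal (cmod (approximant \<phi> f g N l \<theta>) powr p3))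
     \<le> ennreal D * (\<Sum>i<N. \<Sum>k<N. ennreal ((1/2) ^ i * (1/2) ^ k) * (\<Sum>l\<in>L. ennreal (cmod (P i k l \<theta>) powr p3)))" if \<theta>: "\<theta> \<in> J" for \<theta>
  proof -
    have "(\<Sum>l\<in>L. cmod (approximant \<phi> f g N l \<theta>) powr p3)
       \<le> (\<Sum>l\<in>L. D * (\<Sum>i<N. \<Sum>k<N. (1/2) ^ i * (1/2) ^ k * cmod (P i k l \<theta>) powr p3))"
      unfolding approximant_def D_def P_def
      using p(3) taylor_coefficient_bound[OF \<theta>] by (intro sum_mono weighted_double_sum_powr) auto
    also have "\<dots> = D * (\<Sum>i<N. \<Sum>k<N. (1/2) ^ i * (1/2) ^ k * (\<Sum>l\<in>L. cmod (P i k l \<theta>) powr p3))"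
    proof -
      have "(\<Sum>l\<in>L. \<Sum>i<N. \<Sum>k<N. (1/2) ^ i * (1/2) ^ k * cmod (P i k l \<theta>) powr p3)
        = (\<Sum>i<N. \<Sum>l\<in>L. \<Sum>k<N. (1/2) ^ i * (1/2) ^ k * cmod (P i k l \<theta>) powr p3)"
        by (rule sum.swap)
      also have "\<dots> = (\<Sum>i<N. \<Sum>k<N. \<Sum>l\<in>L. (1/2) ^ i * (1/2) ^ k * cmod (P i k l \<theta>) powr p3)"
        by (rule sum.cong[OF refl], rule sum.swap)
      finally show ?thesis by (simp only: sum_distrib_left[symmetric])
    qed
    finally have "ennreal (\<Sum>l\<in>L. cmod (approximant \<phi> f g N l \<theta>) powr p3)
       \<le> ennreal (D * (\<Sum>i<N. \<Sum>k<N. (1/2) ^ i * (1/2) ^ k * (\<Sum>l\<in>L. cmod (P i k l \<theta>) powr p3)))"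
      by (rule ennreal_leI)
    then show ?thesis using D0
      by (simp add: sum_ennreal sum_nonneg flip: ennreal_mult)
  qed
  have "(\<integral>\<^sup>+\<theta>. (\<Sum>l\<in>L. ennreal (cmod (approximant \<phi> f g N l \<theta>) powr p3)) \<partial>unit_cell)
     \<le> (\<integral>\<^sup>+\<theta>. ennreal D * (\<Sum>i<N. \<Sum>k<N. ennreal ((1/2) ^ i * (1/2) ^ k) * (\<Sum>l\<in>L. ennreal (cmod (P i k l \<theta>) powr p3))) \<partial>unit_cell)"
    by (rule nn_integral_mono) (use pt in simp)
  also have "\<dots> = ennreal D * (\<Sum>i<N. \<Sum>k<N. ennreal ((1/2) ^ i * (1/2) ^ k) * (\<Sum>l\<in>L. \<integral>\<^sup>+\<theta>. ennreal (cmod (P i k l \<theta>) powr p3) \<partial>unit_cell))"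
    by (simp add: nn_integral_cmult nn_integral_sum unit_cell_measurable del: sum_ennreal)
  also have "\<dots> \<le> ennreal D * (\<Sum>i<N. \<Sum>k<N. ennreal ((1/2) ^ i * (1/2) ^ k) * ennreal (C * (X powr (p3 / p1) * Y powr (p3 / p2))))"
  proof (intro mult_left_mono sum_mono)
    fix i k
    have "(\<Sum>l\<in>L. \<integral>\<^sup>+\<theta>. ennreal (cmod (P i k l \<theta>) powr p3) \<partial>unit_cell)
       \<le> (\<Sum>l\<in>L. ennreal (C * (x i l powr (p3 / p1) * y k l powr (p3 / p2))))"
      unfolding P_def x_def y_def mult.assoc[symmetric] by (intro sum_mono bd)
    also have "\<dots> = ennreal (C * (\<Sum>l\<in>L. x i l powr (p3 / p1) * y k l powr (p3 / p2)))"
      using C by (simp add: sum_ennreal sum_distrib_left)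
    also have "\<dots> \<le> ennreal (C * (X powr (p3 / p1) * Y powr (p3 / p2)))"
    proof (intro ennreal_leI mult_left_mono C)
      have "(\<Sum>l\<in>L. x i l powr (p3 / p1) * y k l powr (p3 / p2))
         \<le> (\<Sum>l\<in>L. x i l) powr (p3 / p1) * (\<Sum>l\<in>L. y k l) powr (p3 / p2)"
        using p L xy by (intro holder_sum) auto
      also have "\<dots> \<le> X powr (p3 / p1) * Y powr (p3 / p2)"
        using p X[of i] Y[of k] xy unfolding x_def[symmetric] y_def[symmetric]
        by (intro mult_mono powr_mono2) (auto intro!: sum_nonneg)
      finally show "(\<Sum>l\<in>L. x i l powr (p3 / p1) * y k l powr (p3 / p2)) \<le> X powr (p3 / p1) * Y powr (p3 / p2)" .
    qed
    finally show "(\<Sum>l\<in>L. \<integral>\<^sup>+\<theta>. ennreal (cmod (P i k l \<theta>) powr p3) \<partial>unit_cell) \<le> ennreal (C * (X powr (p3 / p1) * Y powr (p3 / p2)))" .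
  qed auto
  also have "\<dots> = ennreal (D * ((\<Sum>i<N. (1/2) ^ i) * (\<Sum>k<N. (1/2) ^ k) * (C * (X powr (p3 / p1) * Y powr (p3 / p2)))))"
  proof -
    have "(\<Sum>i<N. \<Sum>k<N. ennreal ((1/2) ^ i * (1/2) ^ k) * ennreal (C * (X powr (p3 / p1) * Y powr (p3 / p2))))
      = ennreal (\<Sum>i<N. \<Sum>k<N. (1/2) ^ i * (1/2) ^ k * (C * (X powr (p3 / p1) * Y powr (p3 / p2))))"
      using C by (simp add: sum_ennreal sum_nonneg flip: ennreal_mult)
    also have "(\<Sum>i<N. \<Sum>k<N. (1/2) ^ i * (1/2) ^ k * (C * (X powr (p3 / p1) * Y powr (p3 / p2))))
       = (\<Sum>i<N. (1/2) ^ i) * (\<Sum>k<N. (1/2) ^ k) * (C * (X powr (p3 / p1) * Y powr (p3 / p2)))"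
      by (simp only: sum_product) (simp only: sum_distrib_right)
    finally show ?thesis using D0 C by (simp add: ennreal_mult sum_nonneg)
  qed
  also have "\<dots> \<le> ennreal (D * (2 * 2 * (C * (X powr (p3 / p1) * Y powr (p3 / p2)))))"
    using C D0 by (intro ennreal_leI mult_left_mono mult_right_mono mult_mono) (auto intro!: sum_nonneg simp: sum_gp_strict power_le_one)
  finally show ?thesis by (simp add: D_def mult_ac)
qed

text \<open>The operator is a pointwise limit of approximants, taken at the nearest integer to \<open>x\<close> and the
  corresponding residue.\<close>

lemma bilinear_op_R_step_symbol_measurable:
  assumes f: "f \<in> borel_measurable borel" "Cf \<ge> 0" "\<And>\<xi>. cmod (fourier f \<xi>) \<le> Cf / (1 + \<xi>\<^sup>2)"
    and g: "g \<in> borel_measurable borel" "Cg \<ge> 0" "\<And>\<xi>. cmod (fourier g \<xi>) \<le> Cg / (1 + \<xi>\<^sup>2)"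
    and B: "\<And>z. cmod (\<phi> z) \<le> B"
  shows "bilinear_op_R (\<lambda>(\<xi>, \<eta>). \<phi> (nearest \<xi>, nearest \<eta>)) f g \<in> borel_measurable borel"
proof (rule borel_measurable_LIMSEQ_metric)
  fix x
  show "(\<lambda>N. approximant \<phi> f g N (nearest x) (x - of_int (nearest x))) \<longlonglongrightarrow> bilinear_op_R (\<lambda>(\<xi>, \<eta>). \<phi> (nearest \<xi>, nearest \<eta>)) f g x"
    using approximant_tendsto[where l = "nearest x", OF f g B nearest_residue[of x]] by simp
next
  fix N
  show "(\<lambda>x. approximant \<phi> f g N (nearest x) (x - of_int (nearest x))) \<in> borel_measurable borel"
    by (rule measurable_compose_countable[where f = "\<lambda>l x. approximant \<phi> f g N l (x - of_int (nearest x))"]) measurable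
qed

text \<open>Fatou's lemma gives the bound for any finite number of cells with a constant independent of
  their number, since the truncation errors disappear in the limit; the supremum over the number of
  cells is the integral over the line.\<close>

lemma step_symbol_lp_bound:
  assumes hr: "holder_related p1 p2 p3" and p1: "p1 > 1" and p2: "p2 > 1" and \<phi>: "\<phi> \<in> multipliers_T p1 p2 p3"
  shows "\<exists>K\<ge>0. \<forall>f g. schwartz f \<longrightarrow> schwartz g \<longrightarrow>
    (\<integral>\<^sup>+x. ennreal (cmod (bilinear_op_R (\<lambda>(\<xi>, \<eta>). \<phi> (nearest \<xi>, nearest \<eta>)) f g x) powr p3) \<partial>lborel)
      \<le> ennreal (K * (LINT x|lborel. cmod (f x) powr p1) powr (p3 / p1) * (LINT x|lborel. cmod (g x) powr p2) powr (p3 / p2))"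
proof -
  have p3: "p3 \<ge> 1/2" and pp: "1 / p1 + 1 / p2 = 1 / p3" using hr by (auto simp: holder_related_def)
  have "p3 * (1 / p1 + 1 / p2) = 1" using pp p3 by simp
  then have r: "p3 / p1 + p3 / p2 = 1" by (simp add: distrib_left)
  have pos: "p1 > 0" "p2 > 0" "p3 > 0" using p1 p2 p3 by auto
  obtain C where C: "C \<ge> 0" and bd: "\<And>N a b. (\<integral>\<^sup>+\<theta>. ennreal (cmod (bilinear_trig_sum \<phi> a b N \<theta>) powr p3) \<partial>unit_cell)
     \<le> ennreal (C * (LINT \<theta>|unit_cell. cmod (trig_sum a N \<theta>) powr p1) powr (p3 / p1)
                  * (LINT \<theta>|unit_cell. cmod (trig_sum b N \<theta>) powr p2) powr (p3 / p2))"
    using multipliers_T_bound[OF \<phi> pos] by blast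
  obtain B where B: "\<And>z. cmod (\<phi> z) \<le> B" using multipliers_T_bounded[OF \<phi> pos] by blast
  obtain A1 where A1: "A1 \<ge> 0" and s1: "\<And>f. schwartz f \<Longrightarrow> \<exists>E. (\<forall>N. 0 \<le> E N) \<and> E \<longlonglongrightarrow> 0 \<and> (\<forall>j N. \<forall>L :: int set. finite L \<longrightarrow>
     (\<Sum>l\<in>L. LINT \<theta>|unit_cell. cmod (cell_poly f j l N \<theta>) powr p1) \<le> A1 * (LINT x|lborel. cmod (f x) powr p1) + real (card L) * E N)"
    using cell_poly_power_sum[OF p1] by blast
  obtain A2 where A2: "A2 \<ge> 0" and s2: "\<And>f. schwartz f \<Longrightarrow> \<exists>E. (\<forall>N. 0 \<le> E N) \<and> E \<longlonglongrightarrow> 0 \<and> (\<forall>j N. \<forall>L :: int set. finite L \<longrightarrow>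
     (\<Sum>l\<in>L. LINT \<theta>|unit_cell. cmod (cell_poly f j l N \<theta>) powr p2) \<le> A2 * (LINT x|lborel. cmod (f x) powr p2) + real (card L) * E N)"
    using cell_poly_power_sum[OF p2] by blast
  define Q where "Q = (4 * (exp (8 * pi))\<^sup>2) powr p3 * (4 * C)"
  have Q: "Q \<ge> 0" using C by (simp add: Q_def)
  show ?thesis
  proof (intro exI[of _ "Q * A1 powr (p3 / p1) * A2 powr (p3 / p2)"] conjI allI impI)
    show "0 \<le> Q * A1 powr (p3 / p1) * A2 powr (p3 / p2)" using Q by simp
    fix f g assume f: "schwartz f" and g: "schwartz g"
    have fm: "h \<in> borel_measurable borel" if "schwartz h" for h
      by (rule schwartz_decay[OF that]) (rule borel_measurable_continuous_onI)
    obtain Cf where Cf: "Cf \<ge> 0" "\<And>\<xi>. cmod (fourier f \<xi>) \<le> Cf / (1 + \<xi>\<^sup>2)" using fourier_decay[OF f] by blast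
    obtain Cg where Cg: "Cg \<ge> 0" "\<And>\<xi>. cmod (fourier g \<xi>) \<le> Cg / (1 + \<xi>\<^sup>2)" using fourier_decay[OF g] by blast
    define T where "T = bilinear_op_R (\<lambda>(\<xi>, \<eta>). \<phi> (nearest \<xi>, nearest \<eta>)) f g"
    define \<alpha> where "\<alpha> = (LINT x|lborel. cmod (f x) powr p1)"
    define \<beta> where "\<beta> = (LINT x|lborel. cmod (g x) powr p2)"
    have \<alpha>\<beta>: "\<alpha> \<ge> 0" "\<beta> \<ge> 0" unfolding \<alpha>_def \<beta>_def by (auto intro!: integral_nonneg)
    obtain E1 where E1: "\<And>N. 0 \<le> E1 N" "E1 \<longlonglongrightarrow> 0"
      and b1: "\<And>j N (L :: int set). finite L \<Longrightarrow> (\<Sum>l\<in>L. LINT \<theta>|unit_cell. cmod (cell_poly f j l N \<theta>) powr p1) \<le> A1 * \<alpha> + real (card L) * E1 N"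
      using s1[OF f] unfolding \<alpha>_def by blast
    obtain E2 where E2: "\<And>N. 0 \<le> E2 N" "E2 \<longlonglongrightarrow> 0"
      and b2: "\<And>j N (L :: int set). finite L \<Longrightarrow> (\<Sum>l\<in>L. LINT \<theta>|unit_cell. cmod (cell_poly g j l N \<theta>) powr p2) \<le> A2 * \<beta> + real (card L) * E2 N"
      using s2[OF g] unfolding \<beta>_def by blast
    have Tm [measurable]: "T \<in> borel_measurable borel"
      unfolding T_def by (rule bilinear_op_R_step_symbol_measurable[OF fm[OF f] Cf fm[OF g] Cg B])
    have fin: "(\<Sum>l\<in>{- int M..int M}. \<integral>\<^sup>+\<theta>. ennreal (cmod (T (of_int l + \<theta>)) powr p3) \<partial>unit_cell)
       \<le> ennreal (Q * (A1 * \<alpha>) powr (p3 / p1) * (A2 * \<beta>) powr (p3 / p2))" for M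
    proof -
      define L where "L = {- int M..int M}"
      have L: "finite L" by (simp add: L_def)
      have "(\<Sum>l\<in>L. \<integral>\<^sup>+\<theta>. ennreal (cmod (T (of_int l + \<theta>)) powr p3) \<partial>unit_cell)
         = (\<integral>\<^sup>+\<theta>. (\<Sum>l\<in>L. ennreal (cmod (T (of_int l + \<theta>)) powr p3)) \<partial>unit_cell)"
        by (rule nn_integral_sum[symmetric]) (auto intro!: unit_cell_measurable)
      also have "\<dots> \<le> ennreal (Q * (A1 * \<alpha>) powr (p3 / p1) * (A2 * \<beta>) powr (p3 / p2))"
      proof (rule nn_integral_le_of_pointwise_limit[where
            u = "\<lambda>N \<theta>. \<Sum>l\<in>L. ennreal (cmod (approximant \<phi> f g N l \<theta>) powr p3)" and
            c = "\<lambda>N. Q * (A1 * \<alpha> + real (card L) * E1 N) powr (p3 / p1) * (A2 * \<beta> + real (card L) * E2 N) powr (p3 / p2)"])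
        fix N
        show "(\<lambda>\<theta>. \<Sum>l\<in>L. ennreal (cmod (approximant \<phi> f g N l \<theta>) powr p3)) \<in> borel_measurable unit_cell"
          by (rule unit_cell_measurable) measurable
        show "(\<integral>\<^sup>+\<theta>. (\<Sum>l\<in>L. ennreal (cmod (approximant \<phi> f g N l \<theta>) powr p3)) \<partial>unit_cell)
          \<le> ennreal (Q * (A1 * \<alpha> + real (card L) * E1 N) powr (p3 / p1) * (A2 * \<beta> + real (card L) * E2 N) powr (p3 / p2))"
          unfolding Q_def by (rule approximant_power_sum[OF C bd pos(1,2) p3 r L b1[OF L] b2[OF L]])
      next
        fix \<theta> assume "\<theta> \<in> space unit_cell"
        then have \<theta>: "\<theta> \<in> J" by simp
        have "(\<lambda>N. cmod (approximant \<phi> f g N l \<theta>) powr p3) \<longlonglongrightarrow> cmod (T (of_int l + \<theta>)) powr p3" for l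
          using pos(3) unfolding T_def
          by (intro tendsto_powr2 tendsto_norm approximant_tendsto[OF fm[OF f] Cf fm[OF g] Cg B \<theta>]) auto
        then show "(\<lambda>N. \<Sum>l\<in>L. ennreal (cmod (approximant \<phi> f g N l \<theta>) powr p3)) \<longlonglongrightarrow> (\<Sum>l\<in>L. ennreal (cmod (T (of_int l + \<theta>)) powr p3))"
          by (intro tendsto_sum tendsto_ennrealI)
      next
        have "(\<lambda>N. A1 * \<alpha> + real (card L) * E1 N) \<longlonglongrightarrow> A1 * \<alpha> + real (card L) * 0"
          "(\<lambda>N. A2 * \<beta> + real (card L) * E2 N) \<longlonglongrightarrow> A2 * \<beta> + real (card L) * 0"
          by (intro tendsto_intros E1 E2)+
        moreover have "\<forall>\<^sub>F N in sequentially. 0 \<le> A1 * \<alpha> + real (card L) * E1 N" "\<forall>\<^sub>F N in sequentially. 0 \<le> A2 * \<beta> + real (card L) * E2 N"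
          using A1 A2 \<alpha>\<beta> E1(1) E2(1) by (auto intro!: always_eventually)
        ultimately have "(\<lambda>N. (A1 * \<alpha> + real (card L) * E1 N) powr (p3 / p1)) \<longlonglongrightarrow> (A1 * \<alpha>) powr (p3 / p1)"
          "(\<lambda>N. (A2 * \<beta> + real (card L) * E2 N) powr (p3 / p2)) \<longlonglongrightarrow> (A2 * \<beta>) powr (p3 / p2)"
          using tendsto_powr2[OF _ tendsto_const, of _ "A1 * \<alpha>" sequentially "p3 / p1"]
            tendsto_powr2[OF _ tendsto_const, of _ "A2 * \<beta>" sequentially "p3 / p2"] pos by simp_all
        then show "(\<lambda>N. Q * (A1 * \<alpha> + real (card L) * E1 N) powr (p3 / p1) * (A2 * \<beta> + real (card L) * E2 N) powr (p3 / p2))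
          \<longlonglongrightarrow> Q * (A1 * \<alpha>) powr (p3 / p1) * (A2 * \<beta>) powr (p3 / p2)"
          by (intro tendsto_mult tendsto_const)
      qed
      finally show ?thesis unfolding L_def .
    qed
    have "(\<integral>\<^sup>+x. ennreal (cmod (T x) powr p3) \<partial>lborel)
       = (SUP M. \<Sum>l\<in>{- int M..int M}. \<integral>\<^sup>+\<theta>. ennreal (cmod (T (of_int l + \<theta>)) powr p3) \<partial>unit_cell)"
      by (rule SUP_sum_unit_cell_translates[symmetric]) measurable
    also have "\<dots> \<le> ennreal (Q * (A1 * \<alpha>) powr (p3 / p1) * (A2 * \<beta>) powr (p3 / p2))"
      by (rule SUP_least) (rule fin)
    also have "Q * (A1 * \<alpha>) powr (p3 / p1) * (A2 * \<beta>) powr (p3 / p2)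
       = Q * A1 powr (p3 / p1) * A2 powr (p3 / p2) * \<alpha> powr (p3 / p1) * \<beta> powr (p3 / p2)"
      using A1 A2 \<alpha>\<beta> by (simp add: powr_mult)
    finally show "(\<integral>\<^sup>+x. ennreal (cmod (bilinear_op_R (\<lambda>(\<xi>, \<eta>). \<phi> (nearest \<xi>, nearest \<eta>)) f g x) powr p3) \<partial>lborel)
      \<le> ennreal (Q * A1 powr (p3 / p1) * A2 powr (p3 / p2) * (LINT x|lborel. cmod (f x) powr p1) powr (p3 / p1) * (LINT x|lborel. cmod (g x) powr p2) powr (p3 / p2))"
      unfolding T_def \<alpha>_def \<beta>_def .
  qed
qed

lemma lp_norm_schwartz:
  assumes "schwartz f" "p \<ge> 1"
  shows "lp_norm p lebesgue f = ennreal ((LINT x|lborel. cmod (f x) powr p) powr (1 / p))"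
  using assms by (intro lp_norm_eq) (auto simp: nn_integral_completion nn_integral_eq_integral schwartz_power_integrable)

theorem theorem4p5:
  fixes p1 p2 p3 :: real and \<phi> :: "int \<times> int \<Rightarrow> complex"
  assumes "holder_related p1 p2 p3" and "p1 > 1" and "p2 > 1"
    and "\<phi> \<in> multipliers_T p1 p2 p3"
  shows "(\<lambda>(\<xi>, \<eta>). \<Sum>\<^sub>\<infinity>(n, m)\<in>UNIV.
            \<phi> (n, m) * indicator (J \<times> J) (\<xi> - real_of_int n, \<eta> - real_of_int m))
         \<in> multipliers_R p1 p2 p3"
proof -
  define \<psi> where "\<psi> = (\<lambda>(\<xi>, \<eta>). \<phi> (nearest \<xi>, nearest \<eta>))"
  have pos: "p1 > 0" "p2 > 0" "p3 > 0" using assms by (auto simp: holder_related_def)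
  obtain K where K: "K \<ge> 0" and bd: "\<And>f g. schwartz f \<Longrightarrow> schwartz g \<Longrightarrow>
    (\<integral>\<^sup>+x. ennreal (cmod (bilinear_op_R \<psi> f g x) powr p3) \<partial>lborel)
      \<le> ennreal (K * (LINT x|lborel. cmod (f x) powr p1) powr (p3 / p1) * (LINT x|lborel. cmod (g x) powr p2) powr (p3 / p2))"
    using step_symbol_lp_bound[OF assms] unfolding \<psi>_def by blast
  have "\<psi> \<in> L_infinity_plane"
    using step_symbol_measurable[of \<phi>] multipliers_T_bounded[OF assms(4) pos]
    unfolding L_infinity_plane_def \<psi>_def by (auto simp: case_prod_beta' intro!: AE_I2)
  moreover have "lp_norm p3 lebesgue (bilinear_op_R \<psi> f g) \<le> ennreal (K powr (1 / p3)) * lp_norm p1 lebesgue f * lp_norm p2 lebesgue g"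
    if f: "schwartz f" and g: "schwartz g" for f g
  proof -
    define \<alpha> where "\<alpha> = (LINT x|lborel. cmod (f x) powr p1)"
    define \<beta> where "\<beta> = (LINT x|lborel. cmod (g x) powr p2)"
    have \<alpha>\<beta>: "\<alpha> \<ge> 0" "\<beta> \<ge> 0" unfolding \<alpha>_def \<beta>_def by (auto intro!: integral_nonneg)
    have "lp_norm p3 lebesgue (bilinear_op_R \<psi> f g) \<le> ennreal ((K * \<alpha> powr (p3 / p1) * \<beta> powr (p3 / p2)) powr (1 / p3))"
      using bd[OF f g] K pos by (intro lp_norm_le_of_nn_integral_le) (auto simp: nn_integral_completion \<alpha>_def \<beta>_def)
    also have "(K * \<alpha> powr (p3 / p1) * \<beta> powr (p3 / p2)) powr (1 / p3) = K powr (1 / p3) * \<alpha> powr (1 / p1) * \<beta> powr (1 / p2)"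
      using K \<alpha>\<beta> pos by (simp add: powr_mult powr_powr)
    also have "ennreal \<dots> = ennreal (K powr (1 / p3)) * lp_norm p1 lebesgue f * lp_norm p2 lebesgue g"
      using assms(2,3) by (simp add: lp_norm_schwartz f g \<alpha>_def \<beta>_def ennreal_mult)
    finally show ?thesis .
  qed
  ultimately have "\<psi> \<in> multipliers_R p1 p2 p3"
    unfolding multipliers_R_def by (auto intro!: exI[of _ "K powr (1 / p3)"])
  then show ?thesis unfolding step_symbol_eq \<psi>_def .
qed

end
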